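(* Let $d\ge 2$ be an integer. Assume that there exist real constants $\beta,\gamma>0$ such that $$\limsup_{p\to p_c,\ p>p_c}\ \frac{\ln\theta(p)}{\ln(p-p_c)}\ \leq\ \beta\qquad\text{and}\qquad\liminf_{p\to p_c,\ p<p_c}\ \frac{\ln\chi(p)}{\ln(p_c-p)}\ \geq\ -\gamma.$$ Let $a,b,c$ be real numbers such that $$0<b<a<d\qquad\text{and}\qquad c<\min\left(\frac{b}{2\gamma},\ \frac{a-b}{2\gamma},\ \frac{d-a}{\beta},\ \frac{d-bd-b}{\beta}\right).$$ Let $F_n(\omega)=|B_n^b(\omega)|=\big|\{x\in\Lambda(n):|C(x,\omega)|\geq n^b\}\big|$ for $\omega\in\{0,1\}^{\mathbb{E}_n}$, let $p_n(\omega)=\exp(-F_n(\omega)/n^a)$, and let $\mu_n$ be the probability measure on $\{0,1\}^{\mathbb{E}_n}$ given by $\mu_n(\omega)=\frac{1}{Z_n}\mathbb{P}_{p_n(\omega)}(\omega)$ with $Z_n=\sum_{\omega\in\{0,1\}^{\mathbb{E}_n}}\mathbb{P}_{p_n(\omega)}(\omega)$. Then, under $\mu_n$, the random variable $n^c(p_n-p_c)$ converges in law to $0$ as $n\to\infty$.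
   Context: $\Lambda(n)=[-n/2,n/2[^d\cap\mathbb{Z}^d$ is the box with $n^d$ vertices, and $\mathbb{E}_n=\{\{x,y\}\subset\Lambda(n):\|x-y\|_1=1\}$. For $\omega\in\{0,1\}^{\mathbb{E}_n}$, an edge $e$ is open if $\omega(e)=1$; $C(x,\omega)$ is the set of vertices of $\Lambda(n)$ joined to $x$ by a path of open edges of $\mathbb{E}_n$ (including $x$). For $\omega\in\{0,1\}^{\mathbb{E}_n}$, $\mathbb{P}_p(\omega)=\prod_{e\in\mathbb{E}_n}p^{\omega(e)}(1-p)^{1-\omega(e)}$. For Bernoulli bond percolation on $\mathbb{Z}^d$ (each nearest-neighbour edge open independently with probability $p$), $\theta(p)$ is the probability that the open cluster $C(0)$ of the origin is infinite, $p_c=\inf\{p\in[0,1]:\theta(p)>0\}$, and $\chi(p)$ is the mean of $|C(0)|$ conditioned on the event that $C(0)$ is finite (so for $p<p_c$, $\chi(p)$ is the expectation of $|C(0)|$). *)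

theory Defs
  imports "HOL-Probability.Probability"
begin

text \<open>
  The lattice is \<^typ>\<open>int ^ 'd\<close>, of dimension \<^term>\<open>CARD('d)\<close>. An edge is a two-element set of
  vertices, and a configuration \<open>\<omega>\<close> maps an edge to \<^const>\<open>True\<close> iff the edge is open.
\<close>

type_synonym 'd vertex = "int ^ 'd"
type_synonym 'd edge = "'d vertex set"
type_synonym 'd config = "'d edge \<Rightarrow> bool"

definition lattice_edges :: "'d::finite edge set" where
  "lattice_edges = {{x, y} | x y. (\<Sum>i\<in>UNIV. \<bar>x $ i - y $ i\<bar>) = 1}"

definition cluster :: "'d::finite edge set \<Rightarrow> 'd vertex \<Rightarrow> 'd config \<Rightarrow> 'd vertex set" where
  "cluster E x \<omega> = {y. (x, y) \<in> {(u, v). {u, v} \<in> E \<and> \<omega> {u, v}}\<^sup>*}"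

definition percolation :: "real \<Rightarrow> 'd::finite config measure" where
  "percolation p = (\<Pi>\<^sub>M e\<in>lattice_edges. measure_pmf (bernoulli_pmf p))"

definition finite_cluster_event :: "real \<Rightarrow> 'd::finite config set" where
  "finite_cluster_event p = {\<omega> \<in> space (percolation p). finite (cluster lattice_edges 0 \<omega>)}"

definition theta :: "'d::finite itself \<Rightarrow> real \<Rightarrow> real" where
  "theta _ p = measure (percolation p :: 'd config measure)
     {\<omega> \<in> space (percolation p). infinite (cluster lattice_edges 0 \<omega>)}"

definition p_c :: "'d::finite itself \<Rightarrow> real" where
  "p_c d = Inf {p \<in> {0..1}. theta d p > 0}"

text \<open>
  The conditional mean is taken with values in \<^typ>\<open>ennreal\<close>, so that an infinite mean is
  not confused with \<open>0\<close>.
\<close>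

definition chi :: "'d::finite itself \<Rightarrow> real \<Rightarrow> ennreal" where
  "chi _ p =
     (\<integral>\<^sup>+ \<omega> \<in> finite_cluster_event p. of_nat (card (cluster lattice_edges 0 \<omega>))
        \<partial>(percolation p :: 'd config measure))
     / emeasure (percolation p :: 'd config measure) (finite_cluster_event p)"

text \<open>
  The logarithm on \<open>[0, \<infinity>]\<close>; it avoids the convention \<^prop>\<open>ln (0::real) = 0\<close>.
\<close>

definition ext_ln :: "ennreal \<Rightarrow> ereal" where
  "ext_ln x = (if x = 0 then - \<infinity> else if x = \<infinity> then \<infinity> else ereal (ln (enn2real x)))"

definition box_vertices :: "nat \<Rightarrow> 'd::finite vertex set" where
  "box_vertices n =
     {x. \<forall>i. - real n / 2 \<le> real_of_int (x $ i) \<and> real_of_int (x $ i) < real n / 2}"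

definition box_edges :: "nat \<Rightarrow> 'd::finite edge set" where
  "box_edges n = {e \<in> lattice_edges. e \<subseteq> box_vertices n}"

definition box_configs :: "nat \<Rightarrow> 'd::finite config set" where
  "box_configs n = (\<Pi>\<^sub>E e\<in>box_edges n. UNIV)"

definition box_prob :: "nat \<Rightarrow> real \<Rightarrow> 'd::finite config \<Rightarrow> real" where
  "box_prob n p \<omega> = (\<Prod>e\<in>box_edges n. if \<omega> e then p else 1 - p)"

definition large_cluster_vertices ::
    "nat \<Rightarrow> real \<Rightarrow> 'd::finite config \<Rightarrow> 'd vertex set" where
  "large_cluster_vertices n b \<omega> =
     {x \<in> box_vertices n. real (card (cluster (box_edges n) x \<omega>)) \<ge> real n powr b}"

definition F_n :: "nat \<Rightarrow> real \<Rightarrow> 'd::finite config \<Rightarrow> nat" where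
  "F_n n b \<omega> = card (large_cluster_vertices n b \<omega>)"

definition p_n :: "nat \<Rightarrow> real \<Rightarrow> real \<Rightarrow> 'd::finite config \<Rightarrow> real" where
  "p_n n a b \<omega> = exp (- real (F_n n b \<omega>) / real n powr a)"

definition Z_n :: "'d::finite itself \<Rightarrow> nat \<Rightarrow> real \<Rightarrow> real \<Rightarrow> real" where
  "Z_n _ n a b = (\<Sum>\<omega> \<in> (box_configs n :: 'd config set). box_prob n (p_n n a b \<omega>) \<omega>)"

definition \<mu>_n :: "nat \<Rightarrow> real \<Rightarrow> real \<Rightarrow> 'd::finite config measure" where
  "\<mu>_n n a b = point_measure (box_configs n)
     (\<lambda>\<omega>. ennreal (1 / Z_n TYPE('d) n a b * box_prob n (p_n n a b \<omega>) \<omega>))"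

end

theory Submission
  imports Defs
begin

text \<open>
  Decomposing according to the value \<open>k\<close> of \<open>F\<^sub>n\<close>, the weight of \<open>F\<^sub>n = k\<close> under \<open>\<mu>\<^sub>n\<close> is, up to the factor \<open>1 / Z\<^sub>n\<close>,
  its probability under percolation of density \<open>\<phi>(k) = exp (- k / n\<^sup>a)\<close>.

  If \<open>\<phi>(k)\<close> is below \<open>p\<^sub>c\<close> by a multiple of \<open>n\<^bsup>-c\<^esup>\<close>, then \<open>k\<close> is of order at least \<open>n\<^sup>a\<close>, and \<open>F\<^sub>n \<ge> k\<close> has
  probability at most about \<open>exp (- n\<^sup>a / \<chi>\<^sup>2)\<close>: a tree-graph argument gives the cluster size an
  exponential moment of rate \<open>\<chi>\<^bsup>-2\<^esup>\<close>, and exploring the clusters one after the other decouples them.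
  If \<open>\<phi>(k)\<close> is above \<open>p\<^sub>c\<close> by as much, then \<open>F\<^sub>n \<le> k\<close> forces a large deviation of a sum over
  \<open>n\<^bsup>d - b d\<^esup>\<close> independent boxes and has probability at most about \<open>exp (- n\<^bsup>d - b d\<^esup> \<theta>)\<close>.

  Both bounds beat \<open>Z\<^sub>n \<ge> exp (- C n\<^sup>b ln n)\<close>, which is proved as follows. Take the last \<open>k\<close> for which
  \<open>F\<^sub>n \<ge> k\<close> is likely at density \<open>\<phi>(k)\<close>. Either \<open>F\<^sub>n = k\<close> is likely, or at density \<open>\<phi>(k + 1)\<close> the event
  \<open>F\<^sub>n \<ge> k + 1\<close> is neither too rare nor too likely. One edge changes \<open>F\<^sub>n\<close> by at most \<open>2 n\<^sup>b\<close>, so by the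
  Efron--Stein inequality \<open>F\<^sub>n\<close> is slightly below \<open>k + 1\<close> with at least polynomial probability, and
  modifying \<open>O(n\<^sup>b)\<close> edges makes it equal to \<open>k + 1\<close>. Besides, \<open>p\<^sub>c < 1\<close> is needed, by Peierls' argument.
\<close>

text \<open>Each of the four terms bounding \<open>c\<close> pays for one comparison of exponents at
  distance n^(-c) from the threshold, where \<chi> is at most about n^(c \<gamma>) and \<theta> at
  least about n^(-c \<beta>). Below: clusters of size n^b must already be rare, so n^b / \<chi>^2
  has to grow (2 c \<gamma> < b), and the gain n^a / \<chi>^2 has to exceed n^b (2 c \<gamma> < a -
  b). Above: the gain n^(d - b d) \<theta> has to exceed the cost k / n^(b d), at most about n^(a -
  b d) ln n, of the exponential bound (c \<beta> < d - a), and also n^b (c \<beta> < d - b d - b).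
  The obstacle is the lower bound on \<open>Z_n\<close>: a value k of the count is needed that is
  typical at its own density, and the density itself moves with k. Passing from \<phi>(k) to
  \<phi>(k + 1) is a thinning by r = \<phi>(1), and keeping witnesses of m edges for each of k + 1
  vertices costs r^((k + 1) m). Since r^(k + 1) = \<phi>(k + 1), this is only \<phi>(k + 1)^m, a
  power of n with exponent of order m, that is n^b, however large k is.\<close>

subsection \<open>Expectations over sets of open edges\<close>

text \<open>
  The expectation of \<open>f S\<close>, where \<open>S\<close> is the set of open edges of Bernoulli percolation of density \<open>p\<close>
  on the edge set \<open>E\<close>.
\<close>

definition bexp :: "real \<Rightarrow> 'e set \<Rightarrow> ('e set \<Rightarrow> real) \<Rightarrow> real" where
  "bexp p E f = (\<Sum>S\<in>Pow E. p ^ card S * (1 - p) ^ card (E - S) * f S)"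

lemma bexp_empty [simp]: "bexp p {} f = f {}"
  by (simp add: bexp_def)

lemma bexp_insert:
  assumes "finite E" "e \<notin> E"
  shows "bexp p (insert e E) f = p * bexp p E (\<lambda>S. f (insert e S)) + (1 - p) * bexp p E f"
proof -
  have inj: "inj_on (insert e) (Pow E)"
    using assms by (auto simp: inj_on_def)
  have disj: "Pow E \<inter> insert e ` Pow E = {}"
    using assms by auto
  have 1: "(\<Sum>S\<in>insert e ` Pow E. p ^ card S * (1 - p) ^ card (insert e E - S) * f S)
      = p * bexp p E (\<lambda>S. f (insert e S))"
    unfolding bexp_def sum.reindex[OF inj] sum_distrib_left o_def
  proof (rule sum.cong)
    fix S assume S: "S \<in> Pow E"
    then have "finite S" "e \<notin> S" using assms finite_subset by auto
    moreover have "insert e E - insert e S = E - S" using S assms by auto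
    ultimately show "p ^ card (insert e S) * (1 - p) ^ card (insert e E - insert e S) * f (insert e S)
       = p * (p ^ card S * (1 - p) ^ card (E - S) * f (insert e S))" by simp
  qed simp
  have 2: "(\<Sum>S\<in>Pow E. p ^ card S * (1 - p) ^ card (insert e E - S) * f S) = (1 - p) * bexp p E f"
    unfolding bexp_def sum_distrib_left
  proof (rule sum.cong)
    fix S assume S: "S \<in> Pow E"
    then have "insert e E - S = insert e (E - S)" "e \<notin> E - S" "finite (E - S)" using assms by auto
    then show "p ^ card S * (1 - p) ^ card (insert e E - S) * f S
       = (1 - p) * (p ^ card S * (1 - p) ^ card (E - S) * f S)" by simp
  qed simp
  show ?thesis
    unfolding bexp_def[of _ "insert e E"] Pow_insert
    by (subst sum.union_disjoint) (use assms disj 1 2 in auto)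
qed

lemma bexp_cong:
  assumes "\<And>S. S \<subseteq> E \<Longrightarrow> f S = g S"
  shows "bexp p E f = bexp p E g"
  unfolding bexp_def by (rule sum.cong) (use assms in auto)

lemma bexp_mono:
  assumes "0 \<le> p" "p \<le> 1" "\<And>S. S \<subseteq> E \<Longrightarrow> f S \<le> g S"
  shows "bexp p E f \<le> bexp p E g"
  unfolding bexp_def by (rule sum_mono) (use assms in \<open>auto intro!: mult_left_mono\<close>)

lemma bexp_add: "bexp p E (\<lambda>S. f S + g S) = bexp p E f + bexp p E g"
  by (simp add: bexp_def sum.distrib distrib_left)

lemma bexp_diff: "bexp p E (\<lambda>S. f S - g S) = bexp p E f - bexp p E g"
  by (simp add: bexp_def sum_subtractf right_diff_distrib)

lemma bexp_cmult: "bexp p E (\<lambda>S. c * f S) = c * bexp p E f"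
  unfolding bexp_def sum_distrib_left by (rule sum.cong) simp_all

lemma bexp_cmult_right: "bexp p E (\<lambda>S. f S * c) = bexp p E f * c"
  unfolding bexp_def sum_distrib_right by (rule sum.cong) simp_all

lemma bexp_sum: "bexp p E (\<lambda>S. \<Sum>i\<in>I. f i S) = (\<Sum>i\<in>I. bexp p E (f i))"
  unfolding bexp_def sum_distrib_left by (rule sum.swap)

lemma bexp_const: "finite E \<Longrightarrow> bexp p E (\<lambda>S. c) = c"
proof (induction E rule: finite_induct)
  case (insert e E)
  then show ?case by (simp add: bexp_insert algebra_simps)
qed simp

lemma bexp_nonneg:
  assumes "0 \<le> p" "p \<le> 1" "\<And>S. S \<subseteq> E \<Longrightarrow> 0 \<le> f S"
  shows "0 \<le> bexp p E f"
  unfolding bexp_def by (rule sum_nonneg) (use assms in auto)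

lemma bexp_le_const:
  assumes "finite E" "0 \<le> p" "p \<le> 1" "\<And>S. S \<subseteq> E \<Longrightarrow> f S \<le> c"
  shows "bexp p E f \<le> c"
  using bexp_mono[OF assms(2,3), of E f "\<lambda>_. c"] assms by (simp add: bexp_const)

lemma bexp_ge_const:
  assumes "finite E" "0 \<le> p" "p \<le> 1" "\<And>S. S \<subseteq> E \<Longrightarrow> c \<le> f S"
  shows "c \<le> bexp p E f"
  using bexp_mono[OF assms(2,3), of E "\<lambda>_. c" f] assms by (simp add: bexp_const)

lemma bexp_union:
  assumes "finite A" "finite B" "A \<inter> B = {}"
  shows "bexp p (A \<union> B) f = bexp p A (\<lambda>S. bexp p B (\<lambda>T. f (S \<union> T)))"
  using assms
proof (induction A arbitrary: f rule: finite_induct)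
  case (insert e A)
  have "bexp p (insert e (A \<union> B)) f
      = p * bexp p (A \<union> B) (\<lambda>S. f (insert e S)) + (1 - p) * bexp p (A \<union> B) f"
    by (rule bexp_insert) (use insert in auto)
  also have "\<dots> = bexp p (insert e A) (\<lambda>S. bexp p B (\<lambda>T. f (S \<union> T)))"
    using insert by (simp add: bexp_insert)
  finally show ?case by simp
qed simp

text \<open>Independence of the edges inside and outside \<open>B\<close>. Both factors read the
  same set \<open>S\<close>, so the rule applies term by term once an expectation has been split
  over the possible values of a cluster.\<close>

lemma bexp_factor:
  assumes "finite E" "B \<subseteq> E"
  shows "bexp p E (\<lambda>S. f (S - B) * g (S \<inter> B)) = bexp p (E - B) f * bexp p B g"
proof -
  have "bexp p ((E - B) \<union> B) (\<lambda>S. f (S - B) * g (S \<inter> B))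
     = bexp p (E - B) (\<lambda>S. bexp p B (\<lambda>T. f ((S \<union> T) - B) * g ((S \<union> T) \<inter> B)))"
    by (rule bexp_union) (use assms finite_subset in auto)
  also have "\<dots> = bexp p (E - B) (\<lambda>S. bexp p B (\<lambda>T. f S * g T))"
  proof (intro bexp_cong)
    fix S T assume "S \<subseteq> E - B" "T \<subseteq> B"
    then have "(S \<union> T) - B = S" "(S \<union> T) \<inter> B = T" by auto
    then show "f ((S \<union> T) - B) * g ((S \<union> T) \<inter> B) = f S * g T" by simp
  qed
  also have "\<dots> = bexp p (E - B) f * bexp p B g"
    by (simp add: bexp_cmult bexp_cmult_right)
  finally show ?thesis using assms by (simp add: Un_absorb2)
qed

lemma bexp_restrict:
  assumes "finite E" "B \<subseteq> E"
  shows "bexp p E (\<lambda>S. g (S \<inter> B)) = bexp p B g"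
  using bexp_factor[OF assms, of p "\<lambda>_. 1" g] assms by (simp add: bexp_const)

lemma bexp_prod_disjoint:
  assumes "finite J" "\<And>j. j \<in> J \<Longrightarrow> finite (D j)" "disjoint_family_on D J"
  shows "bexp p (\<Union>j\<in>J. D j) (\<lambda>S. \<Prod>j\<in>J. f j (S \<inter> D j)) = (\<Prod>j\<in>J. bexp p (D j) (f j))"
  using assms
proof (induction J rule: finite_induct)
  case (insert i J)
  let ?U = "\<Union>j\<in>J. D j"
  have fin: "finite (D i \<union> ?U)" using insert by auto
  have disj: "D i \<inter> ?U = {}"
    using insert by (auto simp: disjoint_family_on_def)
  have dU: "(D i \<union> ?U) - ?U = D i" using disj by auto
  have "bexp p (D i \<union> ?U) (\<lambda>S. \<Prod>j\<in>insert i J. f j (S \<inter> D j))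
      = bexp p (D i \<union> ?U) (\<lambda>S. f i (S - ?U) * (\<Prod>j\<in>J. f j ((S \<inter> ?U) \<inter> D j)))"
  proof (rule bexp_cong)
    fix S assume "S \<subseteq> D i \<union> ?U"
    then have "S \<inter> D i = S - ?U" using disj by auto
    moreover have "(\<Prod>j\<in>J. f j (S \<inter> D j)) = (\<Prod>j\<in>J. f j ((S \<inter> ?U) \<inter> D j))"
    proof (rule prod.cong)
      fix j assume "j \<in> J"
      then have "S \<inter> D j = S \<inter> ?U \<inter> D j" by auto
      then show "f j (S \<inter> D j) = f j (S \<inter> ?U \<inter> D j)" by simp
    qed simp
    ultimately show "(\<Prod>j\<in>insert i J. f j (S \<inter> D j))
        = f i (S - ?U) * (\<Prod>j\<in>J. f j ((S \<inter> ?U) \<inter> D j))"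
      using insert by simp
  qed
  also have "\<dots> = bexp p (D i) (f i) * bexp p ?U (\<lambda>S. \<Prod>j\<in>J. f j (S \<inter> D j))"
    using bexp_factor[OF fin, of ?U p "f i" "\<lambda>S. \<Prod>j\<in>J. f j (S \<inter> D j)"] dU by simp
  also have "\<dots> = (\<Prod>j\<in>insert i J. bexp p (D j) (f j))"
    using insert by (simp add: disjoint_family_on_def)
  finally show ?case by simp
qed simp

lemma bexp_image:
  assumes "finite E" "inj_on h E"
  shows "bexp p (h ` E) f = bexp p E (\<lambda>S. f (h ` S))"
  using assms
proof (induction E arbitrary: f rule: finite_induct)
  case (insert e E)
  then have "h e \<notin> h ` E" "inj_on h E" by auto
  with insert show ?case by (simp add: bexp_insert)
qed simp

text \<open>Keeping each open edge independently with probability \<open>r\<close> multiplies the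
  density by \<open>r\<close>. This coupling gives both the monotonicity in the density and the
  lower bound for thinned events.\<close>

lemma bexp_thinning:
  assumes "finite E"
  shows "bexp (p * r) E f = bexp p E (\<lambda>S. bexp r E (\<lambda>T. f (S \<inter> T)))"
  using assms
proof (induction E arbitrary: f rule: finite_induct)
  case (insert e E)
  have *: "bexp p E (\<lambda>S. bexp r (insert e E) (\<lambda>T. f (S \<inter> T))) = bexp p E (\<lambda>S. bexp r E (\<lambda>T. f (S \<inter> T)))"
  proof (rule bexp_cong)
    fix S assume "S \<subseteq> E"
    then have "S \<inter> insert e T = S \<inter> T" for T using insert by auto
    then show "bexp r (insert e E) (\<lambda>T. f (S \<inter> T)) = bexp r E (\<lambda>T. f (S \<inter> T))"
      using insert by (simp add: bexp_insert) (simp add: algebra_simps)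
  qed
  have **: "bexp p E (\<lambda>S. bexp r (insert e E) (\<lambda>T. f (insert e S \<inter> T)))
     = r * bexp p E (\<lambda>S. bexp r E (\<lambda>T. f (insert e (S \<inter> T))))
       + (1 - r) * bexp p E (\<lambda>S. bexp r E (\<lambda>T. f (S \<inter> T)))"
  proof -
    have "bexp r (insert e E) (\<lambda>T. f (insert e S \<inter> T))
      = r * bexp r E (\<lambda>T. f (insert e (S \<inter> T))) + (1 - r) * bexp r E (\<lambda>T. f (S \<inter> T))" for S
    proof -
      have "bexp r E (\<lambda>T. f (insert e S \<inter> T)) = bexp r E (\<lambda>T. f (S \<inter> T))"
      proof (rule bexp_cong)
        fix T assume "T \<subseteq> E"
        then have "insert e S \<inter> T = S \<inter> T" using insert by auto
        then show "f (insert e S \<inter> T) = f (S \<inter> T)" by simp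
      qed
      then show ?thesis using insert by (simp add: bexp_insert)
    qed
    then show ?thesis by (simp add: bexp_add bexp_cmult)
  qed
  show ?case
    using insert
      insert.IH[of f] insert.IH[of "\<lambda>S. f (insert e S)"]
    by (simp add: bexp_insert[of E e "p * r"] bexp_insert[of E e p] * **) (simp add: algebra_simps)
qed simp

lemma bexp_mono_density:
  assumes "finite E" "0 \<le> p" "p \<le> p'" "p' \<le> 1"
    and mono: "\<And>S T. S \<subseteq> T \<Longrightarrow> T \<subseteq> E \<Longrightarrow> f S \<le> f T"
  shows "bexp p E f \<le> bexp p' E f"
proof (cases "p' = 0")
  case False
  define r where "r = p / p'"
  have r: "0 \<le> r" "r \<le> 1" "p = p' * r" using False assms by (auto simp: r_def)
  have "bexp p E f = bexp p' E (\<lambda>S. bexp r E (\<lambda>T. f (S \<inter> T)))"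
    unfolding r(3) by (rule bexp_thinning) fact
  also have "\<dots> \<le> bexp p' E f"
    by (intro bexp_mono bexp_le_const) (use assms r mono in auto)
  finally show ?thesis .
qed (use assms in auto)

text \<open>A thinned configuration still satisfies \<open>A\<close> if it keeps one witness
  \<open>W\<close>, which has probability \<open>r ^ card W\<close>. The loss depends on the size of
  the witness and not on that of \<open>E\<close>.\<close>

lemma bexp_thinning_certificate:
  assumes "finite E" "0 \<le> p" "p \<le> 1" "0 \<le> r" "r \<le> 1"
    and mono: "\<And>S T. S \<subseteq> T \<Longrightarrow> T \<subseteq> E \<Longrightarrow> A S \<Longrightarrow> A T"
    and cert: "\<And>S. S \<subseteq> E \<Longrightarrow> A S \<Longrightarrow> \<exists>W\<subseteq>S. card W \<le> w \<and> A W"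
  shows "r ^ w * bexp p E (\<lambda>S. of_bool (A S)) \<le> bexp (p * r) E (\<lambda>S. of_bool (A S))"
proof -
  have superset: "bexp r E (\<lambda>T. of_bool (W \<subseteq> T)) = r ^ card W" if "W \<subseteq> E" for W
  proof -
    have "finite W" using that assms(1) finite_subset by auto
    have "bexp r E (\<lambda>T. of_bool (W \<subseteq> T)) = bexp r E (\<lambda>T. of_bool (W \<subseteq> T \<inter> W))"
      by (rule bexp_cong) simp
    also have "\<dots> = bexp r W (\<lambda>T. of_bool (W \<subseteq> T))"
      by (rule bexp_restrict[of E W r "\<lambda>T. of_bool (W \<subseteq> T)"]) (use assms that in auto)
    also have "\<dots> = r ^ card W"
    proof -
      have "bexp r W (\<lambda>T. of_bool (W \<subseteq> T)) = (\<Sum>T\<in>{W}. r ^ card T * (1 - r) ^ card (W - T) * of_bool (W \<subseteq> T))"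
        unfolding bexp_def by (rule sum.mono_neutral_right) (use \<open>finite W\<close> in auto)
      then show ?thesis by simp
    qed
    finally show ?thesis .
  qed
  have "r ^ w * bexp p E (\<lambda>S. of_bool (A S)) = bexp p E (\<lambda>S. r ^ w * of_bool (A S))"
    by (simp add: bexp_cmult)
  also have "\<dots> \<le> bexp p E (\<lambda>S. bexp r E (\<lambda>T. of_bool (A (S \<inter> T))))"
  proof (rule bexp_mono)
    fix S assume S: "S \<subseteq> E"
    show "r ^ w * of_bool (A S) \<le> bexp r E (\<lambda>T. of_bool (A (S \<inter> T)))"
    proof (cases "A S")
      case True
      then obtain W where W: "W \<subseteq> S" "card W \<le> w" "A W" using cert S by blast
      have "r ^ w \<le> r ^ card W" by (rule power_decreasing) (use W assms in auto)
      also have "\<dots> = bexp r E (\<lambda>T. of_bool (W \<subseteq> T))" using superset W S by auto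
      also have "\<dots> \<le> bexp r E (\<lambda>T. of_bool (A (S \<inter> T)))"
      proof (rule bexp_mono)
        fix T assume "T \<subseteq> E"
        have "A (S \<inter> T)" if "W \<subseteq> T" by (rule mono[OF _ _ \<open>A W\<close>]) (use that W S in auto)
        then show "(of_bool (W \<subseteq> T) :: real) \<le> of_bool (A (S \<inter> T))" by auto
      qed (use assms in auto)
      finally show ?thesis using True by simp
    qed (use assms in \<open>auto intro!: bexp_nonneg\<close>)
  qed (use assms in auto)
  also have "\<dots> = bexp (p * r) E (\<lambda>S. of_bool (A S))"
    by (rule bexp_thinning[symmetric]) fact
  finally show ?thesis .
qed

text \<open>Conditioning on one edge \<open>e\<close>: the variance is the average of the two
  conditional variances plus \<open>p * (1 - p)\<close> times the squared difference of the
  conditional means. Jensen's inequality turns that square into the influence term of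
  \<open>e\<close>, and induction handles the rest.\<close>

lemma bexp_Efron_Stein:
  assumes "finite E" "0 \<le> p" "p \<le> 1"
  shows "bexp p E (\<lambda>S. (f S)\<^sup>2) - (bexp p E f)\<^sup>2
    \<le> (\<Sum>e\<in>E. p * (1 - p) * bexp p E (\<lambda>S. (f (insert e S) - f (S - {e}))\<^sup>2))"
  using assms(1)
proof (induction E arbitrary: f rule: finite_induct)
  case (insert e E)
  define f1 where "f1 = (\<lambda>S. f (insert e S))"
  define I where "I = (\<lambda>g e. bexp p E (\<lambda>S. (g (insert e S) - g (S - {e}))\<^sup>2))"
  have sq: "(bexp p E g)\<^sup>2 \<le> bexp p E (\<lambda>S. (g S)\<^sup>2)" for g
  proof -
    let ?\<mu> = "bexp p E g"
    have "0 \<le> bexp p E (\<lambda>S. (g S - ?\<mu>)\<^sup>2)" by (rule bexp_nonneg) (use assms in auto)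
    also have "\<dots> = bexp p E (\<lambda>S. (g S)\<^sup>2 - 2 * ?\<mu> * g S + ?\<mu>\<^sup>2)"
      by (rule bexp_cong) (simp add: power2_eq_square algebra_simps)
    also have "\<dots> = bexp p E (\<lambda>S. (g S)\<^sup>2) - ?\<mu>\<^sup>2"
      using insert by (simp add: bexp_add bexp_diff bexp_cmult bexp_const power2_eq_square)
    finally show ?thesis by simp
  qed
  have e_term: "bexp p (insert e E) (\<lambda>S. (f (insert e S) - f (S - {e}))\<^sup>2)
      = bexp p E (\<lambda>S. (f1 S - f S)\<^sup>2)"
  proof -
    have 1: "bexp p E (\<lambda>S. (f (insert e (insert e S)) - f (insert e S - {e}))\<^sup>2)
       = bexp p E (\<lambda>S. (f1 S - f S)\<^sup>2)"
    proof (rule bexp_cong)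
      fix S assume "S \<subseteq> E"
      then have "insert e S - {e} = S" using insert by auto
      then show "(f (insert e (insert e S)) - f (insert e S - {e}))\<^sup>2 = (f1 S - f S)\<^sup>2"
        by (simp add: f1_def)
    qed
    have 2: "bexp p E (\<lambda>S. (f (insert e S) - f (S - {e}))\<^sup>2) = bexp p E (\<lambda>S. (f1 S - f S)\<^sup>2)"
    proof (rule bexp_cong)
      fix S assume "S \<subseteq> E"
      then have "S - {e} = S" using insert by auto
      then show "(f (insert e S) - f (S - {e}))\<^sup>2 = (f1 S - f S)\<^sup>2" by (simp add: f1_def)
    qed
    show ?thesis using insert 1 2 by (simp add: bexp_insert) (simp add: algebra_simps)
  qed
  have other: "bexp p (insert e E) (\<lambda>S. (f (insert i S) - f (S - {i}))\<^sup>2) = p * I f1 i + (1 - p) * I f i"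
    if "i \<in> E" for i
  proof -
    have ne: "i \<noteq> e" using that insert by auto
    have "insert e S - {i} = insert e (S - {i})" for S using ne by auto
    then show ?thesis using insert by (simp add: bexp_insert I_def f1_def insert_commute)
  qed
  have "bexp p (insert e E) (\<lambda>S. (f S)\<^sup>2) - (bexp p (insert e E) f)\<^sup>2
     = p * (bexp p E (\<lambda>S. (f1 S)\<^sup>2) - (bexp p E f1)\<^sup>2) + (1 - p) * (bexp p E (\<lambda>S. (f S)\<^sup>2) - (bexp p E f)\<^sup>2)
       + p * (1 - p) * (bexp p E f1 - bexp p E f)\<^sup>2"
    using insert by (simp add: bexp_insert f1_def) (simp add: power2_eq_square algebra_simps)
  also have "\<dots> \<le> p * (\<Sum>i\<in>E. p * (1 - p) * I f1 i) + (1 - p) * (\<Sum>i\<in>E. p * (1 - p) * I f i)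
       + p * (1 - p) * bexp p E (\<lambda>S. (f1 S - f S)\<^sup>2)"
  proof (intro add_mono mult_left_mono)
    show "(bexp p E f1 - bexp p E f)\<^sup>2 \<le> bexp p E (\<lambda>S. (f1 S - f S)\<^sup>2)"
      using sq[of "\<lambda>S. f1 S - f S"] by (simp add: bexp_diff)
  qed (use assms insert.IH I_def in auto)
  also have "\<dots> = (\<Sum>i\<in>E. p * (1 - p) * (p * I f1 i + (1 - p) * I f i))
       + p * (1 - p) * bexp p E (\<lambda>S. (f1 S - f S)\<^sup>2)"
    by (simp add: sum_distrib_left sum.distrib[symmetric] algebra_simps)
  also have "\<dots> = (\<Sum>i\<in>insert e E. p * (1 - p) * bexp p (insert e E) (\<lambda>S. (f (insert i S) - f (S - {i}))\<^sup>2))"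
    using insert by (simp add: other e_term)
  finally show ?case .
qed simp

text \<open>The variance of an indicator is the product on the left. Whether \<open>e\<close> is
  pivotal does not depend on the state of \<open>e\<close>, so its influence weighted by
  \<open>1 - p\<close> is the probability that \<open>e\<close> is closed and pivotal; each such
  event lies in the boundary event on the right.\<close>

lemma bexp_pivotal:
  assumes "finite E" "0 \<le> p" "p \<le> 1"
    and mono: "\<And>S T. S \<subseteq> T \<Longrightarrow> T \<subseteq> E \<Longrightarrow> A S \<Longrightarrow> A T"
  shows "bexp p E (\<lambda>S. of_bool (A S)) * bexp p E (\<lambda>S. of_bool (\<not> A S))
    \<le> card E * bexp p E (\<lambda>S. of_bool (\<not> A S \<and> (\<exists>e\<in>E. A (insert e S))))"
proof -
  let ?f = "\<lambda>S. of_bool (A S) :: real"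
  let ?B = "bexp p E (\<lambda>S. of_bool (\<not> A S \<and> (\<exists>e\<in>E. A (insert e S))))"
  have neg: "bexp p E (\<lambda>S. of_bool (\<not> A S)) = 1 - bexp p E ?f"
  proof -
    have "bexp p E (\<lambda>S. of_bool (\<not> A S)) = bexp p E (\<lambda>S. 1 - ?f S)" by (rule bexp_cong) simp
    then show ?thesis using assms by (simp add: bexp_diff bexp_const)
  qed
  have "bexp p E ?f * (1 - bexp p E ?f) = bexp p E (\<lambda>S. (?f S)\<^sup>2) - (bexp p E ?f)\<^sup>2"
  proof -
    have "bexp p E (\<lambda>S. (?f S)\<^sup>2) = bexp p E ?f" by (rule bexp_cong) simp
    then show ?thesis by (simp add: power2_eq_square algebra_simps)
  qed
  also have "\<dots> \<le> (\<Sum>e\<in>E. p * (1 - p) * bexp p E (\<lambda>S. (?f (insert e S) - ?f (S - {e}))\<^sup>2))"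
    by (rule bexp_Efron_Stein) fact+
  also have "\<dots> \<le> (\<Sum>e\<in>E. ?B)"
  proof (rule sum_mono)
    fix e assume e: "e \<in> E"
    define g where "g = (\<lambda>S. (?f (insert e S) - ?f (S - {e}))\<^sup>2)"
    have fin: "finite (E - {e})" and E: "E = insert e (E - {e})" using assms e by auto
    have g: "g (insert e S) = g S" for S by (simp add: g_def)
    have g0: "g S \<ge> 0" for S by (simp add: g_def)
    have "bexp p E g = p * bexp p (E - {e}) (\<lambda>S. g (insert e S)) + (1 - p) * bexp p (E - {e}) g"
      by (subst E) (rule bexp_insert, use fin in auto)
    then have gE: "bexp p E g = bexp p (E - {e}) g" by (simp add: g) (simp add: algebra_simps)
    have nn: "0 \<le> bexp p (E - {e}) g" by (rule bexp_nonneg) (use assms g0 in auto)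
    have "p * (1 - p) * bexp p E g \<le> 1 * (1 - p) * bexp p (E - {e}) g"
      unfolding gE by (intro mult_right_mono nn) (use assms in auto)
    also have "\<dots> = bexp p E (\<lambda>S. of_bool (e \<notin> S) * g S)"
    proof -
      have "bexp p E (\<lambda>S. of_bool (e \<notin> S) * g S) = p * bexp p (E - {e}) (\<lambda>S. of_bool (e \<notin> insert e S) * g (insert e S))
         + (1 - p) * bexp p (E - {e}) (\<lambda>S. of_bool (e \<notin> S) * g S)"
        by (subst E) (rule bexp_insert, use fin in auto)
      also have "bexp p (E - {e}) (\<lambda>S. of_bool (e \<notin> insert e S) * g (insert e S)) = 0"
        by (simp add: bexp_def)
      also have "bexp p (E - {e}) (\<lambda>S. of_bool (e \<notin> S) * g S) = bexp p (E - {e}) g"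
        by (rule bexp_cong) auto
      finally show ?thesis by simp
    qed
    also have "\<dots> \<le> ?B"
    proof (rule bexp_mono)
      fix S assume S: "S \<subseteq> E"
      show "of_bool (e \<notin> S) * g S \<le> of_bool (\<not> A S \<and> (\<exists>e\<in>E. A (insert e S)))"
      proof (cases "e \<notin> S \<and> A (insert e S) \<noteq> A S")
        case True
        then have "A (insert e S)" "\<not> A S" using mono[of S "insert e S"] S e by auto
        then show ?thesis using e by (auto simp: g_def)
      qed (auto simp: g_def)
    qed (use assms in auto)
    finally show "p * (1 - p) * bexp p E (\<lambda>S. (?f (insert e S) - ?f (S - {e}))\<^sup>2) \<le> ?B"
      by (simp add: g_def)
  qed
  finally show ?thesis by (simp add: neg)
qed

subsection \<open>The van den Berg--Kesten inequality\<close>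

text \<open>
  For increasing \<open>Q\<close>, sharing one edge between the two arguments is less favourable than giving
  each argument its own independent copy of that edge.
\<close>

lemma bexp_disjoint_occurrence_pair:
  assumes "finite E" "0 \<le> p" "p \<le> 1"
    and "\<And>I J I' J'. Q I J \<Longrightarrow> I \<subseteq> I' \<Longrightarrow> J \<subseteq> J' \<Longrightarrow> Q I' J'"
  shows "bexp p E (\<lambda>S. of_bool (\<exists>I J. I \<subseteq> S \<and> J \<subseteq> S \<and> I \<inter> J = {} \<and> Q I J))
    \<le> bexp p E (\<lambda>S. bexp p E (\<lambda>T. of_bool (Q S T)))"
  using assms(1,4)
proof (induction E arbitrary: Q rule: finite_induct)
  case empty
  then show ?case by auto
next
  case (insert e E)
  define box where "box = (\<lambda>Q (S :: 'a set). \<exists>I J. I \<subseteq> S \<and> J \<subseteq> S \<and> I \<inter> J = {} \<and> (Q I J :: bool))"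
  define Q10 where "Q10 = (\<lambda>I J. Q (insert e I) J)"
  define Q01 where "Q01 = (\<lambda>I J. Q I (insert e J))"
  define Q11 where "Q11 = (\<lambda>I J. Q (insert e I) (insert e J))"
  note mono = insert.prems
  have box_le: "bexp p E (\<lambda>S. of_bool (box R S)) \<le> bexp p E (\<lambda>S. bexp p E (\<lambda>T. of_bool (R S T)))"
    if "R \<in> {Q, Q10, Q01, Q11}" for R
  proof -
    have "R I' J'" if "R I J" "I \<subseteq> I'" "J \<subseteq> J'" for I J I' J'
    proof -
      have "Q10 I J \<Longrightarrow> Q10 I' J'" "Q01 I J \<Longrightarrow> Q01 I' J'" "Q11 I J \<Longrightarrow> Q11 I' J'" "Q I J \<Longrightarrow> Q I' J'"
        unfolding Q10_def Q01_def Q11_def by (erule mono; use \<open>I \<subseteq> I'\<close> \<open>J \<subseteq> J'\<close> in blast)+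
      then show ?thesis using \<open>R \<in> _\<close> \<open>R I J\<close> by auto
    qed
    then show ?thesis unfolding box_def by (rule insert.IH)
  qed
  have sub: "box Q S \<Longrightarrow> box Q10 S" "box Q S \<Longrightarrow> box Q01 S" "box Q10 S \<Longrightarrow> box Q11 S" "box Q01 S \<Longrightarrow> box Q11 S" for S
  proof -
    have R: "box R S" if "box Q' S" "\<And>I J. Q' I J \<Longrightarrow> R I J" for R Q'
      using that unfolding box_def by blast
    show "box Q S \<Longrightarrow> box Q10 S" "box Q S \<Longrightarrow> box Q01 S" "box Q10 S \<Longrightarrow> box Q11 S" "box Q01 S \<Longrightarrow> box Q11 S"
      by (erule R; unfold Q10_def Q01_def Q11_def; erule mono; blast)+
  qed
  \<comment> \<open>The witnesses are disjoint, so at most one of them uses the edge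
    \<open>e\<close>.\<close>
  have ins: "box Q (insert e S) \<Longrightarrow> box Q10 S \<or> box Q01 S" for S
  proof -
    assume "box Q (insert e S)"
    then obtain I J where IJ: "I \<subseteq> insert e S" "J \<subseteq> insert e S" "I \<inter> J = {}" "Q I J"
      unfolding box_def by blast
    show "box Q10 S \<or> box Q01 S"
    proof (cases "e \<in> I")
      case True
      then have "I - {e} \<subseteq> S" "J \<subseteq> S" "(I - {e}) \<inter> J = {}" "insert e (I - {e}) = I" using IJ by auto
      then have "box Q10 S" unfolding box_def Q10_def using IJ(4) by metis
      then show ?thesis ..
    next
      case False
      then have "I \<subseteq> S" "J - {e} \<subseteq> S" "I \<inter> (J - {e}) = {}" using IJ by auto
      moreover have "Q I (insert e (J - {e}))" by (rule mono[OF IJ(4)]) auto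
      ultimately have "box Q01 S" unfolding box_def Q01_def by blast
      then show ?thesis ..
    qed
  qed
  have "bexp p (insert e E) (\<lambda>S. of_bool (box Q S))
     = bexp p E (\<lambda>S. p * of_bool (box Q (insert e S)) + (1 - p) * of_bool (box Q S))"
    using insert by (simp add: bexp_insert bexp_add bexp_cmult)
  also have "\<dots> \<le> bexp p E (\<lambda>S. p * p * of_bool (box Q11 S) + p * (1 - p) * of_bool (box Q10 S)
       + p * (1 - p) * of_bool (box Q01 S) + (1 - p) * (1 - p) * of_bool (box Q S))"
  proof (rule bexp_mono)
    fix S
    have a: "p * of_bool (box Q (insert e S)) \<le> p * of_bool (box Q10 S \<or> box Q01 S)"
      by (rule mult_left_mono) (use ins assms in auto)
    \<comment> \<open>If \<open>box Q S\<close> holds, all four events hold and both sides equal 1.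
      If it fails and exactly one of \<open>box Q10 S\<close>, \<open>box Q01 S\<close> holds, then
      so does \<open>box Q11 S\<close>, and both sides equal \<open>p\<close>. If both hold, the
      right side is at least \<open>p * (2 - p)\<close>.\<close>
    have b: "p * of_bool (box Q10 S \<or> box Q01 S) + (1 - p) * of_bool (box Q S)
      \<le> p * p * of_bool (box Q11 S) + p * (1 - p) * of_bool (box Q10 S)
       + p * (1 - p) * of_bool (box Q01 S) + (1 - p) * (1 - p) * of_bool (box Q S)"
      using sub[of S] assms(2,3) mult_nonneg_nonneg[of p "1 - p"]
      by (cases "box Q S"; cases "box Q10 S"; cases "box Q01 S"; cases "box Q11 S")
        (auto simp: algebra_simps)
    show "p * of_bool (box Q (insert e S)) + (1 - p) * of_bool (box Q S)
      \<le> p * p * of_bool (box Q11 S) + p * (1 - p) * of_bool (box Q10 S)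
       + p * (1 - p) * of_bool (box Q01 S) + (1 - p) * (1 - p) * of_bool (box Q S)"
      using a b by linarith
  qed (use assms in auto)
  also have "\<dots> = p * p * bexp p E (\<lambda>S. of_bool (box Q11 S)) + p * (1 - p) * bexp p E (\<lambda>S. of_bool (box Q10 S))
       + p * (1 - p) * bexp p E (\<lambda>S. of_bool (box Q01 S)) + (1 - p) * (1 - p) * bexp p E (\<lambda>S. of_bool (box Q S))"
    by (simp add: bexp_add bexp_cmult)
  also have "\<dots> \<le> p * p * bexp p E (\<lambda>S. bexp p E (\<lambda>T. of_bool (Q11 S T)))
       + p * (1 - p) * bexp p E (\<lambda>S. bexp p E (\<lambda>T. of_bool (Q10 S T)))
       + p * (1 - p) * bexp p E (\<lambda>S. bexp p E (\<lambda>T. of_bool (Q01 S T)))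
       + (1 - p) * (1 - p) * bexp p E (\<lambda>S. bexp p E (\<lambda>T. of_bool (Q S T)))"
    by (intro add_mono mult_left_mono box_le) (use assms in auto)
  also have "\<dots> = bexp p (insert e E) (\<lambda>S. bexp p (insert e E) (\<lambda>T. of_bool (Q S T)))"
    using insert
    by (simp add: bexp_insert bexp_add bexp_cmult Q11_def Q10_def Q01_def) (simp add: algebra_simps)
  finally show ?case unfolding box_def .
qed

lemma bexp_BK:
  assumes "finite E" "0 \<le> p" "p \<le> 1"
    and "\<And>I I'. A I \<Longrightarrow> I \<subseteq> I' \<Longrightarrow> A I'" "\<And>I I'. B I \<Longrightarrow> I \<subseteq> I' \<Longrightarrow> B I'"
  shows "bexp p E (\<lambda>S. of_bool (\<exists>I J. I \<subseteq> S \<and> J \<subseteq> S \<and> I \<inter> J = {} \<and> A I \<and> B J))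
    \<le> bexp p E (\<lambda>S. of_bool (A S)) * bexp p E (\<lambda>S. of_bool (B S))"
proof -
  have "bexp p E (\<lambda>S. of_bool (\<exists>I J. I \<subseteq> S \<and> J \<subseteq> S \<and> I \<inter> J = {} \<and> A I \<and> B J))
     \<le> bexp p E (\<lambda>S. bexp p E (\<lambda>T. of_bool (A S \<and> B T)))"
    by (rule bexp_disjoint_occurrence_pair) (use assms in blast)+
  also have "\<dots> = bexp p E (\<lambda>S. bexp p E (\<lambda>T. of_bool (A S) * of_bool (B T)))"
    by (simp add: of_bool_conj)
  finally show ?thesis by (simp add: bexp_cmult bexp_cmult_right)
qed

text \<open>Two uses of the inequality for pairs: the disjoint occurrence of \<open>B\<close> and
  \<open>C\<close> is itself an increasing event.\<close>

lemma bexp_BK3: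
  assumes "finite E" "0 \<le> p" "p \<le> 1"
    and mono: "\<And>I I'. A I \<Longrightarrow> I \<subseteq> I' \<Longrightarrow> A I'" "\<And>I I'. B I \<Longrightarrow> I \<subseteq> I' \<Longrightarrow> B I'"
      "\<And>I I'. C I \<Longrightarrow> I \<subseteq> I' \<Longrightarrow> C I'"
  shows "bexp p E (\<lambda>S. of_bool (\<exists>I J K. I \<subseteq> S \<and> J \<subseteq> S \<and> K \<subseteq> S \<and> I \<inter> J = {} \<and> I \<inter> K = {} \<and> J \<inter> K = {}
      \<and> A I \<and> B J \<and> C K))
    \<le> bexp p E (\<lambda>S. of_bool (A S)) * bexp p E (\<lambda>S. of_bool (B S)) * bexp p E (\<lambda>S. of_bool (C S))"
proof -
  define BC where "BC = (\<lambda>S. \<exists>J K. J \<subseteq> S \<and> K \<subseteq> S \<and> J \<inter> K = {} \<and> B J \<and> C K)"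
  have BC_mono: "BC I \<Longrightarrow> I \<subseteq> I' \<Longrightarrow> BC I'" for I I' unfolding BC_def by (meson order_trans)
  have "bexp p E (\<lambda>S. of_bool (\<exists>I J K. I \<subseteq> S \<and> J \<subseteq> S \<and> K \<subseteq> S \<and> I \<inter> J = {} \<and> I \<inter> K = {} \<and> J \<inter> K = {}
      \<and> A I \<and> B J \<and> C K))
    \<le> bexp p E (\<lambda>S. of_bool (\<exists>I L. I \<subseteq> S \<and> L \<subseteq> S \<and> I \<inter> L = {} \<and> A I \<and> BC L))"
  proof (rule bexp_mono)
    fix S :: "'a set"
    have *: "\<exists>I L. I \<subseteq> S \<and> L \<subseteq> S \<and> I \<inter> L = {} \<and> A I \<and> BC L"
      if "I \<subseteq> S \<and> J \<subseteq> S \<and> K \<subseteq> S \<and> I \<inter> J = {} \<and> I \<inter> K = {} \<and> J \<inter> K = {} \<and> A I \<and> B J \<and> C K" for I J K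
    proof -
      have "BC (J \<union> K)" unfolding BC_def by (intro exI[of _ J] exI[of _ K]) (use that in simp)
      then show ?thesis using that by (intro exI[of _ I] exI[of _ "J \<union> K"]) (simp add: Int_Un_distrib)
    qed
    show "of_bool (\<exists>I J K. I \<subseteq> S \<and> J \<subseteq> S \<and> K \<subseteq> S \<and> I \<inter> J = {} \<and> I \<inter> K = {} \<and> J \<inter> K = {}
      \<and> A I \<and> B J \<and> C K) \<le> (of_bool (\<exists>I L. I \<subseteq> S \<and> L \<subseteq> S \<and> I \<inter> L = {} \<and> A I \<and> BC L) :: real)"
      unfolding of_bool_less_eq_iff by (intro impI, elim exE) (rule *)
  qed (use assms(2,3) in auto)
  also have "\<dots> \<le> bexp p E (\<lambda>S. of_bool (A S)) * bexp p E (\<lambda>S. of_bool (BC S))"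
    by (rule bexp_BK[OF assms(1-3) mono(1) BC_mono])
  also have "\<dots> \<le> bexp p E (\<lambda>S. of_bool (A S)) * (bexp p E (\<lambda>S. of_bool (B S)) * bexp p E (\<lambda>S. of_bool (C S)))"
    unfolding BC_def by (intro mult_left_mono bexp_BK[OF assms(1-3) mono(2,3)] bexp_nonneg) (use assms(2,3) in auto)
  finally show ?thesis by (simp add: mult.assoc)
qed

subsection \<open>Clusters\<close>

definition conn :: "'v set set \<Rightarrow> 'v \<Rightarrow> 'v set" where
  "conn S x = {y. (x, y) \<in> {(u, v). {u, v} \<in> S}\<^sup>*}"

lemma conn_refl [simp]: "x \<in> conn S x"
  by (simp add: conn_def)

lemma conn_step: "y \<in> conn S x \<Longrightarrow> {y, z} \<in> S \<Longrightarrow> z \<in> conn S x"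
  unfolding conn_def by (auto intro: rtrancl_into_rtrancl)

lemma conn_induct [consumes 1, case_names base step]:
  assumes "y \<in> conn S x" "P x"
    and "\<And>y z. y \<in> conn S x \<Longrightarrow> {y, z} \<in> S \<Longrightarrow> P y \<Longrightarrow> P z"
  shows "P y"
proof -
  have "(x, y) \<in> {(u, v). {u, v} \<in> S}\<^sup>*" using assms(1) by (simp add: conn_def)
  then show ?thesis
    by (induction rule: rtrancl_induct) (use assms(2,3) in \<open>auto simp: conn_def\<close>)
qed

lemma conn_mono: "S \<subseteq> T \<Longrightarrow> conn S x \<subseteq> conn T x"
proof
  fix y assume "S \<subseteq> T" "y \<in> conn S x"
  from this(2,1) show "y \<in> conn T x"
  proof (induction rule: conn_induct)
    case (step y z)
    then show ?case using conn_step[of y T x z] by blast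
  qed simp
qed

lemma conn_trans: "y \<in> conn S x \<Longrightarrow> z \<in> conn S y \<Longrightarrow> z \<in> conn S x"
  unfolding conn_def by auto

lemma conn_sym: "y \<in> conn S x \<Longrightarrow> x \<in> conn S y"
proof (induction rule: conn_induct)
  case (step y z)
  have "y \<in> conn S z" using conn_step[of z S z y] step(2) by (simp add: insert_commute)
  then show ?case by (rule conn_trans) (rule step.IH)
qed simp

lemma conn_eq:
  assumes y: "y \<in> conn S x"
  shows "conn S y = conn S x"
proof
  show "conn S y \<subseteq> conn S x" using conn_trans[OF y] by blast
  show "conn S x \<subseteq> conn S y" using conn_trans[OF conn_sym[OF y]] by blast
qed

lemma conn_subset:
  assumes "\<And>e. e \<in> S \<Longrightarrow> e \<subseteq> V" "x \<in> V"
  shows "conn S x \<subseteq> V"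
proof
  fix y assume "y \<in> conn S x"
  then show "y \<in> V" by (induction rule: conn_induct) (use assms in auto)
qed

lemma finite_conn:
  assumes "finite S"
  shows "finite (conn S x)"
proof -
  let ?V = "insert x (\<Union>{e\<in>S. finite e})"
  have "conn S x \<subseteq> ?V"
  proof
    fix y assume "y \<in> conn S x"
    then show "y \<in> ?V" by (induction rule: conn_induct) auto
  qed
  then show ?thesis by (rule finite_subset) (use assms in auto)
qed

lemma card_conn_mono: "finite T \<Longrightarrow> S \<subseteq> T \<Longrightarrow> card (conn S x) \<le> card (conn T x)"
  by (intro card_mono finite_conn conn_mono)

lemma card_conn_pos: "finite S \<Longrightarrow> 0 < card (conn S x)"
  using finite_conn[of S x] conn_refl[of x S] by (auto simp: card_gt_0_iff simp del: conn_refl)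

lemma conn_restrict: "conn {e \<in> S. e \<subseteq> conn S x} x = conn S x"
proof
  show "conn S x \<subseteq> conn {e \<in> S. e \<subseteq> conn S x} x"
  proof
    fix y assume "y \<in> conn S x"
    then show "y \<in> conn {e \<in> S. e \<subseteq> conn S x} x"
    proof (induction rule: conn_induct)
      case (step y z)
      then show ?case using conn_step[of y S x z] conn_step[of y "{e \<in> S. e \<subseteq> conn S x}" x z] by simp
    qed simp
  qed
qed (auto intro!: conn_mono)

lemma conn_image:
  assumes "inj h"
  shows "conn ((`) h ` S) (h x) = h ` conn S x"
proof
  show "conn ((`) h ` S) (h x) \<subseteq> h ` conn S x"
  proof
    fix y assume "y \<in> conn ((`) h ` S) (h x)"
    then show "y \<in> h ` conn S x"
    proof (induction rule: conn_induct)
      case (step y z)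
      then obtain w e where w: "y = h w" "w \<in> conn S x" "e \<in> S" "h ` e = {h w, z}" by auto
      then obtain v where v: "z = h v" by (metis imageE insertI1 insert_commute)
      have "h ` e = h ` {w, v}" using w v by simp
      then have "e = {w, v}" using inj_image_eq_iff[OF assms, of e "{w, v}"] by simp
      then have "v \<in> conn S x" using w conn_step[of w S x v] by simp
      then show ?case using v by simp
    qed simp
  qed
  show "h ` conn S x \<subseteq> conn ((`) h ` S) (h x)"
  proof
    fix y assume "y \<in> h ` conn S x"
    then obtain w where w: "y = h w" "w \<in> conn S x" by auto
    from w(2) have "h w \<in> conn ((`) h ` S) (h x)"
    proof (induction rule: conn_induct)
      case (step y z)
      then have "h ` {y, z} \<in> (`) h ` S" by (rule_tac imageI)
      then show ?case using step conn_step[of "h y" "(`) h ` S" "h x" "h z"] by simp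
    qed simp
    then show "y \<in> conn ((`) h ` S) (h x)" using w by simp
  qed
qed

text \<open>The event that the cluster of \<open>x\<close> is \<open>K\<close> is decided by the
  edges meeting \<open>K\<close>. Revealing a cluster therefore leaves the edges disjoint from it
  independent and unbiased.\<close>

lemma conn_eq_iff_touching:
  "conn S x = K \<longleftrightarrow> conn {e \<in> S. e \<inter> K \<noteq> {}} x = K"
proof
  assume K: "conn S x = K"
  have "y \<in> conn {e \<in> S. e \<inter> K \<noteq> {}} x" if "y \<in> conn S x" for y
    using that
  proof (induction rule: conn_induct)
    case (step y z)
    then have "{y, z} \<in> {e \<in> S. e \<inter> K \<noteq> {}}" using K by blast
    then show ?case by (rule conn_step[OF step.IH])
  qed simp
  moreover have "conn {e \<in> S. e \<inter> K \<noteq> {}} x \<subseteq> conn S x" by (rule conn_mono) auto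
  ultimately have "conn {e \<in> S. e \<inter> K \<noteq> {}} x = conn S x" by blast
  then show "conn {e \<in> S. e \<inter> K \<noteq> {}} x = K" using K by (rule trans)
next
  assume K: "conn {e \<in> S. e \<inter> K \<noteq> {}} x = K"
  have "y \<in> K" if "y \<in> conn S x" for y
    using that
  proof (induction rule: conn_induct)
    case base
    have "x \<in> conn {e \<in> S. e \<inter> K \<noteq> {}} x" by simp
    then show ?case unfolding K .
  next
    case (step y z)
    then have "{y, z} \<in> {e \<in> S. e \<inter> K \<noteq> {}}" by auto
    then have "z \<in> conn {e \<in> S. e \<inter> K \<noteq> {}} x" using step K conn_step[of y _ x z] by blast
    then show ?case unfolding K .
  qed
  moreover have "conn {e \<in> S. e \<inter> K \<noteq> {}} x \<subseteq> conn S x" by (rule conn_mono) auto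
  ultimately show "conn S x = K" unfolding K by blast
qed

text \<open>No open edge joins two different clusters, so discarding the edges that touch the
  cluster of \<open>x\<close> does not affect any other cluster.\<close>

lemma conn_avoiding:
  assumes "y \<notin> conn S x"
  shows "conn S y = conn {e \<in> S. e \<inter> conn S x = {}} y"
proof
  show "conn S y \<subseteq> conn {e \<in> S. e \<inter> conn S x = {}} y"
  proof
    fix z assume "z \<in> conn S y"
    then show "z \<in> conn {e \<in> S. e \<inter> conn S x = {}} y"
    proof (induction rule: conn_induct)
      case base
      show ?case by simp
    next
      case (step z w)
      have "z \<in> conn S y" using step(1) .
      then have "w \<in> conn S y" by (rule conn_step) (rule step(2))
      have "z \<notin> conn S x" using conn_trans[of z S x y] conn_sym[OF \<open>z \<in> conn S y\<close>] assms by blast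
      moreover have "w \<notin> conn S x" using conn_trans[of w S x y] conn_sym[OF \<open>w \<in> conn S y\<close>] assms by blast
      ultimately have "z \<notin> conn S x" "w \<notin> conn S x" .
      then have "{z, w} \<in> {e \<in> S. e \<inter> conn S x = {}}" using step by blast
      then show ?case by (rule conn_step[OF step.IH])
    qed
  qed
qed (auto intro!: conn_mono)

text \<open>
  The clusters meeting \<open>A\<close> are explored one after the other: given the cluster of the first vertex,
  the remaining ones live on the edges not touching it, where clusters are smaller.
\<close>

lemma bexp_exploration:
  fixes f :: "nat \<Rightarrow> real"
  assumes "finite E" "0 \<le> p" "p \<le> 1" "finite A" "\<And>k. 1 \<le> f k" "mono f"
  shows "bexp p E (\<lambda>S. \<Prod>C\<in>conn S ` A. f (card C)) \<le> (\<Prod>x\<in>A. bexp p E (\<lambda>S. f (card (conn S x))))"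
  using assms(4,1)
proof (induction "card A" arbitrary: A E rule: less_induct)
  case less
  show ?case
  proof (cases "A = {}")
    case True
    then show ?thesis using less by (simp add: bexp_const)
  next
    case False
    then obtain x where "x \<in> A" by blast
    define A' where "A' = A - {x}"
    have A: "A = insert x A'" "x \<notin> A'" using \<open>x \<in> A\<close> by (auto simp: A'_def)
    have fin: "finite A'" "finite E" using less A by auto
    have f0: "0 \<le> f k" for k using assms(5)[of k] by linarith
    define EK where "EK = (\<lambda>K. {e \<in> E. e \<inter> K = {}})"
    define KK where "KK = (\<lambda>S. conn S x) ` Pow E"
    have finKK: "finite KK" unfolding KK_def using fin by auto
    define g where "g = (\<lambda>K S. \<Prod>C\<in>conn S ` (A' - K). f (card C))"
    define h where "h = (\<lambda>K S. of_bool (conn S x = K) * f (card K))"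
    define R where "R = (\<Prod>y\<in>A'. bexp p E (\<lambda>S. f (card (conn S y))))"
    have touch: "{e \<in> S. e \<inter> K \<noteq> {}} = S - EK K" "{e \<in> S. e \<inter> K = {}} = S \<inter> EK K" if "S \<subseteq> E" for S K
      using that by (auto simp: EK_def)
    have at_iff: "(conn S x = K) = (conn (S - EK K) x = K)" if "S \<subseteq> E" for S K
      using conn_eq_iff_touching[of S x K] unfolding touch[OF that] .
    have split_at: "(\<Sum>K\<in>KK. of_bool (conn S x = K) * F K) = F (conn S x)" if "S \<subseteq> E" for S and F :: "'a set \<Rightarrow> real"
    proof -
      have "(\<Sum>K\<in>KK. of_bool (conn S x = K) * F K) = (\<Sum>K\<in>{conn S x}. of_bool (conn S x = K) * F K)"
        by (rule sum.mono_neutral_right) (use finKK that in \<open>auto simp: KK_def\<close>)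
      then show ?thesis by simp
    qed
    have "bexp p E (\<lambda>S. \<Prod>C\<in>conn S ` A. f (card C)) = bexp p E (\<lambda>S. \<Sum>K\<in>KK. h K (S - EK K) * g K (S \<inter> EK K))"
    proof (rule bexp_cong)
      fix S assume S: "S \<subseteq> E"
      let ?K = "conn S x"
      have "conn S ` A = insert ?K (conn S ` (A' - ?K))" (is "?L = ?R")
      proof
        show "?L \<subseteq> ?R"
        proof
          fix C assume "C \<in> ?L"
          then obtain y where y: "y \<in> A" "C = conn S y" by blast
          show "C \<in> ?R" using y A conn_eq[of y S x] by (cases "y \<in> ?K") auto
        qed
      qed (use A in auto)
      moreover have "?K \<notin> conn S ` (A' - ?K)" using conn_refl[of _ S] by blast
      moreover have "conn S ` (A' - ?K) = conn (S \<inter> EK ?K) ` (A' - ?K)"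
        using conn_avoiding[of _ S x] touch[OF S] by (intro image_cong) auto
      ultimately have "(\<Prod>C\<in>conn S ` A. f (card C)) = f (card ?K) * g ?K (S \<inter> EK ?K)"
        unfolding g_def using fin by simp
      also have "\<dots> = (\<Sum>K\<in>KK. of_bool (conn S x = K) * (f (card K) * g K (S \<inter> EK K)))"
        using split_at[OF S, of "\<lambda>K. f (card K) * g K (S \<inter> EK K)"] by simp
      also have "\<dots> = (\<Sum>K\<in>KK. h K (S - EK K) * g K (S \<inter> EK K))"
        by (intro sum.cong refl) (simp only: h_def at_iff[OF S, symmetric] mult.assoc)
      finally show "(\<Prod>C\<in>conn S ` A. f (card C)) = (\<Sum>K\<in>KK. h K (S - EK K) * g K (S \<inter> EK K))" .
    qed
    also have "\<dots> = (\<Sum>K\<in>KK. bexp p (E - EK K) (h K) * bexp p (EK K) (g K))"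
      unfolding bexp_sum by (intro sum.cong refl bexp_factor) (use fin in \<open>auto simp: EK_def\<close>)
    also have "\<dots> \<le> (\<Sum>K\<in>KK. bexp p (E - EK K) (h K) * R)"
    proof (intro sum_mono mult_left_mono)
      fix K
      have finK: "finite (EK K)" using fin by (auto simp: EK_def)
      have "bexp p (EK K) (g K) \<le> (\<Prod>y\<in>A' - K. bexp p (EK K) (\<lambda>S. f (card (conn S y))))"
        unfolding g_def
      proof (rule less.hyps)
        have "card (A' - K) \<le> card A'" by (rule card_mono) (use fin in auto)
        then show "card (A' - K) < card A" using A fin by simp
      qed (use fin finK in auto)
      also have "\<dots> \<le> (\<Prod>y\<in>A' - K. bexp p E (\<lambda>S. f (card (conn S y))))"
      proof (intro prod_mono conjI)
        fix y
        show "0 \<le> bexp p (EK K) (\<lambda>S. f (card (conn S y)))"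
          by (rule bexp_nonneg) (use assms f0 in auto)
        have "bexp p (EK K) (\<lambda>S. f (card (conn S y))) = bexp p E (\<lambda>S. f (card (conn (S \<inter> EK K) y)))"
          by (rule bexp_restrict[symmetric, of E "EK K" p "\<lambda>S. f (card (conn S y))"])
            (use fin in \<open>auto simp: EK_def\<close>)
        also have "\<dots> \<le> bexp p E (\<lambda>S. f (card (conn S y)))"
        proof (rule bexp_mono)
          fix S assume "S \<subseteq> E"
          then have "finite S" using fin finite_subset by auto
          then show "f (card (conn (S \<inter> EK K) y)) \<le> f (card (conn S y))"
            by (intro monoD[OF assms(6)] card_conn_mono) auto
        qed (use assms in auto)
        finally show "bexp p (EK K) (\<lambda>S. f (card (conn S y))) \<le> bexp p E (\<lambda>S. f (card (conn S y)))" .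
      qed
      \<comment> \<open>The vertices of \<open>A'\<close> absorbed by \<open>K\<close> have no
        factor on the left; because \<open>f\<close> is at least 1, their factors can be
        inserted.\<close>
      also have "\<dots> \<le> R"
        unfolding R_def
      proof (rule prod_mono2)
        fix b show "1 \<le> bexp p E (\<lambda>S. f (card (conn S b)))"
          by (rule bexp_ge_const) (use fin assms in auto)
      next
        fix b show "0 \<le> bexp p E (\<lambda>S. f (card (conn S b)))"
          by (rule bexp_nonneg) (use f0 assms in auto)
      qed (use fin in auto)
      finally show "bexp p (EK K) (g K) \<le> R" .
      show "0 \<le> bexp p (E - EK K) (h K)"
        by (rule bexp_nonneg) (use f0 assms in \<open>auto simp: h_def\<close>)
    qed
    also have "\<dots> = (\<Sum>K\<in>KK. bexp p (E - EK K) (h K)) * R"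
      by (simp add: sum_distrib_right)
    also have "(\<Sum>K\<in>KK. bexp p (E - EK K) (h K)) = (\<Sum>K\<in>KK. bexp p E (\<lambda>S. h K (S - EK K)))"
    proof (rule sum.cong)
      fix K
      have "bexp p E (\<lambda>S. h K (S - EK K) * (\<lambda>_. 1) (S \<inter> EK K)) = bexp p (E - EK K) (h K) * bexp p (EK K) (\<lambda>_. 1)"
        by (rule bexp_factor) (use fin in \<open>auto simp: EK_def\<close>)
      moreover have "finite (EK K)" using fin by (auto simp: EK_def)
      ultimately show "bexp p (E - EK K) (h K) = bexp p E (\<lambda>S. h K (S - EK K))" by (simp add: bexp_const)
    qed simp
    also have "\<dots> = bexp p E (\<lambda>S. f (card (conn S x)))"
      unfolding bexp_sum[symmetric]
    proof (rule bexp_cong)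
      fix S assume S: "S \<subseteq> E"
      have "(\<Sum>K\<in>KK. h K (S - EK K)) = (\<Sum>K\<in>KK. of_bool (conn S x = K) * f (card K))"
        by (intro sum.cong refl) (simp only: h_def at_iff[OF S, symmetric] mult.assoc)
      then show "(\<Sum>K\<in>KK. h K (S - EK K)) = f (card (conn S x))" using split_at[OF S] by simp
    qed
    finally show ?thesis unfolding A R_def using A fin by simp
  qed
qed

subsection \<open>Decomposing a cluster along a branching point\<close>

text \<open>The index \<open>G\<close> is the set of vertices visited so far. Every edge used lies
  inside \<open>G\<close>, while the next edge has its new endpoint outside \<open>G\<close>; this
  is how edge-disjointness is obtained without handling paths as lists.\<close>

inductive self_avoiding :: "'v set set \<Rightarrow> 'v \<Rightarrow> 'v set \<Rightarrow> 'v \<Rightarrow> bool" for S u where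
  start: "self_avoiding S u {u} u"
| extend: "self_avoiding S u G v \<Longrightarrow> {v, w} \<in> S \<Longrightarrow> w \<notin> G \<Longrightarrow> self_avoiding S u (insert w G) w"

text \<open>Cutting at \<open>z\<close> separates the edges used before reaching \<open>z\<close>
  from those used afterwards, and each later edge is new because it has an endpoint outside the
  earlier vertex set. The condition that all edges lie inside \<open>G\<close> later keeps them
  apart from the third leg.\<close>

lemma self_avoiding_split:
  assumes "self_avoiding S u G v" "z \<in> G"
  shows "\<exists>S1 S2 H. H \<subseteq> G \<and> self_avoiding S u H z \<and> S1 \<subseteq> S \<and> S2 \<subseteq> S \<and> S1 \<inter> S2 = {}
    \<and> (\<forall>e\<in>S1 \<union> S2. e \<subseteq> G) \<and> z \<in> conn S1 u \<and> v \<in> conn S2 z"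
  using assms
proof (induction arbitrary: z)
  case start
  then have "z = u" by simp
  then show ?case
    by (intro exI[of _ "{}"] exI[of _ "{u}"]) (simp add: self_avoiding.start)
next
  case (extend G v w)
  have w_conn: "w \<in> conn (insert {v, w} R) y" if "v \<in> conn R y" for R y
  proof -
    have "v \<in> conn (insert {v, w} R) y" using conn_mono[of R "insert {v, w} R" y] that by auto
    then show ?thesis by (rule conn_step) simp
  qed
  have v_in: "v \<in> G" using extend(1) by (induction) auto
  show ?case
  proof (cases "z = w")
    case True
    obtain S1 where S1: "S1 \<subseteq> S" "\<forall>e\<in>S1. e \<subseteq> G" "v \<in> conn S1 u"
      using extend.IH[OF v_in] by auto
    show ?thesis
      by (rule exI[of _ "insert {v, w} S1"], rule exI[of _ "{}"], rule exI[of _ "insert w G"])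
        (use True S1 extend v_in w_conn[OF S1(3)] in \<open>auto intro: self_avoiding.extend\<close>)
  next
    case False
    then obtain S1 S2 H where S: "H \<subseteq> G" "self_avoiding S u H z" "S1 \<subseteq> S" "S2 \<subseteq> S" "S1 \<inter> S2 = {}"
      "\<forall>e\<in>S1 \<union> S2. e \<subseteq> G" "z \<in> conn S1 u" "v \<in> conn S2 z"
      using extend.IH[of z] extend.prems by auto
    have new: "{v, w} \<notin> S1"
    proof
      assume "{v, w} \<in> S1"
      then have "{v, w} \<in> S1 \<union> S2" by (rule UnI1)
      with S(6) have "{v, w} \<subseteq> G" by (rule bspec)
      then show False using \<open>w \<notin> G\<close> by simp
    qed
    show ?thesis
      by (rule exI[of _ S1], rule exI[of _ "insert {v, w} S2"], rule exI[of _ H])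
        (use S new extend v_in w_conn[OF S(8)] in auto)
  qed
qed

lemma self_avoiding_exists:
  assumes "v \<in> conn S u"
  shows "\<exists>G. self_avoiding S u G v"
  using assms
proof (induction rule: conn_induct)
  case base
  show ?case by (rule exI) (rule self_avoiding.start)
next
  case (step v w)
  then obtain G where G: "self_avoiding S u G v" by blast
  show ?case
  proof (cases "w \<in> G")
    case True
    then show ?thesis using self_avoiding_split[OF G] by blast
  next
    case False
    then show ?thesis using self_avoiding.extend[OF G step(2)] by blast
  qed
qed

text \<open>A tripod with centre \<open>z\<close> and ends \<open>u\<close>, \<open>v\<close>,
  \<open>x\<close>, with pairwise edge-disjoint legs. The last line says that each leg consists only
  of edges reachable within it from its root, so an edge with an endpoint outside the three leg
  clusters cannot belong to any leg.\<close>

definition legs :: "'v set set \<Rightarrow> 'v \<Rightarrow> 'v \<Rightarrow> 'v \<Rightarrow> 'v \<Rightarrow> 'v set set \<Rightarrow> 'v set set \<Rightarrow> 'v set set \<Rightarrow> bool" where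
  "legs S u v x z S1 S2 S3 \<longleftrightarrow> S1 \<subseteq> S \<and> S2 \<subseteq> S \<and> S3 \<subseteq> S \<and> S1 \<inter> S2 = {} \<and> S1 \<inter> S3 = {} \<and> S2 \<inter> S3 = {}
    \<and> z \<in> conn S1 u \<and> v \<in> conn S2 z \<and> x \<in> conn S3 z
    \<and> (\<forall>e\<in>S1. e \<subseteq> conn S1 u) \<and> (\<forall>e\<in>S2. e \<subseteq> conn S2 z) \<and> (\<forall>e\<in>S3. e \<subseteq> conn S3 z)"

text \<open>The centre \<open>z\<close> is the last vertex of a self-avoiding path from
  \<open>u\<close> to \<open>v\<close> met on the way from \<open>u\<close> to \<open>x\<close>.
  After \<open>z\<close>, every edge leaves the vertex set \<open>G\<close> of that path, hence
  differs from all edges of the path.\<close>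

lemma legs_exist:
  assumes "v \<in> conn S u" "x \<in> conn S u"
  shows "\<exists>z S1 S2 S3. legs S u v x z S1 S2 S3"
proof -
  obtain G where G: "self_avoiding S u G v" using self_avoiding_exists[OF assms(1)] by blast
  have uG: "u \<in> G" using G by induction auto
  have "\<exists>z\<in>G. \<exists>S3\<subseteq>S. (\<forall>e\<in>S3. \<not> e \<subseteq> G) \<and> x \<in> conn S3 z"
    using assms(2)
  proof (induction rule: conn_induct)
    case base
    show ?case by (rule bexI[OF _ uG], rule exI[of _ "{}"]) simp
  next
    case (step y w)
    then obtain z S3 where z: "z \<in> G" "S3 \<subseteq> S" "\<forall>e\<in>S3. \<not> e \<subseteq> G" "y \<in> conn S3 z" by blast
    show ?case
    proof (cases "w \<in> G")
      case True
      then show ?thesis by (rule_tac bexI[of _ w], rule_tac exI[of _ "{}"]) simp_all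
    next
      case False
      have "y \<in> conn (insert {y, w} S3) z" using conn_mono[of S3 "insert {y, w} S3" z] z(4) by auto
      then have "w \<in> conn (insert {y, w} S3) z" by (rule conn_step) simp
      then show ?thesis
        by (intro bexI[OF _ z(1)] exI[of _ "insert {y, w} S3"]) (use z step False in auto)
    qed
  qed
  then obtain z S3 where z: "z \<in> G" "S3 \<subseteq> S" "\<forall>e\<in>S3. \<not> e \<subseteq> G" "x \<in> conn S3 z" by blast
  obtain S1 S2 where S: "S1 \<subseteq> S" "S2 \<subseteq> S" "S1 \<inter> S2 = {}" "\<forall>e\<in>S1 \<union> S2. e \<subseteq> G" "z \<in> conn S1 u" "v \<in> conn S2 z"
    using self_avoiding_split[OF G z(1)] by blast
  \<comment> \<open>Pruning a leg to its reachable edges establishes the closure condition without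
    changing its cluster.\<close>
  define R where "R = (\<lambda>S y. {e \<in> S. e \<subseteq> conn S y} :: 'a set set)"
  have R: "conn (R S y) y = conn S y" "R S y \<subseteq> S" "\<forall>e\<in>R S y. e \<subseteq> conn (R S y) y" for S y
    using conn_restrict[of S y] by (auto simp: R_def)
  have disj: "S1 \<inter> S3 = {}" "S2 \<inter> S3 = {}" using z(3) S(4) by auto
  have "legs S u v x z (R S1 u) (R S2 z) (R S3 z)"
    unfolding legs_def
  proof (intro conjI)
    show "z \<in> conn (R S1 u) u" "v \<in> conn (R S2 z) z" "x \<in> conn (R S3 z) z" using R(1) S z by auto
    show "R S1 u \<subseteq> S" "R S2 z \<subseteq> S" "R S3 z \<subseteq> S" using R(2) S(1,2) z(2) by (meson order_trans)+
    show "R S1 u \<inter> R S2 z = {}" "R S1 u \<inter> R S3 z = {}" "R S2 z \<inter> R S3 z = {}"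
      using R(2) S(3) disj by blast+
  qed (rule R(3))+
  then show ?thesis by blast
qed

lemma conn_insert_closed:
  assumes "\<forall>e\<in>S. e \<subseteq> conn S u" "y \<in> conn S u"
  shows "w \<in> conn (insert {y, w} S) u" "\<forall>e\<in>insert {y, w} S. e \<subseteq> conn (insert {y, w} S) u"
proof -
  have sub: "conn S u \<subseteq> conn (insert {y, w} S) u" by (rule conn_mono) auto
  then have y: "y \<in> conn (insert {y, w} S) u" using assms by blast
  then show w: "w \<in> conn (insert {y, w} S) u" by (rule conn_step) simp
  show "\<forall>e\<in>insert {y, w} S. e \<subseteq> conn (insert {y, w} S) u" using sub y w assms(1) by blast
qed

text \<open>Following a path to \<open>y\<close>, whenever the next vertex lies outside the three
  legs, the edge leading to it is attached to a leg containing the previous vertex. By closure that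
  edge is in no leg, so disjointness survives.\<close>

lemma legs_extend:
  assumes "legs S u v x z S1 S2 S3" "y \<in> conn S u"
  shows "\<exists>S1' S2' S3'. S1 \<subseteq> S1' \<and> S2 \<subseteq> S2' \<and> S3 \<subseteq> S3' \<and> legs S u v x z S1' S2' S3'
    \<and> y \<in> conn S1' u \<union> conn S2' z \<union> conn S3' z"
  using assms(2)
proof (induction rule: conn_induct)
  case base
  show ?case using assms(1) by (intro exI[of _ S1] exI[of _ S2] exI[of _ S3]) simp
next
  case (step y w)
  then obtain S1' S2' S3' where S: "S1 \<subseteq> S1'" "S2 \<subseteq> S2'" "S3 \<subseteq> S3'" "legs S u v x z S1' S2' S3'"
    "y \<in> conn S1' u \<union> conn S2' z \<union> conn S3' z" by blast
  show ?case
  proof (cases "w \<in> conn S1' u \<union> conn S2' z \<union> conn S3' z")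
    case True
    then show ?thesis using S by (intro exI[of _ S1'] exI[of _ S2'] exI[of _ S3']) simp
  next
    case False
    let ?e = "{y, w}"
    note L = S(4)[unfolded legs_def]
    have closed: "\<forall>e\<in>S1'. e \<subseteq> conn S1' u" "\<forall>e\<in>S2'. e \<subseteq> conn S2' z" "\<forall>e\<in>S3'. e \<subseteq> conn S3' z"
      using L by simp_all
    then have new: "?e \<notin> S1'" "?e \<notin> S2'" "?e \<notin> S3'" using False by auto
    have mono: "conn R a \<subseteq> conn (insert ?e R) a" for R a by (rule conn_mono) auto
    consider "y \<in> conn S1' u" | "y \<in> conn S2' z" | "y \<in> conn S3' z" using S(5) by blast
    then show ?thesis
    proof cases
      case 1
      note c = conn_insert_closed[OF closed(1) 1, of w]
      have "legs S u v x z (insert ?e S1') S2' S3'"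
        unfolding legs_def using L c new mono[of S1' u] step(2) by (simp add: subset_iff)
      then show ?thesis using S(1-3) c(1) L
        by (intro exI[of _ "insert ?e S1'"] exI[of _ S2'] exI[of _ S3']) auto
    next
      case 2
      note c = conn_insert_closed[OF closed(2) 2, of w]
      have "legs S u v x z S1' (insert ?e S2') S3'"
        unfolding legs_def using L c new mono[of S2' z] step(2) by (simp add: subset_iff)
      then show ?thesis using S(1-3) c(1) L
        by (intro exI[of _ S1'] exI[of _ "insert ?e S2'"] exI[of _ S3']) auto
    next
      case 3
      note c = conn_insert_closed[OF closed(3) 3, of w]
      have "legs S u v x z S1' S2' (insert ?e S3')"
        unfolding legs_def using L c new mono[of S3' z] step(2) by (simp add: subset_iff)
      then show ?thesis using S(1-3) c(1) L
        by (intro exI[of _ S1'] exI[of _ S2'] exI[of _ "insert ?e S3'"]) auto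
    qed
  qed
qed

lemma legs_cover:
  assumes "finite T" "T \<subseteq> conn S u" "v \<in> conn S u" "x \<in> conn S u"
  shows "\<exists>z S1 S2 S3. legs S u v x z S1 S2 S3 \<and> T \<subseteq> conn S1 u \<union> conn S2 z \<union> conn S3 z"
  using assms(1,2)
proof (induction T rule: finite_induct)
  case empty
  show ?case using legs_exist[OF assms(3,4)] by blast
next
  case (insert y T)
  then obtain z S1 S2 S3 where L: "legs S u v x z S1 S2 S3" "T \<subseteq> conn S1 u \<union> conn S2 z \<union> conn S3 z" by blast
  obtain S1' S2' S3' where S: "S1 \<subseteq> S1'" "S2 \<subseteq> S2'" "S3 \<subseteq> S3'" "legs S u v x z S1' S2' S3'"
    "y \<in> conn S1' u \<union> conn S2' z \<union> conn S3' z"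
    using legs_extend[OF L(1), of y] insert.prems by auto
  have "insert y T \<subseteq> conn S1' u \<union> conn S2' z \<union> conn S3' z"
    using L(2) S(5) conn_mono[OF S(1), of u] conn_mono[OF S(2), of z] conn_mono[OF S(3), of z] by blast
  then show ?case using S(4) by blast
qed

text \<open>Assigning each vertex of \<open>T\<close> to the first leg that contains it gives a
  partition with edge-disjoint witnesses, which is the form required by the inequality for disjoint
  occurrence.\<close>

lemma cluster_decomposition:
  assumes "finite T" "T \<subseteq> conn S u" "v \<in> conn S u" "x \<in> conn S u"
  shows "\<exists>z T1 T2 T3. z \<in> conn S u \<and> T1 \<union> T2 \<union> T3 = T \<and> T1 \<inter> T2 = {} \<and> T1 \<inter> T3 = {} \<and> T2 \<inter> T3 = {}
    \<and> (\<exists>S1 S2 S3. S1 \<subseteq> S \<and> S2 \<subseteq> S \<and> S3 \<subseteq> S \<and> S1 \<inter> S2 = {} \<and> S1 \<inter> S3 = {} \<and> S2 \<inter> S3 = {}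
      \<and> insert z T1 \<subseteq> conn S1 u \<and> insert v T2 \<subseteq> conn S2 z \<and> insert x T3 \<subseteq> conn S3 z)"
proof -
  obtain z S1 S2 S3 where L: "legs S u v x z S1 S2 S3" "T \<subseteq> conn S1 u \<union> conn S2 z \<union> conn S3 z"
    using legs_cover[OF assms] by blast
  define T1 where "T1 = T \<inter> conn S1 u"
  define T2 where "T2 = T \<inter> conn S2 z - T1"
  define T3 where "T3 = T - T1 - T2"
  note L' = L(1)[unfolded legs_def]
  show ?thesis
  proof (rule exI[of _ z], rule exI[of _ T1], rule exI[of _ T2], rule exI[of _ T3], intro conjI)
    have "conn S1 u \<subseteq> conn S u" by (rule conn_mono) (use L' in simp)
    moreover have "z \<in> conn S1 u" using L' by simp
    ultimately show "z \<in> conn S u" by blast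
    show "T1 \<union> T2 \<union> T3 = T" "T1 \<inter> T2 = {}" "T1 \<inter> T3 = {}" "T2 \<inter> T3 = {}"
      by (auto simp: T1_def T2_def T3_def)
    have "insert z T1 \<subseteq> conn S1 u" "insert v T2 \<subseteq> conn S2 z" "insert x T3 \<subseteq> conn S3 z"
      using L' L(2) by (auto simp: T1_def T2_def T3_def)
    then show "\<exists>S1 S2 S3. S1 \<subseteq> S \<and> S2 \<subseteq> S \<and> S3 \<subseteq> S \<and> S1 \<inter> S2 = {} \<and> S1 \<inter> S3 = {} \<and> S2 \<inter> S3 = {}
      \<and> insert z T1 \<subseteq> conn S1 u \<and> insert v T2 \<subseteq> conn S2 z \<and> insert x T3 \<subseteq> conn S3 z"
      using L' by (intro exI[of _ S1] exI[of _ S2] exI[of _ S3]) simp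
  qed
qed

subsection \<open>Exponential moments of subcritical clusters\<close>

lemma sum_power_card_Pow:
  assumes "finite C"
  shows "(\<Sum>T\<in>Pow C. (s::real) ^ card T) = (1 + s) ^ card C"
  using assms
proof (induction C rule: finite_induct)
  case (insert c C)
  have inj: "inj_on (insert c) (Pow C)" using insert by (auto simp: inj_on_def)
  have "(\<Sum>T\<in>insert c ` Pow C. s ^ card T) = (\<Sum>T\<in>Pow C. s * s ^ card T)"
    unfolding sum.reindex[OF inj] o_def
  proof (rule sum.cong)
    fix T assume "T \<in> Pow C"
    then have "finite T" "c \<notin> T" using insert finite_subset by auto
    then show "s ^ card (insert c T) = s * s ^ card T" by simp
  qed simp
  moreover have "Pow C \<inter> insert c ` Pow C = {}" using insert by auto
  ultimately show ?case
    using insert by (simp add: Pow_insert sum.union_disjoint sum_distrib_left[symmetric] algebra_simps)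
qed simp

text \<open>The two-point function tilted by the weight \<open>(1 + s) ^ card (conn S x)\<close>; at
  \<open>s = 0\<close> it is the usual probability of connection.\<close>

definition weighted_connection :: "real \<Rightarrow> 'v set set \<Rightarrow> real \<Rightarrow> 'v \<Rightarrow> 'v \<Rightarrow> real" where
  "weighted_connection p E s x y =
     bexp p E (\<lambda>S. of_bool (y \<in> conn S x) * (1 + s) ^ card (conn S x))"

lemma weighted_connection_nonneg:
  "0 \<le> p \<Longrightarrow> p \<le> 1 \<Longrightarrow> 0 \<le> s \<Longrightarrow> 0 \<le> weighted_connection p E s x y"
  unfolding weighted_connection_def by (rule bexp_nonneg) auto

lemma sum_product3:
  fixes f g h :: "'a \<Rightarrow> real"
  shows "(\<Sum>a\<in>A. f a) * (\<Sum>b\<in>B. g b) * (\<Sum>c\<in>C. h c) = (\<Sum>a\<in>A. \<Sum>b\<in>B. \<Sum>c\<in>C. f a * g b * h c)"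
  unfolding mult.assoc sum_product[of g B h C]
  by (subst sum_distrib_right) (simp only: sum_distrib_left)

text \<open>
  Expanding \<open>(1 + s)\<^bsup>|C|\<^esup>\<close> over the subsets of the cluster, every subset splits along the three
  legs of the skeleton, and the BK inequality decouples the legs.
\<close>

lemma weighted_tree_inequality:
  assumes p: "0 \<le> p" "p \<le> 1" and fin: "finite E" "finite V"
    and EV: "\<And>e. e \<in> E \<Longrightarrow> e \<subseteq> V" and u: "u \<in> V" and s: "0 \<le> s"
  shows "bexp p E (\<lambda>S. of_bool (v \<in> conn S u) * of_bool (x \<in> conn S u) * (1 + s) ^ card (conn S u))
    \<le> (\<Sum>z\<in>V. weighted_connection p E s u z * weighted_connection p E s z v * weighted_connection p E s z x)"
proof -
  define \<tau> where "\<tau> = (\<lambda>a b T. bexp p E (\<lambda>S. of_bool (insert b T \<subseteq> conn S a)))"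
  define part where "part = (\<lambda>T1 T2 T3 (T :: 'a set).
    T1 \<union> T2 \<union> T3 = T \<and> T1 \<inter> T2 = {} \<and> T1 \<inter> T3 = {} \<and> T2 \<inter> T3 = {})"
  define D where "D = (\<lambda>z T1 T2 T3 S. \<exists>S1 S2 S3. S1 \<subseteq> S \<and> S2 \<subseteq> S \<and> S3 \<subseteq> S \<and> S1 \<inter> S2 = {} \<and> S1 \<inter> S3 = {} \<and> S2 \<inter> S3 = {}
      \<and> insert z T1 \<subseteq> conn S1 u \<and> insert v T2 \<subseteq> conn S2 z \<and> insert x T3 \<subseteq> conn S3 z)"
  let ?P = "Pow V"
  have finP: "finite ?P" using fin by simp
  have sub: "conn S a \<subseteq> V" if "S \<subseteq> E" "a \<in> V" for S a
    by (rule conn_subset) (use that EV in auto)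
  have expand: "(1 + s) ^ card (conn S a) = (\<Sum>T\<in>?P. s ^ card T * of_bool (T \<subseteq> conn S a))" if "S \<subseteq> E" "a \<in> V" for S a
  proof -
    have "finite (conn S a)" using sub[OF that] fin finite_subset by blast
    then have "(1 + s) ^ card (conn S a) = (\<Sum>T\<in>Pow (conn S a). s ^ card T * of_bool (T \<subseteq> conn S a))"
      by (subst sum_power_card_Pow[symmetric]) auto
    also have "\<dots> = (\<Sum>T\<in>?P. s ^ card T * of_bool (T \<subseteq> conn S a))"
      by (rule sum.mono_neutral_left) (use finP sub[OF that] in auto)
    finally show ?thesis .
  qed
  have wc: "weighted_connection p E s a b = (\<Sum>T\<in>?P. s ^ card T * \<tau> a b T)" if "a \<in> V" for a b
  proof -
    have "weighted_connection p E s a b = bexp p E (\<lambda>S. \<Sum>T\<in>?P. s ^ card T * of_bool (insert b T \<subseteq> conn S a))"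
      unfolding weighted_connection_def
    proof (rule bexp_cong)
      fix S assume S: "S \<subseteq> E"
      show "of_bool (b \<in> conn S a) * (1 + s) ^ card (conn S a)
        = (\<Sum>T\<in>?P. s ^ card T * of_bool (insert b T \<subseteq> conn S a))"
        unfolding expand[OF S that] sum_distrib_left by (rule sum.cong) auto
    qed
    then show ?thesis by (simp add: bexp_sum bexp_cmult \<tau>_def)
  qed
  have D_le: "bexp p E (\<lambda>S. of_bool (D z T1 T2 T3 S)) \<le> \<tau> u z T1 * \<tau> z v T2 * \<tau> z x T3" for z T1 T2 T3
    unfolding D_def \<tau>_def
    by (rule bexp_BK3) (use fin p in \<open>auto dest: conn_mono\<close>)
  have \<tau>_nonneg: "0 \<le> \<tau> a b T" for a b T unfolding \<tau>_def by (rule bexp_nonneg) (use p in auto)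
  have split: "of_bool (v \<in> conn S u) * of_bool (x \<in> conn S u) * of_bool (T \<subseteq> conn S u)
     \<le> (\<Sum>z\<in>V. \<Sum>T1\<in>?P. \<Sum>T2\<in>?P. \<Sum>T3\<in>?P. of_bool (part T1 T2 T3 T) * (of_bool (D z T1 T2 T3 S) :: real))"
    if S: "S \<subseteq> E" and T: "T \<in> ?P" for S T
  proof (cases "v \<in> conn S u \<and> x \<in> conn S u \<and> T \<subseteq> conn S u")
    case True
    have "finite T" using T fin finite_subset by blast
    obtain z T1 T2 T3 where z: "z \<in> conn S u" "part T1 T2 T3 T" "D z T1 T2 T3 S"
    proof -
      have "\<exists>z T1 T2 T3. z \<in> conn S u \<and> part T1 T2 T3 T \<and> D z T1 T2 T3 S"
        unfolding part_def D_def conj_assoc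
        by (rule cluster_decomposition[OF \<open>finite T\<close>]) (use True in simp_all)
      then show ?thesis using that by (elim exE conjE)
    qed
    have mem: "z \<in> V" "T1 \<in> ?P" "T2 \<in> ?P" "T3 \<in> ?P"
      using z(1) sub[OF S u] z(2) T unfolding part_def by auto
    have "1 = of_bool (part T1 T2 T3 T) * (of_bool (D z T1 T2 T3 S) :: real)" using z by simp
    also have "\<dots> \<le> (\<Sum>T3\<in>?P. of_bool (part T1 T2 T3 T) * of_bool (D z T1 T2 T3 S))"
      by (rule member_le_sum[OF mem(4)]) (use finP in auto)
    also have "\<dots> \<le> (\<Sum>T2\<in>?P. \<Sum>T3\<in>?P. of_bool (part T1 T2 T3 T) * of_bool (D z T1 T2 T3 S))"
      by (rule member_le_sum[OF mem(3)]) (use finP in \<open>auto intro!: sum_nonneg\<close>)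
    also have "\<dots> \<le> (\<Sum>T1\<in>?P. \<Sum>T2\<in>?P. \<Sum>T3\<in>?P. of_bool (part T1 T2 T3 T) * of_bool (D z T1 T2 T3 S))"
      by (rule member_le_sum[OF mem(2)]) (use finP in \<open>auto intro!: sum_nonneg\<close>)
    also have "\<dots> \<le> (\<Sum>z\<in>V. \<Sum>T1\<in>?P. \<Sum>T2\<in>?P. \<Sum>T3\<in>?P. of_bool (part T1 T2 T3 T) * of_bool (D z T1 T2 T3 S))"
      by (rule member_le_sum[OF mem(1)]) (use fin in \<open>auto intro!: sum_nonneg\<close>)
    finally show ?thesis using True by simp
  qed (auto intro!: sum_nonneg)
  have "bexp p E (\<lambda>S. of_bool (v \<in> conn S u) * of_bool (x \<in> conn S u) * (1 + s) ^ card (conn S u))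
      = bexp p E (\<lambda>S. \<Sum>T\<in>?P. s ^ card T * (of_bool (v \<in> conn S u) * of_bool (x \<in> conn S u) * of_bool (T \<subseteq> conn S u)))"
    by (rule bexp_cong) (simp add: expand[OF _ u] sum_distrib_left mult_ac)
  also have "\<dots> \<le> bexp p E (\<lambda>S. \<Sum>T\<in>?P. s ^ card T *
      (\<Sum>z\<in>V. \<Sum>T1\<in>?P. \<Sum>T2\<in>?P. \<Sum>T3\<in>?P. of_bool (part T1 T2 T3 T) * of_bool (D z T1 T2 T3 S)))"
    by (intro bexp_mono sum_mono mult_left_mono split) (use p s in auto)
  also have "\<dots> = (\<Sum>T\<in>?P. \<Sum>z\<in>V. \<Sum>T1\<in>?P. \<Sum>T2\<in>?P. \<Sum>T3\<in>?P.
      s ^ card T * of_bool (part T1 T2 T3 T) * bexp p E (\<lambda>S. of_bool (D z T1 T2 T3 S)))"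
    by (simp add: bexp_sum bexp_cmult sum_distrib_left mult.assoc)
  also have "\<dots> \<le> (\<Sum>T\<in>?P. \<Sum>z\<in>V. \<Sum>T1\<in>?P. \<Sum>T2\<in>?P. \<Sum>T3\<in>?P.
      of_bool (part T1 T2 T3 T) * ((s ^ card T1 * \<tau> u z T1) * (s ^ card T2 * \<tau> z v T2) * (s ^ card T3 * \<tau> z x T3)))"
  proof (intro sum_mono)
    fix T z T1 T2 T3 assume "T1 \<in> ?P" "T2 \<in> ?P" "T3 \<in> ?P"
    then have f: "finite T1" "finite T2" "finite T3" using fin finite_subset by auto
    show "s ^ card T * of_bool (part T1 T2 T3 T) * bexp p E (\<lambda>S. of_bool (D z T1 T2 T3 S))
       \<le> of_bool (part T1 T2 T3 T) * ((s ^ card T1 * \<tau> u z T1) * (s ^ card T2 * \<tau> z v T2) * (s ^ card T3 * \<tau> z x T3))"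
    proof (cases "part T1 T2 T3 T")
      case True
      then have "T = T1 \<union> T2 \<union> T3" "T1 \<inter> T2 = {}" "(T1 \<union> T2) \<inter> T3 = {}" unfolding part_def by auto
      then have "card T = card T1 + card T2 + card T3" using f by (simp add: card_Un_disjoint)
      then have pw: "s ^ card T = s ^ card T1 * s ^ card T2 * s ^ card T3" by (simp add: power_add)
      have "s ^ card T * bexp p E (\<lambda>S. of_bool (D z T1 T2 T3 S)) \<le> s ^ card T * (\<tau> u z T1 * \<tau> z v T2 * \<tau> z x T3)"
        by (rule mult_left_mono[OF D_le]) (use s in auto)
      then show ?thesis using True unfolding pw by (simp add: mult_ac)
    qed simp
  qed
  also have "\<dots> = (\<Sum>z\<in>V. \<Sum>T1\<in>?P. \<Sum>T2\<in>?P. \<Sum>T3\<in>?P. \<Sum>T\<in>?P.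
      of_bool (part T1 T2 T3 T) * ((s ^ card T1 * \<tau> u z T1) * (s ^ card T2 * \<tau> z v T2) * (s ^ card T3 * \<tau> z x T3)))"
    by ((rule trans[OF sum.swap], rule sum.cong[OF refl])+) (rule refl)
  \<comment> \<open>With the sum over \<open>T\<close> innermost, a triple
    \<open>(T1, T2, T3)\<close> determines \<open>T\<close> as its union, so at most one term
    survives.\<close>
  also have "\<dots> \<le> (\<Sum>z\<in>V. \<Sum>T1\<in>?P. \<Sum>T2\<in>?P. \<Sum>T3\<in>?P.
      (s ^ card T1 * \<tau> u z T1) * (s ^ card T2 * \<tau> z v T2) * (s ^ card T3 * \<tau> z x T3))"
  proof (intro sum_mono)
    fix z T1 T2 T3
    let ?c = "(s ^ card T1 * \<tau> u z T1) * (s ^ card T2 * \<tau> z v T2) * (s ^ card T3 * \<tau> z x T3)"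
    have c: "0 \<le> ?c" using s \<tau>_nonneg by simp
    have "(\<Sum>T\<in>?P. of_bool (part T1 T2 T3 T) * ?c) = (\<Sum>T\<in>?P \<inter> {T1 \<union> T2 \<union> T3}. of_bool (part T1 T2 T3 T) * ?c)"
      by (rule sum.mono_neutral_right) (use finP in \<open>auto simp: part_def\<close>)
    also have "\<dots> \<le> (\<Sum>T\<in>?P \<inter> {T1 \<union> T2 \<union> T3}. ?c)"
      by (rule sum_mono) (use c in auto)
    also have "\<dots> \<le> ?c" using c by (cases "T1 \<union> T2 \<union> T3 \<in> ?P") auto
    finally show "(\<Sum>T\<in>?P. of_bool (part T1 T2 T3 T) * ?c) \<le> ?c" .
  qed
  also have "\<dots> = (\<Sum>z\<in>V. weighted_connection p E s u z * weighted_connection p E s z v * weighted_connection p E s z x)"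
  proof (rule sum.cong)
    fix z assume z: "z \<in> V"
    show "(\<Sum>T1\<in>?P. \<Sum>T2\<in>?P. \<Sum>T3\<in>?P. (s ^ card T1 * \<tau> u z T1) * (s ^ card T2 * \<tau> z v T2) * (s ^ card T3 * \<tau> z x T3))
      = weighted_connection p E s u z * weighted_connection p E s z v * weighted_connection p E s z x"
      unfolding wc[OF u] wc[OF z] sum_product3 ..
  qed simp
  finally show ?thesis .
qed

text \<open>Up to a factor \<open>1 + s\<close>, the derivative in \<open>s\<close> of the
  generating function of the cluster size; at \<open>s = 0\<close> it is the expected cluster size.
  Summing \<open>weighted_connection\<close> over its endpoint gives it back.\<close>

definition cluster_moment :: "real \<Rightarrow> 'v set set \<Rightarrow> real \<Rightarrow> 'v \<Rightarrow> real" where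
  "cluster_moment p E s x = bexp p E (\<lambda>S. real (card (conn S x)) * (1 + s) ^ card (conn S x))"

lemma power_le_one_plus_derivative:
  assumes "0 \<le> (s::real)"
  shows "(1 + s) ^ k \<le> 1 + s * real k * (1 + s) ^ k"
proof (induction k)
  case (Suc k)
  have "(1 + s) ^ Suc k \<le> (1 + s) * (1 + s * real k * (1 + s) ^ k)"
    using mult_left_mono[OF Suc, of "1 + s"] assms by simp
  also have "\<dots> = 1 + s + s * real k * (1 + s) ^ Suc k" by (simp add: algebra_simps)
  also have "\<dots> \<le> 1 + s * (1 + s) ^ Suc k + s * real k * (1 + s) ^ Suc k"
    using mult_left_mono[OF one_le_power[of "1 + s" "Suc k"], of s] assms by simp
  finally show ?case by (simp add: algebra_simps)
qed simp

text \<open>By \<open>k (1 + s)^k \<le> k + s k^2 (1 + s)^k\<close> it suffices to bound a tilted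
  second moment. Summing the tree inequality over both free ends produces one factor
  \<open>M\<close> for each of the three legs.\<close>

lemma cluster_moment_bootstrap:
  assumes p: "0 \<le> p" "p \<le> 1" and fin: "finite E" "finite V"
    and EV: "\<And>e. e \<in> E \<Longrightarrow> e \<subseteq> V" and u: "u \<in> V" and s: "0 \<le> s"
    and M: "\<And>x. x \<in> V \<Longrightarrow> cluster_moment p E s x \<le> M"
  shows "cluster_moment p E s u \<le> cluster_moment p E 0 u + s * M ^ 3"
proof -
  let ?G = "weighted_connection p E s"
  have card_eq: "real (card (conn S a)) = (\<Sum>y\<in>V. of_bool (y \<in> conn S a))" if "S \<subseteq> E" "a \<in> V" for S a
  proof -
    have "conn S a \<subseteq> V" by (rule conn_subset) (use that EV in auto)
    then have "V \<inter> {y. y \<in> conn S a} = conn S a" by auto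
    then show ?thesis using fin by simp
  qed
  have moment: "cluster_moment p E s a = (\<Sum>y\<in>V. ?G a y)" if "a \<in> V" for a
    unfolding cluster_moment_def weighted_connection_def bexp_sum[symmetric]
    by (rule bexp_cong) (simp only: card_eq[OF _ that] sum_distrib_right)
  have G0: "0 \<le> ?G a b" for a b by (rule weighted_connection_nonneg) (use p s in auto)
  have m0: "0 \<le> cluster_moment p E s a" for a
    unfolding cluster_moment_def by (rule bexp_nonneg) (use p s in auto)
  have M0: "0 \<le> M" using m0 M[OF u] order_trans by blast
  have "cluster_moment p E s u \<le> bexp p E (\<lambda>S. real (card (conn S u)) * (1 + 0) ^ card (conn S u)
      + s * ((real (card (conn S u)))\<^sup>2 * (1 + s) ^ card (conn S u)))"
    unfolding cluster_moment_def
  proof (rule bexp_mono)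
    fix S
    let ?k = "card (conn S u)"
    have "real ?k * (1 + s) ^ ?k \<le> real ?k * (1 + s * real ?k * (1 + s) ^ ?k)"
      by (rule mult_left_mono[OF power_le_one_plus_derivative]) (use s in auto)
    then show "real ?k * (1 + s) ^ ?k \<le> real ?k * (1 + 0) ^ ?k + s * ((real ?k)\<^sup>2 * (1 + s) ^ ?k)"
      by (simp add: power2_eq_square algebra_simps)
  qed (use p in auto)
  also have "\<dots> = cluster_moment p E 0 u + s * bexp p E (\<lambda>S. (real (card (conn S u)))\<^sup>2 * (1 + s) ^ card (conn S u))"
    by (simp add: bexp_add bexp_cmult cluster_moment_def)
  also have "bexp p E (\<lambda>S. (real (card (conn S u)))\<^sup>2 * (1 + s) ^ card (conn S u))
     = (\<Sum>v\<in>V. \<Sum>x\<in>V. bexp p E (\<lambda>S. of_bool (v \<in> conn S u) * of_bool (x \<in> conn S u) * (1 + s) ^ card (conn S u)))"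
    unfolding bexp_sum[symmetric]
  proof (rule bexp_cong)
    fix S assume S: "S \<subseteq> E"
    show "(real (card (conn S u)))\<^sup>2 * (1 + s) ^ card (conn S u)
      = (\<Sum>v\<in>V. \<Sum>x\<in>V. of_bool (v \<in> conn S u) * of_bool (x \<in> conn S u) * (1 + s) ^ card (conn S u))"
    proof -
      have "(\<Sum>v\<in>V. \<Sum>x\<in>V. of_bool (v \<in> conn S u) * of_bool (x \<in> conn S u) * (1 + s) ^ card (conn S u))
        = (\<Sum>v\<in>V. of_bool (v \<in> conn S u)) * (\<Sum>x\<in>V. of_bool (x \<in> conn S u)) * (1 + s) ^ card (conn S u)"
        by (subst sum_product) (simp only: sum_distrib_right)
      then show ?thesis by (simp only: card_eq[OF S u, symmetric] power2_eq_square)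
    qed
  qed
  also have "\<dots> \<le> (\<Sum>v\<in>V. \<Sum>x\<in>V. \<Sum>z\<in>V. ?G u z * ?G z v * ?G z x)"
    by (intro sum_mono weighted_tree_inequality) (use assms in auto)
  also have "\<dots> = (\<Sum>z\<in>V. \<Sum>v\<in>V. \<Sum>x\<in>V. ?G u z * ?G z v * ?G z x)"
    by (subst sum.swap[of _ V V], subst (2) sum.swap[of _ V V], rule refl)
  also have "\<dots> = (\<Sum>z\<in>V. ?G u z * cluster_moment p E s z * cluster_moment p E s z)"
  proof (rule sum.cong)
    fix z assume z: "z \<in> V"
    show "(\<Sum>v\<in>V. \<Sum>x\<in>V. ?G u z * ?G z v * ?G z x) = ?G u z * cluster_moment p E s z * cluster_moment p E s z"
      unfolding moment[OF z] by (subst mult.assoc, subst sum_product) (simp only: sum_distrib_left mult.assoc)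
  qed simp
  also have "\<dots> \<le> (\<Sum>z\<in>V. ?G u z * M * M)"
    by (intro sum_mono mult_mono mult_nonneg_nonneg M order_refl) (use G0 M0 m0 in auto)
  also have "\<dots> = cluster_moment p E s u * M * M" by (simp add: moment[OF u] sum_distrib_right)
  also have "\<dots> \<le> M * M * M" by (intro mult_right_mono M[OF u] M0)
  finally show ?thesis using s by (simp add: power3_eq_cube mult_left_mono)
qed

lemma continuous_on_Max_image:
  fixes f :: "'a \<Rightarrow> real \<Rightarrow> real"
  assumes "finite A" "A \<noteq> {}" "\<And>a. a \<in> A \<Longrightarrow> continuous_on X (f a)"
  shows "continuous_on X (\<lambda>t. Max ((\<lambda>a. f a t) ` A))"
  using assms
proof (induction A rule: finite_ne_induct)
  case (insert a A)
  then have "continuous_on X (\<lambda>t. max (f a t) (Max ((\<lambda>a. f a t) ` A)))"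
    by (intro continuous_on_max) auto
  then show ?case using insert by simp
qed simp

text \<open>
  The maximal moment \<open>M(s)\<close> satisfies \<open>M \<le> X + s M\<^sup>3\<close>, so it cannot cross the level \<open>2 X\<close> while
  \<open>s < 1 / (8 X\<^sup>2)\<close>.
\<close>

lemma cluster_moment_le:
  assumes p: "0 \<le> p" "p \<le> 1" and fin: "finite E" "finite V"
    and EV: "\<And>e. e \<in> E \<Longrightarrow> e \<subseteq> V" and u: "u \<in> V" and s: "0 \<le> s" "s < 1 / (8 * X\<^sup>2)"
    and X: "0 < X" "\<And>x. x \<in> V \<Longrightarrow> bexp p E (\<lambda>S. real (card (conn S x))) \<le> X"
  shows "cluster_moment p E s u \<le> 2 * X"
proof (rule ccontr)
  assume neg: "\<not> cluster_moment p E s u \<le> 2 * X"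
  define M where "M = (\<lambda>t. Max ((\<lambda>x. cluster_moment p E t x) ` V))"
  have V: "V \<noteq> {}" using u by auto
  have le_M: "cluster_moment p E t x \<le> M t" if "x \<in> V" for t x
    unfolding M_def by (rule Max_ge) (use fin that in auto)
  have zero: "cluster_moment p E 0 x \<le> X" if "x \<in> V" for x
    using X(2)[OF that] by (simp add: cluster_moment_def)
  have "continuous_on {0..s} M"
    unfolding M_def
    by (rule continuous_on_Max_image)
      (use fin V in \<open>auto simp: cluster_moment_def bexp_def intro!: continuous_intros\<close>)
  moreover have "M 0 \<le> 2 * X"
  proof -
    have "M 0 \<le> X" unfolding M_def by (rule Max.boundedI) (use fin V zero in auto)
    then show ?thesis using X by simp
  qed
  moreover have "2 * X \<le> M s" using le_M[OF u, of s] neg by simp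
  ultimately obtain t where t: "0 \<le> t" "t \<le> s" "M t = 2 * X"
    using IVT'[of M 0 "2 * X" s] s by auto
  have "2 * X \<le> X + t * (2 * X) ^ 3"
    unfolding t(3)[symmetric] M_def
  proof (rule Max.boundedI)
    fix m assume "m \<in> cluster_moment p E t ` V"
    then obtain x where x: "x \<in> V" "m = cluster_moment p E t x" by auto
    have "m \<le> cluster_moment p E 0 x + t * M t ^ 3"
      unfolding x(2) by (rule cluster_moment_bootstrap[OF p fin EV x(1) t(1) le_M])
    then show "m \<le> X + t * Max ((\<lambda>x. cluster_moment p E t x) ` V) ^ 3"
      using zero[OF x(1)] by (simp add: M_def)
  qed (use fin V in auto)
  then have "X * 1 \<le> X * (t * (8 * X\<^sup>2))" by (simp add: power2_eq_square power3_eq_cube algebra_simps)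
  then have "1 \<le> t * (8 * X\<^sup>2)" using X(1) by (simp only: mult_le_cancel_left_pos)
  also have "\<dots> \<le> s * (8 * X\<^sup>2)" by (rule mult_right_mono[OF t(2)]) simp
  also have "\<dots> < 1" using s X(1) by (simp add: field_simps)
  finally show False by simp
qed

section \<open>Upper tail of the number of vertices in large clusters\<close>

definition large_count :: "'v set \<Rightarrow> nat \<Rightarrow> 'v set set \<Rightarrow> nat" where
  "large_count V m S = card {x \<in> V. m \<le> card (conn S x)}"

text \<open>A large cluster contributes all its vertices. Hence the exponential of the count is a
  product over clusters, the form bounded by the exploration argument.\<close>

lemma large_count_eq_sum_clusters:
  assumes "finite V" "\<And>e. e \<in> S \<Longrightarrow> e \<subseteq> V"
  shows "large_count V m S = (\<Sum>C\<in>conn S ` V. if m \<le> card C then card C else 0)"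
proof -
  have sub: "conn S x \<subseteq> V" if "x \<in> V" for x by (rule conn_subset) (use that assms in auto)
  let ?CC = "{C \<in> conn S ` V. m \<le> card C}"
  have "{x \<in> V. m \<le> card (conn S x)} = \<Union>?CC"
  proof
    show "{x \<in> V. m \<le> card (conn S x)} \<subseteq> \<Union>?CC" by (auto intro!: bexI[of _ "conn S _"])
    show "\<Union>?CC \<subseteq> {x \<in> V. m \<le> card (conn S x)}"
    proof
      fix y assume "y \<in> \<Union>?CC"
      then obtain x where x: "x \<in> V" "m \<le> card (conn S x)" "y \<in> conn S x" by auto
      then show "y \<in> {x \<in> V. m \<le> card (conn S x)}" using sub[of x] conn_eq[of y S x] by auto
    qed
  qed
  moreover have "card (\<Union>?CC) = (\<Sum>C\<in>?CC. card C)"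
  proof (rule card_Union_disjoint)
    show "disjoint ?CC"
    proof (rule disjointI)
      fix C D assume "C \<in> ?CC" "D \<in> ?CC" "C \<noteq> D"
      then obtain x y where "C = conn S x" "D = conn S y" by auto
      moreover have "z \<notin> conn S y" if "z \<in> conn S x" for z
        using conn_eq[of z S x] conn_eq[of z S y] that \<open>C \<noteq> D\<close> calculation by argo
      ultimately show "C \<inter> D = {}" by blast
    qed
    show "finite C" if C: "C \<in> ?CC" for C
    proof -
      obtain x where "x \<in> V" "C = conn S x" using C by auto
      then show ?thesis using finite_subset[OF sub[of x] assms(1)] by simp
    qed
  qed
  moreover have "(\<Sum>C\<in>?CC. card C) = (\<Sum>C\<in>conn S ` V. if m \<le> card C then card C else 0)"
    by (rule sum.inter_filter) (use assms in auto)
  ultimately show ?thesis by (simp add: large_count_def)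
qed

text \<open>An exponential Markov inequality for the weight \<open>r ^ large_count V m S\<close>.
  The available rate is shared: one half is the tilt \<open>r\<close>, the other half yields the
  factor \<open>exp (- (m * y))\<close> for the rarity of clusters with at least \<open>m\<close>
  vertices.\<close>

lemma large_count_tail:
  assumes p: "0 \<le> p" "p \<le> 1" and fin: "finite E" "finite V"
    and EV: "\<And>e. e \<in> E \<Longrightarrow> e \<subseteq> V"
    and X: "1 \<le> X" "\<And>x. x \<in> V \<Longrightarrow> bexp p E (\<lambda>S. real (card (conn S x))) \<le> X"
  shows "bexp p E (\<lambda>S. of_bool (k \<le> large_count V m S))
    \<le> exp (2 * X * real (card V) * exp (- (real m / (64 * X\<^sup>2))) - real k / (64 * X\<^sup>2))"
proof -
  \<comment> \<open>The moment bound holds for \<open>s < 1 / (8 * X\<^sup>2)\<close>, and half of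
    this is taken. The square root in \<open>r\<close> leaves a spare factor \<open>r ^ j\<close>
    out of \<open>(1 + s) ^ j\<close>, and \<open>y = s / 4\<close> makes
    \<open>exp (2 * y) \<le> 1 + s\<close>.\<close>
  define s where "s = 1 / (16 * X\<^sup>2)"
  define r where "r = sqrt (1 + s)"
  define y where "y = 1 / (64 * X\<^sup>2)"
  have X2: "1 \<le> X\<^sup>2" using X by simp
  have s: "0 < s" "s < 1 / (8 * X\<^sup>2)" using X2 by (auto simp: s_def intro!: divide_strict_left_mono)
  have r: "1 \<le> r" "r\<^sup>2 = 1 + s" using s by (auto simp: r_def)
  have y: "0 \<le> y" "y \<le> 1 / 64" "s = 4 * y" using X2 by (auto simp: y_def s_def divide_le_eq)
  have "exp y \<le> r"
  proof (rule power2_le_imp_le)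
    have "exp (2 * y) \<le> 1 + 2 * y + (2 * y)\<^sup>2" by (rule exp_bound) (use y in auto)
    also have "(2 * y)\<^sup>2 \<le> 2 * y"
      using mult_right_mono[of "2 * y" 1 "2 * y"] y by (simp add: power2_eq_square)
    finally have "exp (2 * y) \<le> 1 + s" using y by simp
    then show "(exp y)\<^sup>2 \<le> r\<^sup>2" unfolding r(2) by (simp add: exp_double)
  qed (use r in auto)
  then have r_pow: "exp (real j * y) \<le> r ^ j" for j :: nat
    by (simp add: exp_of_nat_mult power_mono)
  define f where "f = (\<lambda>j. if m \<le> j then r ^ j else 1)"
  have f1: "1 \<le> f j" for j using r by (simp add: f_def)
  have fmono: "mono f"
  proof (rule monoI)
    fix i j :: nat assume "i \<le> j"
    then show "f i \<le> f j" using r power_increasing[of i j r] one_le_power[of r j] by (auto simp: f_def)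
  qed
  have each: "bexp p E (\<lambda>S. f (card (conn S x))) \<le> exp (2 * X * exp (- (real m * y)))" if x: "x \<in> V" for x
  proof -
    have "bexp p E (\<lambda>S. f (card (conn S x)))
       \<le> bexp p E (\<lambda>S. 1 + exp (- (real m * y)) * (real (card (conn S x)) * (1 + s) ^ card (conn S x)))"
    proof (rule bexp_mono)
      fix S assume "S \<subseteq> E"
      then have "finite S" using fin finite_subset by auto
      let ?j = "card (conn S x)"
      have j: "1 \<le> ?j" using card_conn_pos[OF \<open>finite S\<close>, of x] by simp
      show "f ?j \<le> 1 + exp (- (real m * y)) * (real ?j * (1 + s) ^ ?j)"
      proof (cases "m \<le> ?j")
        case True
        have "r ^ ?j * exp (real m * y) \<le> r ^ ?j * r ^ ?j"
          by (rule mult_left_mono) (use r_pow[of m] power_increasing[OF True r(1)] r in auto)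
        also have "\<dots> = (1 + s) ^ ?j" by (simp add: r(2)[symmetric] power2_eq_square power_mult_distrib)
        also have "\<dots> \<le> real ?j * (1 + s) ^ ?j"
          using mult_right_mono[of 1 "real ?j" "(1 + s) ^ ?j"] j s by simp
        finally have "r ^ ?j \<le> exp (- (real m * y)) * (real ?j * (1 + s) ^ ?j)"
          by (simp add: exp_minus field_simps)
        then show ?thesis using True by (simp add: f_def)
      next
        case False
        then show ?thesis using s by (simp add: f_def)
      qed
    qed (use p in auto)
    also have "\<dots> = 1 + exp (- (real m * y)) * cluster_moment p E s x"
      using fin by (simp add: bexp_add bexp_cmult bexp_const cluster_moment_def)
    also have "\<dots> \<le> 1 + exp (- (real m * y)) * (2 * X)"
      by (intro add_mono mult_left_mono order_refl cluster_moment_le[of p E V]) (use assms s x in auto)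
    also have "\<dots> \<le> exp (2 * X * exp (- (real m * y)))"
      using exp_ge_add_one_self[of "exp (- (real m * y)) * (2 * X)"] by (simp add: mult_ac)
    finally show ?thesis .
  qed
  have "exp (real k * y) * bexp p E (\<lambda>S. of_bool (k \<le> large_count V m S))
      = bexp p E (\<lambda>S. exp (real k * y) * of_bool (k \<le> large_count V m S))"
    by (simp add: bexp_cmult)
  also have "\<dots> \<le> bexp p E (\<lambda>S. \<Prod>C\<in>conn S ` V. f (card C))"
  proof (rule bexp_mono)
    fix S assume S: "S \<subseteq> E"
    have "(\<Prod>C\<in>conn S ` V. f (card C)) = (\<Prod>C\<in>conn S ` V. r ^ (if m \<le> card C then card C else 0))"
      by (rule prod.cong) (auto simp: f_def)
    also have "\<dots> = r ^ (large_count V m S)"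
      by (subst large_count_eq_sum_clusters) (use fin S EV in \<open>auto simp: power_sum\<close>)
    finally have eq: "(\<Prod>C\<in>conn S ` V. f (card C)) = r ^ (large_count V m S)" .
    show "exp (real k * y) * of_bool (k \<le> large_count V m S) \<le> (\<Prod>C\<in>conn S ` V. f (card C))"
      unfolding eq using r_pow[of k] power_increasing[of k "large_count V m S" r] r
      by (cases "k \<le> large_count V m S") auto
  qed (use p in auto)
  also have "\<dots> \<le> (\<Prod>x\<in>V. bexp p E (\<lambda>S. f (card (conn S x))))"
    by (rule bexp_exploration) (use fin p f1 fmono in auto)
  also have "\<dots> \<le> (\<Prod>x\<in>V. exp (2 * X * exp (- (real m * y))))"
    by (intro prod_mono conjI each bexp_nonneg) (use p f1 order_trans[OF zero_le_one f1] in auto)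
  also have "\<dots> = exp (2 * X * real (card V) * exp (- (real m * y)))"
    by (simp add: exp_of_nat_mult[symmetric] mult_ac)
  finally have "bexp p E (\<lambda>S. of_bool (k \<le> large_count V m S)) \<le> exp (2 * X * real (card V) * exp (- (real m * y)) - real k * y)"
    by (simp add: exp_diff field_simps)
  then show ?thesis by (simp add: y_def)
qed

subsection \<open>Local modifications of the number of vertices in large clusters\<close>

lemma large_count_mono:
  assumes "finite V" "finite T" "S \<subseteq> T"
  shows "large_count V m S \<le> large_count V m T"
  unfolding large_count_def
  by (rule card_mono) (use assms(1) le_trans[OF _ card_conn_mono[OF assms(2,3)]] in auto)

lemma large_count_le_card: "finite V \<Longrightarrow> large_count V m S \<le> card V"
  unfolding large_count_def by (rule card_mono) auto

text \<open>While the cluster in \<open>W\<close> is smaller than the cluster in \<open>S\<close>,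
  some edge of \<open>S\<close> leaves it; adding that edge gains at least one vertex.\<close>

lemma conn_certificate:
  assumes "finite S" "j \<le> card (conn S x)"
  shows "\<exists>W\<subseteq>S. card W \<le> j \<and> j \<le> card (conn W x)"
  using assms(2)
proof (induction j)
  case 0
  show ?case by (intro exI[of _ "{}"]) simp
next
  case (Suc j)
  then obtain W where W: "W \<subseteq> S" "card W \<le> j" "j \<le> card (conn W x)" by auto
  have finW: "finite W" using W(1) assms(1) finite_subset by blast
  show ?case
  proof (cases "Suc j \<le> card (conn W x)")
    case True
    then show ?thesis using W by (intro exI[of _ W]) simp
  next
    case False
    have "\<exists>y z. y \<in> conn W x \<and> z \<notin> conn W x \<and> {y, z} \<in> S"
    proof (rule ccontr)
      assume none: "\<not> ?thesis"
      have "w \<in> conn W x" if "w \<in> conn S x" for w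
        using that by (induction rule: conn_induct) (use none in auto)
      then have "conn S x \<subseteq> conn W x" by blast
      then have "card (conn S x) \<le> card (conn W x)" by (rule card_mono[OF finite_conn[OF finW]])
      then show False using False Suc.prems by simp
    qed
    then obtain y z where yz: "y \<in> conn W x" "z \<notin> conn W x" "{y, z} \<in> S" by auto
    let ?W = "insert {y, z} W"
    have sub: "conn W x \<subseteq> conn ?W x" by (rule conn_mono) auto
    have "y \<in> conn ?W x" using sub yz(1) by blast
    then have "z \<in> conn ?W x" by (rule conn_step) simp
    then have "insert z (conn W x) \<subseteq> conn ?W x" using sub by simp
    then have "card (insert z (conn W x)) \<le> card (conn ?W x)"
      by (intro card_mono finite_conn) (use finW in auto)
    then have "Suc (card (conn W x)) \<le> card (conn ?W x)" using yz(2) finite_conn[OF finW] by simp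
    moreover have "card ?W \<le> Suc (card W)" using finW by (simp add: card_insert_if)
    ultimately show ?thesis using W yz(3) by (intro exI[of _ ?W]) auto
  qed
qed

lemma large_count_certificate:
  assumes "finite V" "finite S" "k \<le> large_count V m S"
  shows "\<exists>W\<subseteq>S. card W \<le> k * m \<and> k \<le> large_count V m W"
proof -
  obtain A where A: "A \<subseteq> {x \<in> V. m \<le> card (conn S x)}" "card A = k"
    by (rule obtain_subset_with_card_n[OF assms(3)[unfolded large_count_def]])
  have finA: "finite A" using A(1) by (rule finite_subset) (use assms in simp)
  have "\<forall>x\<in>A. \<exists>W\<subseteq>S. card W \<le> m \<and> m \<le> card (conn W x)"
    using A(1) conn_certificate[OF assms(2)] by auto
  then obtain W where W: "\<And>x. x \<in> A \<Longrightarrow> W x \<subseteq> S \<and> card (W x) \<le> m \<and> m \<le> card (conn (W x) x)" by metis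
  let ?W = "\<Union>x\<in>A. W x"
  have sub: "?W \<subseteq> S" using W by auto
  have finW: "finite ?W" using sub assms(2) finite_subset by auto
  have "card ?W \<le> (\<Sum>x\<in>A. card (W x))" by (rule card_UN_le[OF finA])
  also have "\<dots> \<le> (\<Sum>x\<in>A. m)" by (rule sum_mono) (use W in auto)
  finally have "card ?W \<le> k * m" using A by simp
  moreover have "k \<le> large_count V m ?W"
    unfolding large_count_def A(2)[symmetric]
  proof (rule card_mono)
    show "A \<subseteq> {x \<in> V. m \<le> card (conn ?W x)}"
    proof
      fix x assume x: "x \<in> A"
      have "card (conn (W x) x) \<le> card (conn ?W x)" by (rule card_conn_mono) (use finW x in auto)
      then show "x \<in> {x \<in> V. m \<le> card (conn ?W x)}" using W[OF x] A(1) x by auto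
    qed
  qed (use assms in simp)
  ultimately show ?thesis using sub by (intro exI[of _ ?W]) simp
qed

lemma conn_insert_far:
  assumes "x \<notin> conn S a" "x \<notin> conn S b"
  shows "conn (insert {a, b} S) x = conn S x"
proof
  show "conn (insert {a, b} S) x \<subseteq> conn S x"
  proof
    fix y assume "y \<in> conn (insert {a, b} S) x"
    then show "y \<in> conn S x"
    proof (induction rule: conn_induct)
      case (step y z)
      have "y \<noteq> a" "y \<noteq> b" using conn_sym[OF step.IH] assms by auto
      then have "{y, z} \<noteq> {a, b}" by auto
      then have "{y, z} \<in> S" using step(2) by simp
      then show ?case by (rule conn_step[OF step.IH])
    qed simp
  qed
qed (rule conn_mono, auto)

text \<open>A new edge \<open>{a, b}\<close> changes only the clusters of \<open>a\<close> and
  \<open>b\<close>. Vertices that become large come from those of the two clusters that were small,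
  each with fewer than \<open>m\<close> vertices.\<close>

lemma large_count_insert_le:
  assumes "finite V" "finite S"
  shows "large_count V m (insert {a, b} S) \<le> large_count V m S + 2 * m"
proof -
  define small where "small = (\<lambda>y. if card (conn S y) < m then conn S y else {})"
  have small: "finite (small y)" "card (small y) \<le> m" for y
    using finite_conn[OF assms(2), of y] by (auto simp: small_def)
  have "{x \<in> V. m \<le> card (conn (insert {a, b} S) x)}
      \<subseteq> {x \<in> V. m \<le> card (conn S x)} \<union> (small a \<union> small b)"
  proof
    fix x assume x: "x \<in> {x \<in> V. m \<le> card (conn (insert {a, b} S) x)}"
    show "x \<in> {x \<in> V. m \<le> card (conn S x)} \<union> (small a \<union> small b)"
    proof (cases "m \<le> card (conn S x)")
      case False
      have "x \<in> conn S a \<or> x \<in> conn S b"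
      proof (rule ccontr)
        assume "\<not> ?thesis"
        then have "conn (insert {a, b} S) x = conn S x" by (intro conn_insert_far) auto
        then show False using x False by simp
      qed
      then have "x \<in> small a \<or> x \<in> small b"
        using False conn_eq[of x S a] conn_eq[of x S b] unfolding small_def by auto
      then show ?thesis by blast
    qed (use x in simp)
  qed
  then have "large_count V m (insert {a, b} S) \<le> card ({x \<in> V. m \<le> card (conn S x)} \<union> (small a \<union> small b))"
    unfolding large_count_def by (rule card_mono[rotated]) (use assms small in auto)
  also have "\<dots> \<le> large_count V m S + (card (small a) + card (small b))"
    unfolding large_count_def by (meson add_left_mono card_Un_le order_trans)
  finally show ?thesis using small(2)[of a] small(2)[of b] by linarith
qed

definition dist_edges :: "'e set \<Rightarrow> 'e set \<Rightarrow> nat" where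
  "dist_edges S T = card ((S - T) \<union> (T - S))"

lemma dist_edges_triangle:
  assumes "finite S" "finite T" "finite U"
  shows "dist_edges S U \<le> dist_edges S T + dist_edges T U"
proof -
  have "(S - U) \<union> (U - S) \<subseteq> ((S - T) \<union> (T - S)) \<union> ((T - U) \<union> (U - T))" by blast
  then have "dist_edges S U \<le> card (((S - T) \<union> (T - S)) \<union> ((T - U) \<union> (U - T)))"
    unfolding dist_edges_def by (rule card_mono[rotated]) (use assms in auto)
  also have "\<dots> \<le> dist_edges S T + dist_edges T U" unfolding dist_edges_def by (rule card_Un_le)
  finally show ?thesis .
qed

text \<open>
  A vertex \<open>y\<close> next to a large cluster, but not in one, is detached from its own small cluster and
  attached to the large one.
\<close>

lemma large_count_raise:
  assumes fin: "finite V" "finite E" and S: "S \<subseteq> E"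
    and deg: "\<And>y. y \<in> V \<Longrightarrow> card {e \<in> E. y \<in> e} \<le> D"
    and connected: "\<And>U. U \<subseteq> V \<Longrightarrow> U \<noteq> {} \<Longrightarrow> U \<noteq> V \<Longrightarrow> \<exists>x\<in>U. \<exists>y\<in>V - U. {x, y} \<in> E"
    and count: "0 < large_count V m S" "large_count V m S < card V"
  shows "\<exists>S'\<subseteq>E. large_count V m S' = Suc (large_count V m S) \<and> dist_edges S S' \<le> D"
proof -
  define U where "U = {x \<in> V. m \<le> card (conn S x)}"
  have cardU: "card U = large_count V m S" by (simp add: U_def large_count_def)
  have "U \<subseteq> V" by (auto simp: U_def)
  moreover have "U \<noteq> {}" using count(1) cardU by (metis card.empty less_irrefl)
  moreover have "U \<noteq> V" using count(2) cardU by auto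
  ultimately obtain x y where xy: "x \<in> U" "y \<in> V - U" "{x, y} \<in> E" using connected by blast
  define S0 where "S0 = {e \<in> S. y \<notin> e}"
  define S' where "S' = insert {x, y} S0"
  have finS: "finite S" by (rule finite_subset[OF S fin(2)])
  moreover have "finite S0" unfolding S0_def using finS by simp
  ultimately have finS: "finite S" "finite S0" "finite S'" by (simp_all add: S'_def)
  have y_alone: "conn S0 y = {y}"
  proof -
    have "w = y" if "w \<in> conn S0 y" for w
      using that by (induction rule: conn_induct) (auto simp: S0_def)
    then show ?thesis by auto
  qed
  have far: "conn S0 w = conn S w" if "w \<notin> conn S y" for w
  proof
    show "conn S0 w \<subseteq> conn S w" by (rule conn_mono) (auto simp: S0_def)
    have "conn S w = conn {e \<in> S. e \<inter> conn S y = {}} w" by (rule conn_avoiding[OF that])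
    also have "\<dots> \<subseteq> conn S0 w" by (rule conn_mono) (auto simp: S0_def intro: conn_refl)
    finally show "conn S w \<subseteq> conn S0 w" .
  qed
  \<comment> \<open>Detaching \<open>y\<close> affects only its own cluster, whose vertices were not
    counted and are still not counted afterwards. The count therefore changes exactly by
    \<open>y\<close>.\<close>
  have small: "card (conn S w) < m" "card (conn S0 w) < m" if "w \<in> conn S y" for w
  proof -
    show *: "card (conn S w) < m" using conn_eq[OF that] xy(2) by (auto simp: U_def)
    have "card (conn S0 w) \<le> card (conn S w)" by (rule card_conn_mono) (use finS in \<open>auto simp: S0_def\<close>)
    then show "card (conn S0 w) < m" using * by simp
  qed
  have x_far: "x \<notin> conn S y" using small(1)[of x] xy(1) by (auto simp: U_def)
  have S0x: "conn S0 x = conn S x" by (rule far[OF x_far])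
  have mono0: "conn S0 w \<subseteq> conn S' w" for w by (rule conn_mono) (auto simp: S'_def)
  have y_in: "y \<in> conn S' x"
    by (rule conn_step[of x]) (auto simp: S'_def)
  have large_x: "m \<le> card (conn S' x)"
  proof -
    have "card (conn S0 x) \<le> card (conn S' x)" by (rule card_conn_mono) (use finS in \<open>auto simp: S'_def\<close>)
    then show ?thesis using S0x xy(1) by (simp add: U_def)
  qed
  have "{w \<in> V. m \<le> card (conn S' w)} = insert y U"
  proof (intro set_eqI)
    fix w
    consider "w \<in> conn S x" | "w = y" | "w \<notin> conn S x" "w \<noteq> y" by blast
    then show "w \<in> {w \<in> V. m \<le> card (conn S' w)} \<longleftrightarrow> w \<in> insert y U"
    proof cases
      case 1
      then have "w \<in> conn S' x" using mono0[of x] S0x by auto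
      then have "conn S' w = conn S' x" by (rule conn_eq)
      moreover have "conn S w = conn S x" by (rule conn_eq[OF 1])
      ultimately show ?thesis using large_x xy(1,2) by (auto simp: U_def)
    next
      case 2
      then show ?thesis using conn_eq[OF y_in] large_x xy(2) by simp
    next
      case 3
      then have "conn S' w = conn S0 w"
        unfolding S'_def by (intro conn_insert_far) (simp_all add: S0x y_alone)
      then have "m \<le> card (conn S' w) \<longleftrightarrow> m \<le> card (conn S w)"
        using far[of w] small[of w] by (cases "w \<in> conn S y") auto
      then show ?thesis using 3 by (simp add: U_def)
    qed
  qed
  then have "large_count V m S' = Suc (large_count V m S)"
    using xy(2) fin(1) cardU by (simp add: large_count_def[of V m S'] U_def)
  moreover have "dist_edges S S' \<le> D"
  proof -
    \<comment> \<open>Every modified edge contains \<open>y\<close>, so their number is bounded by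
      its degree.\<close>
    have "(S - S') \<union> (S' - S) \<subseteq> {e \<in> E. y \<in> e}" using S xy(3) by (auto simp: S'_def S0_def)
    then have "dist_edges S S' \<le> card {e \<in> E. y \<in> e}"
      unfolding dist_edges_def by (rule card_mono[rotated]) (use fin in auto)
    then show ?thesis using deg[of y] xy(2) by simp
  qed
  moreover have "S' \<subseteq> E" using S xy(3) by (auto simp: S'_def S0_def)
  ultimately show ?thesis by blast
qed

lemma large_count_raise_to:
  assumes fin: "finite V" "finite E" and S: "S \<subseteq> E"
    and deg: "\<And>y. y \<in> V \<Longrightarrow> card {e \<in> E. y \<in> e} \<le> D"
    and connected: "\<And>U. U \<subseteq> V \<Longrightarrow> U \<noteq> {} \<Longrightarrow> U \<noteq> V \<Longrightarrow> \<exists>x\<in>U. \<exists>y\<in>V - U. {x, y} \<in> E"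
    and count: "0 < large_count V m S" "large_count V m S + r \<le> card V"
  shows "\<exists>S'\<subseteq>E. large_count V m S' = large_count V m S + r \<and> dist_edges S S' \<le> r * D"
  using count(2)
proof (induction r)
  case 0
  show ?case using S by (intro exI[of _ S]) (simp add: dist_edges_def)
next
  case (Suc r)
  then obtain S' where S': "S' \<subseteq> E" "large_count V m S' = large_count V m S + r" "dist_edges S S' \<le> r * D" by auto
  then obtain T where T: "T \<subseteq> E" "large_count V m T = Suc (large_count V m S')" "dist_edges S' T \<le> D"
    using large_count_raise[OF fin S'(1) deg connected, of m] Suc.prems count(1) by auto
  have "dist_edges S T \<le> dist_edges S S' + dist_edges S' T"
    by (rule dist_edges_triangle; rule finite_subset[OF _ fin(2)]; fact)
  then show ?case using S' T by (intro exI[of _ T]) auto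
qed

text \<open>Flipping one edge is a bijection of configurations which changes weights by a factor at
  most \<open>1 / \<mu>\<close>.\<close>

lemma bexp_flip_le:
  assumes "finite E" "e \<in> E" "0 < \<mu>" "\<mu> \<le> p" "\<mu> \<le> 1 - p" "\<And>S. 0 \<le> f S"
  shows "bexp p E (\<lambda>S. f (if e \<in> S then S - {e} else insert e S)) \<le> bexp p E f / \<mu>"
proof -
  let ?E = "E - {e}"
  have fin: "finite ?E" "e \<notin> ?E" and E: "E = insert e ?E" using assms(1,2) by auto
  have p: "0 \<le> p" "p \<le> 1" using assms by auto
  have nn: "0 \<le> bexp p ?E (\<lambda>S. f (insert e S))" "0 \<le> bexp p ?E f"
    by (rule bexp_nonneg; use p assms in simp)+
  have 1: "bexp p ?E (\<lambda>S. f (if e \<in> insert e S then insert e S - {e} else insert e (insert e S))) = bexp p ?E f"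
  proof (rule bexp_cong)
    fix S assume "S \<subseteq> ?E"
    then have "insert e S - {e} = S" by auto
    then show "f (if e \<in> insert e S then insert e S - {e} else insert e (insert e S)) = f S" by simp
  qed
  have 2: "bexp p ?E (\<lambda>S. f (if e \<in> S then S - {e} else insert e S)) = bexp p ?E (\<lambda>S. f (insert e S))"
    by (rule bexp_cong) auto
  have "bexp p E (\<lambda>S. f (if e \<in> S then S - {e} else insert e S))
     = p * bexp p ?E f + (1 - p) * bexp p ?E (\<lambda>S. f (insert e S))"
    by (subst E, subst bexp_insert[OF fin]) (simp only: 1 2)
  also have "\<dots> \<le> 1 * bexp p ?E f + 1 * bexp p ?E (\<lambda>S. f (insert e S))"
    by (intro add_mono mult_right_mono nn) (use p in auto)
  also have "\<dots> \<le> ((1 - p) / \<mu>) * bexp p ?E f + (p / \<mu>) * bexp p ?E (\<lambda>S. f (insert e S))"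
    by (intro add_mono mult_right_mono nn) (use assms in \<open>auto simp: le_divide_eq\<close>)
  also have "\<dots> = bexp p (insert e ?E) f / \<mu>"
    by (subst bexp_insert[OF fin]) (simp add: add_divide_distrib)
  finally show ?thesis by (simp only: E[symmetric])
qed

text \<open>A union bound over the modified edges: each of the \<open>M\<close> moves either changes
  nothing, the summand 1, or flips one of \<open>card E\<close> edges at the price
  \<open>1 / \<mu>\<close>.\<close>

lemma bexp_modification:
  assumes "finite E" "0 < \<mu>" "\<mu> \<le> p" "\<mu> \<le> 1 - p"
    and "\<And>S. S \<subseteq> E \<Longrightarrow> A S \<Longrightarrow> \<exists>S'\<subseteq>E. B S' \<and> dist_edges S S' \<le> M"
  shows "bexp p E (\<lambda>S. of_bool (A S)) \<le> (1 + card E / \<mu>) ^ M * bexp p E (\<lambda>S. of_bool (B S))"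
  using assms(5)
proof (induction M arbitrary: B)
  case 0
  have "bexp p E (\<lambda>S. of_bool (A S)) \<le> bexp p E (\<lambda>S. of_bool (B S))"
  proof (rule bexp_mono)
    fix S assume S: "S \<subseteq> E"
    have "B S" if "A S"
    proof -
      obtain S' where S': "S' \<subseteq> E" "B S'" "dist_edges S S' \<le> 0" using 0[OF S \<open>A S\<close>] by blast
      have "finite ((S - S') \<union> (S' - S))" using S S'(1) assms(1) by (meson finite_Diff finite_UnI finite_subset)
      then have "S = S'" using S'(3) by (auto simp: dist_edges_def)
      then show ?thesis using S'(2) by simp
    qed
    then show "(of_bool (A S) :: real) \<le> of_bool (B S)" by auto
  qed (use assms in auto)
  then show ?case by simp
next
  case (Suc M)
  let ?flip = "\<lambda>e S. if e \<in> S then S - {e} else insert e S"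
  define B1 where "B1 = (\<lambda>S. B S \<or> (\<exists>e\<in>E. B (?flip e S)))"
  have p: "0 \<le> p" "p \<le> 1" using assms by auto
  have near: "\<exists>S'\<subseteq>E. B1 S' \<and> dist_edges S S' \<le> M" if S: "S \<subseteq> E" and "A S" for S
  proof -
    obtain T where T: "T \<subseteq> E" "B T" "dist_edges S T \<le> Suc M" using Suc.prems[OF S \<open>A S\<close>] by blast
    show ?thesis
    proof (cases "S = T")
      case True
      then show ?thesis using T by (intro exI[of _ T]) (simp add: B1_def dist_edges_def)
    next
      case False
      then obtain e where e: "e \<in> (S - T) \<union> (T - S)" by blast
      have eE: "e \<in> E" using e S T(1) by auto
      have fin: "finite ((S - T) \<union> (T - S))" using S T(1) assms(1) by (meson finite_Diff finite_UnI finite_subset)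
      have "(S - ?flip e T) \<union> (?flip e T - S) = ((S - T) \<union> (T - S)) - {e}" using e by auto
      then have "dist_edges S (?flip e T) \<le> M"
        using T(3) e fin unfolding dist_edges_def by simp
      moreover have "?flip e (?flip e T) = T" by auto
      then have "B (?flip e (?flip e T))" by (rule ssubst) (rule T(2))
      then have "B1 (?flip e T)" unfolding B1_def using eE by blast
      moreover have "?flip e T \<subseteq> E" using T(1) eE by auto
      ultimately show ?thesis by blast
    qed
  qed
  have step: "bexp p E (\<lambda>S. of_bool (A S)) \<le> (1 + card E / \<mu>) ^ M * bexp p E (\<lambda>S. of_bool (B1 S))"
    by (rule Suc.IH) (rule near)
  have "bexp p E (\<lambda>S. of_bool (B1 S)) \<le> bexp p E (\<lambda>S. of_bool (B S) + (\<Sum>e\<in>E. of_bool (B (?flip e S))))"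
  proof (rule bexp_mono)
    fix S
    show "of_bool (B1 S) \<le> of_bool (B S) + (\<Sum>e\<in>E. of_bool (B (?flip e S)) :: real)"
    proof (cases "\<exists>e\<in>E. B (?flip e S)")
      case True
      then obtain e where e: "e \<in> E" "B (?flip e S)" by blast
      have "(1::real) = of_bool (B (?flip e S))" using e by simp
      also have "\<dots> \<le> (\<Sum>e\<in>E. of_bool (B (?flip e S)))"
        by (rule member_le_sum[OF e(1)]) (use assms(1) in auto)
      finally have "1 \<le> (\<Sum>e\<in>E. of_bool (B (?flip e S)) :: real)" .
      then show ?thesis by (cases "B S"; cases "B1 S") auto
    next
      case False
      then show ?thesis by (auto simp: B1_def sum_nonneg)
    qed
  qed (use p in auto)
  also have "\<dots> = bexp p E (\<lambda>S. of_bool (B S)) + (\<Sum>e\<in>E. bexp p E (\<lambda>S. of_bool (B (?flip e S))))"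
    by (simp add: bexp_add bexp_sum)
  also have "\<dots> \<le> bexp p E (\<lambda>S. of_bool (B S)) + (\<Sum>e\<in>E. bexp p E (\<lambda>S. of_bool (B S)) / \<mu>)"
    by (intro add_mono sum_mono order_refl bexp_flip_le[of E _ \<mu> p "\<lambda>S. of_bool (B S)"]) (use assms in auto)
  also have "\<dots> = (1 + card E / \<mu>) * bexp p E (\<lambda>S. of_bool (B S))" by (simp add: algebra_simps)
  finally have "(1 + card E / \<mu>) ^ M * bexp p E (\<lambda>S. of_bool (B1 S))
      \<le> (1 + card E / \<mu>) ^ M * ((1 + card E / \<mu>) * bexp p E (\<lambda>S. of_bool (B S)))"
    by (rule mult_left_mono) (use assms in auto)
  with step show ?case by (simp add: mult_ac)
qed

text \<open>
  Around the largest \<open>k\<close> for which \<open>large_count \<ge> k\<close> is likely: either \<open>large_count = k\<close> is likely,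
  or at the next density the event \<open>large_count \<ge> k + 1\<close> is neither too rare nor too likely; then its
  boundary is not too rare, and boundary configurations are a few modifications away from
  \<open>large_count = k + 1\<close>.
\<close>

lemma exact_count_lower_bound:
  assumes fin: "finite V" "finite E"
    and edges: "\<And>e. e \<in> E \<Longrightarrow> \<exists>a b. e = {a, b}"
    and deg: "\<And>y. y \<in> V \<Longrightarrow> card {e \<in> E. y \<in> e} \<le> D"
    and connected: "\<And>U. U \<subseteq> V \<Longrightarrow> U \<noteq> {} \<Longrightarrow> U \<noteq> V \<Longrightarrow> \<exists>x\<in>U. \<exists>y\<in>V - U. {x, y} \<in> E"
    and p: "0 \<le> p" "p \<le> 1" and r: "0 \<le> r" "r \<le> 1"
    and \<mu>: "0 < \<mu>" "\<mu> \<le> p * r" "\<mu> \<le> 1 - p * r"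
    and k: "2 * m \<le> k"
    and likely: "1 / 2 \<le> bexp p E (\<lambda>S. of_bool (k \<le> large_count V m S))"
    and unlikely: "bexp (p * r) E (\<lambda>S. of_bool (Suc k \<le> large_count V m S)) \<le> 1 / 2"
  shows "1 / 4 \<le> bexp p E (\<lambda>S. of_bool (large_count V m S = k)) \<or>
    r ^ (Suc k * m) / 8 \<le> card E * (1 + card E / \<mu>) ^ (2 * m * D) *
      bexp (p * r) E (\<lambda>S. of_bool (large_count V m S = Suc k))"
proof (cases "1 / 4 \<le> bexp p E (\<lambda>S. of_bool (Suc k \<le> large_count V m S))")
  case False
  have "bexp p E (\<lambda>S. of_bool (k \<le> large_count V m S))
     = bexp p E (\<lambda>S. of_bool (large_count V m S = k) + of_bool (Suc k \<le> large_count V m S))"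
    by (rule bexp_cong) auto
  then show ?thesis using False likely by (simp add: bexp_add)
next
  case True
  define A where "A = (\<lambda>S. Suc k \<le> large_count V m S)"
  let ?q = "p * r"
  have q: "0 \<le> ?q" "?q \<le> 1" using \<mu> by auto
  have monoA: "A T" if "S \<subseteq> T" "T \<subseteq> E" "A S" for S T
  proof -
    have "large_count V m S \<le> large_count V m T"
      by (rule large_count_mono) (use that fin finite_subset in auto)
    then show ?thesis using that(3) by (simp add: A_def)
  qed
  have "r ^ (Suc k * m) / 4 \<le> r ^ (Suc k * m) * bexp p E (\<lambda>S. of_bool (A S))"
    using mult_left_mono[OF True, of "r ^ (Suc k * m)"] r by (simp add: A_def)
  \<comment> \<open>Each of the \<open>Suc k\<close> vertices needs at most \<open>m\<close> edges
    to witness that its cluster is large.\<close>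
  also have "\<dots> \<le> bexp ?q E (\<lambda>S. of_bool (A S))"
  proof (rule bexp_thinning_certificate)
    fix S assume "S \<subseteq> E" "A S"
    moreover from this have "finite S" using fin finite_subset by auto
    ultimately show "\<exists>W\<subseteq>S. card W \<le> Suc k * m \<and> A W"
      unfolding A_def by (intro large_count_certificate) (use fin in auto)
  qed (use fin p r monoA in auto)
  finally have lower: "r ^ (Suc k * m) / 4 \<le> bexp ?q E (\<lambda>S. of_bool (A S))" .
  have upper: "1 / 2 \<le> bexp ?q E (\<lambda>S. of_bool (\<not> A S))"
  proof -
    have "bexp ?q E (\<lambda>S. of_bool (\<not> A S)) = bexp ?q E (\<lambda>S. 1 - of_bool (A S))" by (rule bexp_cong) simp
    then show ?thesis using unlikely fin by (simp add: bexp_diff bexp_const A_def)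
  qed
  have "r ^ (Suc k * m) / 8 = (r ^ (Suc k * m) / 4) * (1 / 2)" by simp
  also have "\<dots> \<le> bexp ?q E (\<lambda>S. of_bool (A S)) * bexp ?q E (\<lambda>S. of_bool (\<not> A S))"
    by (rule mult_mono[OF lower upper]) (use q r in \<open>auto intro!: bexp_nonneg\<close>)
  also have "\<dots> \<le> card E * bexp ?q E (\<lambda>S. of_bool (\<not> A S \<and> (\<exists>e\<in>E. A (insert e S))))"
    by (rule bexp_pivotal[OF fin(2) q monoA])
  also have "\<dots> \<le> card E * ((1 + card E / \<mu>) ^ (2 * m * D) * bexp ?q E (\<lambda>S. of_bool (large_count V m S = Suc k)))"
  proof (intro mult_left_mono bexp_modification)
    fix S assume S: "S \<subseteq> E" and piv: "\<not> A S \<and> (\<exists>e\<in>E. A (insert e S))"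
    have finS: "finite S" using S fin finite_subset by auto
    obtain e where e: "e \<in> E" "A (insert e S)" using piv by blast
    obtain a b where ab: "e = {a, b}" using edges[OF e(1)] by blast
    \<comment> \<open>One edge lifts the count over \<open>k\<close>, so \<open>S\<close> is short
      of \<open>Suc k\<close> by at most \<open>2 * m\<close>. Since \<open>2 * m \<le> k\<close>,
      some large cluster is already present, and the raising procedure can attach vertices to
      it.\<close>
    have "Suc k \<le> large_count V m S + 2 * m"
      using large_count_insert_le[OF fin(1) finS, of m a b] e(2) ab by (simp add: A_def)
    moreover have "large_count V m S \<le> k" using piv by (simp add: A_def)
    moreover have "Suc k \<le> card V" using e(2) large_count_le_card[OF fin(1), of m "insert e S"] by (simp add: A_def)
    moreover define t where "t = Suc k - large_count V m S"
    ultimately have t: "large_count V m S + t = Suc k" "t \<le> 2 * m" "0 < large_count V m S" "Suc k \<le> card V"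
      using k by auto
    obtain S' where S': "S' \<subseteq> E" "large_count V m S' = large_count V m S + t" "dist_edges S S' \<le> t * D"
      using large_count_raise_to[OF fin S deg connected t(3), of t] t by auto
    have "t * D \<le> 2 * m * D" using t(2) by (rule mult_le_mono1)
    then have "dist_edges S S' \<le> 2 * m * D" using S'(3) by (rule order_trans[rotated])
    then show "\<exists>S'\<subseteq>E. large_count V m S' = Suc k \<and> dist_edges S S' \<le> 2 * m * D"
      using S' t(1) by (intro exI[of _ S']) simp
  qed (use fin \<mu> in auto)
  finally show ?thesis by (simp add: mult.assoc)
qed

subsection \<open>Lower deviations in the supercritical phase\<close>

lemma exp_minus_le_linear:
  assumes "0 \<le> (y::real)" "y \<le> 1"
  shows "exp (- y) \<le> 1 - y / 2"
proof -
  have "exp (- y) = 1 / exp y" by (simp add: exp_minus field_simps)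
  also have "\<dots> \<le> 1 / (1 + y)" using assms exp_ge_add_one_self[of y] by (intro divide_left_mono) auto
  also have "\<dots> \<le> 1 - y / 2"
  proof -
    have "1 \<le> (1 - y / 2) * (1 + y)"
      using assms mult_left_mono[of y 1 y] by (simp add: algebra_simps)
    then show ?thesis using assms by (simp add: divide_le_eq)
  qed
  finally show ?thesis .
qed

text \<open>Within each block \<open>j\<close>, only connections through \<open>G j\<close> are
  counted, which gives independent lower bounds for the contributions to the count. Divided by
  \<open>L\<close> they lie in the unit interval, where \<open>exp (- y) \<le> 1 - y / 2\<close>, so
  each block contributes a factor \<open>exp (- (\<nu> / (2 * L)))\<close>.\<close>

lemma large_count_lower_tail:
  fixes T :: "'j \<Rightarrow> 'v set" and L \<nu> :: real
  assumes p: "0 \<le> p" "p \<le> 1" and fin: "finite E" "finite V" "finite J"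
    and T: "\<And>j. j \<in> J \<Longrightarrow> T j \<subseteq> V" "disjoint_family_on T J" "\<And>j. j \<in> J \<Longrightarrow> card (T j) \<le> L"
    and G: "\<And>j. j \<in> J \<Longrightarrow> G j \<subseteq> E" "disjoint_family_on G J"
    and L: "0 < L"
    and \<nu>: "\<And>j. j \<in> J \<Longrightarrow> \<nu> \<le> bexp p (G j) (\<lambda>S. card {x \<in> T j. m \<le> card (conn S x)})"
  shows "bexp p E (\<lambda>S. of_bool (large_count V m S \<le> k)) \<le> exp (k / L - card J * \<nu> / (2 * L))"
proof -
  define N where "N = (\<lambda>j S. real (card {x \<in> T j. m \<le> card (conn S x)}))"
  have finT: "finite (T j)" if "j \<in> J" for j using T(1)[OF that] fin finite_subset by auto
  have finG: "finite (G j)" if "j \<in> J" for j using G(1)[OF that] fin finite_subset by auto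
  have sum_le: "(\<Sum>j\<in>J. N j (S \<inter> G j)) \<le> large_count V m S" if S: "S \<subseteq> E" for S
  proof -
    have finS: "finite S" using S fin finite_subset by auto
    have "(\<Sum>j\<in>J. card {x \<in> T j. m \<le> card (conn (S \<inter> G j) x)}) = card (\<Union>j\<in>J. {x \<in> T j. m \<le> card (conn (S \<inter> G j) x)})"
      by (rule card_UN_disjoint[symmetric])
        (use fin finT T(2) in \<open>auto simp: disjoint_family_on_def\<close>)
    also have "\<dots> \<le> large_count V m S"
      unfolding large_count_def
    proof (rule card_mono)
      show "(\<Union>j\<in>J. {x \<in> T j. m \<le> card (conn (S \<inter> G j) x)}) \<subseteq> {x \<in> V. m \<le> card (conn S x)}"
      proof
        fix x assume "x \<in> (\<Union>j\<in>J. {x \<in> T j. m \<le> card (conn (S \<inter> G j) x)})"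
        then obtain j where j: "j \<in> J" "x \<in> T j" "m \<le> card (conn (S \<inter> G j) x)" by blast
        have "card (conn (S \<inter> G j) x) \<le> card (conn S x)" by (rule card_conn_mono[OF finS]) auto
        then show "x \<in> {x \<in> V. m \<le> card (conn S x)}" using j T(1) by auto
      qed
    qed (use fin in simp)
    finally show ?thesis unfolding N_def by (simp only: of_nat_sum[symmetric] of_nat_le_iff)
  qed
  have N: "0 \<le> N j S / L" "N j S / L \<le> 1" if "j \<in> J" for j S
  proof -
    have "card {x \<in> T j. m \<le> card (conn S x)} \<le> card (T j)" by (rule card_mono) (use finT that in auto)
    then show "0 \<le> N j S / L" "N j S / L \<le> 1" using T(3)[OF that] L by (auto simp: N_def divide_le_eq)
  qed
  have each: "bexp p (G j) (\<lambda>S. exp (- (N j S / L))) \<le> exp (- (\<nu> / (2 * L)))" if j: "j \<in> J" for j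
  proof -
    have "bexp p (G j) (\<lambda>S. exp (- (N j S / L))) \<le> bexp p (G j) (\<lambda>S. 1 - (1 / (2 * L)) * N j S)"
    proof (rule bexp_mono)
      fix S
      have "(1 / (2 * L)) * N j S = N j S / L / 2" by simp
      then show "exp (- (N j S / L)) \<le> 1 - (1 / (2 * L)) * N j S"
        using exp_minus_le_linear[OF N(1)[OF j] N(2)[OF j], of S] by (simp only:)
    qed (use p in auto)
    also have "\<dots> = 1 - (1 / (2 * L)) * bexp p (G j) (N j)"
      using finG[OF j] by (simp only: bexp_diff bexp_cmult bexp_const)
    also have "\<dots> \<le> 1 - (1 / (2 * L)) * \<nu>"
      using \<nu>[OF j] L unfolding N_def by (intro diff_left_mono mult_left_mono) auto
    also have "\<dots> \<le> exp (- (\<nu> / (2 * L)))" using exp_ge_add_one_self[of "- (\<nu> / (2 * L))"] by simp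
    finally show ?thesis .
  qed
  have "bexp p E (\<lambda>S. of_bool (large_count V m S \<le> k)) \<le> bexp p E (\<lambda>S. exp (k / L) * (\<Prod>j\<in>J. exp (- (N j (S \<inter> G j) / L))))"
  proof (rule bexp_mono)
    fix S assume S: "S \<subseteq> E"
    have prod: "exp (k / L) * (\<Prod>j\<in>J. exp (- (N j (S \<inter> G j) / L))) = exp ((k - (\<Sum>j\<in>J. N j (S \<inter> G j))) / L)"
      using fin(3) by (simp add: exp_sum[symmetric] exp_add[symmetric] sum_negf sum_divide_distrib diff_divide_distrib)
    show "of_bool (large_count V m S \<le> k) \<le> exp (k / L) * (\<Prod>j\<in>J. exp (- (N j (S \<inter> G j) / L)))"
      unfolding prod
    proof (cases "large_count V m S \<le> k")
      case True
      then have "0 \<le> (k - (\<Sum>j\<in>J. N j (S \<inter> G j))) / L" using sum_le[OF S] L by (intro divide_nonneg_pos) auto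
      then show "of_bool (large_count V m S \<le> k) \<le> exp ((k - (\<Sum>j\<in>J. N j (S \<inter> G j))) / L)" using True by simp
    qed simp
  qed (use p in auto)
  also have "\<dots> = exp (k / L) * bexp p (\<Union>j\<in>J. G j) (\<lambda>S. \<Prod>j\<in>J. exp (- (N j (S \<inter> G j) / L)))"
  proof -
    have "bexp p E (\<lambda>S. \<Prod>j\<in>J. exp (- (N j (S \<inter> G j) / L)))
       = bexp p E (\<lambda>S. \<Prod>j\<in>J. exp (- (N j (S \<inter> (\<Union>j\<in>J. G j) \<inter> G j) / L)))"
    proof (intro bexp_cong prod.cong refl)
      fix S j assume "j \<in> J"
      then have "S \<inter> (\<Union>j\<in>J. G j) \<inter> G j = S \<inter> G j" by auto
      then show "exp (- (N j (S \<inter> G j) / L)) = exp (- (N j (S \<inter> (\<Union>j\<in>J. G j) \<inter> G j) / L))" by simp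
    qed
    also have "\<dots> = bexp p (\<Union>j\<in>J. G j) (\<lambda>S. \<Prod>j\<in>J. exp (- (N j (S \<inter> G j) / L)))"
      by (rule bexp_restrict[of E "\<Union>j\<in>J. G j" p "\<lambda>S. \<Prod>j\<in>J. exp (- (N j (S \<inter> G j) / L))"])
        (use fin G in auto)
    finally show ?thesis by (simp add: bexp_cmult)
  qed
  also have "\<dots> = exp (k / L) * (\<Prod>j\<in>J. bexp p (G j) (\<lambda>S. exp (- (N j S / L))))"
    using bexp_prod_disjoint[OF fin(3) finG G(2), of p "\<lambda>j S. exp (- (N j S / L))"] by simp
  also have "\<dots> \<le> exp (k / L) * (\<Prod>j\<in>J. exp (- (\<nu> / (2 * L))))"
    by (intro mult_left_mono prod_mono conjI each bexp_nonneg) (use p in auto)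
  also have "\<dots> = exp (k / L - card J * \<nu> / (2 * L))"
    by (simp add: exp_of_nat_mult[symmetric] exp_add[symmetric])
  finally show ?thesis .
qed

subsection \<open>Finite-dimensional distributions of Bernoulli percolation\<close>

lemma cluster_eq_conn: "cluster E x \<omega> = conn {e \<in> E. \<omega> e} x"
  by (simp add: cluster_def conn_def)

lemma prob_space_percolation: "prob_space (percolation p)"
  unfolding percolation_def by (intro prob_space_PiM measure_pmf.prob_space_axioms)

lemma sets_open_edges:
  assumes "finite E" "E \<subseteq> lattice_edges"
  shows "{\<omega> \<in> space (percolation p). P {e \<in> E. \<omega> e}} \<in> sets (percolation p)"
proof -
  have eq: "{\<omega> \<in> space (percolation p). P {e \<in> E. \<omega> e}}
     = (\<Union>S\<in>{S \<in> Pow E. P S}. {\<omega> \<in> space (percolation p). \<forall>e\<in>E. \<omega> e = (e \<in> S)})"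
  proof (intro set_eqI iffI)
    fix \<omega> assume "\<omega> \<in> {\<omega> \<in> space (percolation p). P {e \<in> E. \<omega> e}}"
    then show "\<omega> \<in> (\<Union>S\<in>{S \<in> Pow E. P S}. {\<omega> \<in> space (percolation p). \<forall>e\<in>E. \<omega> e = (e \<in> S)})"
      by (intro UN_I[of "{e \<in> E. \<omega> e}"]) auto
  next
    fix \<omega> assume "\<omega> \<in> (\<Union>S\<in>{S \<in> Pow E. P S}. {\<omega> \<in> space (percolation p). \<forall>e\<in>E. \<omega> e = (e \<in> S)})"
    then obtain S where S: "S \<subseteq> E" "P S" "\<omega> \<in> space (percolation p)" "\<forall>e\<in>E. \<omega> e = (e \<in> S)" by auto
    then have "{e \<in> E. \<omega> e} = S" by auto
    then show "\<omega> \<in> {\<omega> \<in> space (percolation p). P {e \<in> E. \<omega> e}}" using S by simp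
  qed
  have "{\<omega> \<in> space (percolation p). \<forall>e\<in>E. \<omega> e = (e \<in> S)} \<in> sets (percolation p)" for S
  proof (rule sets.sets_Collect_finite_All)
    fix e assume e: "e \<in> E"
    have "(\<lambda>\<omega>. \<omega> e) \<in> measurable (percolation p) (measure_pmf (bernoulli_pmf p))"
      unfolding percolation_def by (rule measurable_component_singleton) (use e assms in auto)
    from measurable_sets[OF this, of "{e \<in> S}"]
    show "{\<omega> \<in> space (percolation p). \<omega> e = (e \<in> S)} \<in> sets (percolation p)"
      by (simp add: vimage_def Int_def conj_commute)
  qed (use assms in auto)
  then show ?thesis unfolding eq by (intro sets.finite_UN) (use assms in auto)
qed

lemma measure_open_edges_eq:
  assumes "finite E" "E \<subseteq> lattice_edges" "0 \<le> p" "p \<le> 1" "S \<subseteq> E"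
  shows "measure (percolation p) {\<omega> \<in> space (percolation p). {e \<in> E. \<omega> e} = S} = p ^ card S * (1 - p) ^ card (E - S)"
proof -
  interpret product_prob_space "\<lambda>_. measure_pmf (bernoulli_pmf p)" lattice_edges
    by standard
  have "{\<omega> \<in> space (percolation p). {e \<in> E. \<omega> e} = S} = {\<omega> \<in> space (percolation p). \<forall>e\<in>E. \<omega> e \<in> {e \<in> S}}"
    using assms(5) by auto
  then have "emeasure (percolation p) {\<omega> \<in> space (percolation p). {e \<in> E. \<omega> e} = S}
     = (\<Prod>e\<in>E. emeasure (measure_pmf (bernoulli_pmf p)) {e \<in> S})"
    unfolding percolation_def using emeasure_PiM_Collect[OF assms(2,1), of "\<lambda>e. {e \<in> S}"] by simp
  also have "\<dots> = (\<Prod>e\<in>E. ennreal (if e \<in> S then p else 1 - p))"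
    by (rule prod.cong) (use assms in \<open>auto simp: emeasure_pmf_single\<close>)
  also have "\<dots> = ennreal (\<Prod>e\<in>E. if e \<in> S then p else 1 - p)"
    by (rule prod_ennreal) (use assms in auto)
  also have "(\<Prod>e\<in>E. if e \<in> S then p else 1 - p) = p ^ card S * (1 - p) ^ card (E - S)"
  proof -
    have "(\<Prod>e\<in>E. if e \<in> S then p else 1 - p) = (\<Prod>e\<in>E \<inter> S. p) * (\<Prod>e\<in>E \<inter> - S. 1 - p)"
      using prod.If_cases[OF assms(1), of "\<lambda>e. e \<in> S" "\<lambda>_. p" "\<lambda>_. 1 - p"] by simp
    moreover have "E \<inter> S = S" "E \<inter> - S = E - S" using assms(5) by auto
    ultimately show ?thesis by simp
  qed
  finally show ?thesis using assms by (simp add: measure_def)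
qed

text \<open>The bridge from the infinite product measure to finite sums: a function of finitely many
  edges is a combination of indicators of cylinders, whose probabilities are the weights in
  \<open>bexp\<close>.\<close>

lemma nn_integral_open_edges:
  fixes E :: "'d::finite edge set"
  assumes "finite E" "E \<subseteq> lattice_edges" "0 \<le> p" "p \<le> 1" "\<And>S. 0 \<le> f S"
  shows "(\<integral>\<^sup>+ \<omega>. ennreal (f {e \<in> E. \<omega> e}) \<partial>percolation p) = ennreal (bexp p E f)"
proof -
  interpret prob_space "percolation p :: 'd config measure" by (rule prob_space_percolation)
  let ?A = "\<lambda>S. {\<omega> \<in> space (percolation p :: 'd config measure). {e \<in> E. \<omega> e} = S}"
  have A: "?A S \<in> sets (percolation p)" for S using sets_open_edges[OF assms(1,2), of p "\<lambda>T. T = S"] .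
  have "(\<integral>\<^sup>+ \<omega>. ennreal (f {e \<in> E. \<omega> e}) \<partial>percolation p)
     = (\<integral>\<^sup>+ \<omega>. (\<Sum>S\<in>Pow E. ennreal (f S) * indicator (?A S) \<omega>) \<partial>percolation p)"
  proof (rule nn_integral_cong)
    fix \<omega> :: "'d config" assume \<omega>: "\<omega> \<in> space (percolation p)"
    have "(\<Sum>S\<in>Pow E. ennreal (f S) * indicator (?A S) \<omega>) = (\<Sum>S\<in>{{e \<in> E. \<omega> e}}. ennreal (f S) * indicator (?A S) \<omega>)"
      by (rule sum.mono_neutral_right) (use assms(1) \<omega> in \<open>auto simp: indicator_def\<close>)
    then show "ennreal (f {e \<in> E. \<omega> e}) = (\<Sum>S\<in>Pow E. ennreal (f S) * indicator (?A S) \<omega>)" using \<omega> by simp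
  qed
  also have "\<dots> = (\<Sum>S\<in>Pow E. \<integral>\<^sup>+ \<omega>. ennreal (f S) * indicator (?A S) \<omega> \<partial>percolation p)"
    by (rule nn_integral_sum) (use A in auto)
  also have "\<dots> = (\<Sum>S\<in>Pow E. ennreal (f S * (p ^ card S * (1 - p) ^ card (E - S))))"
  proof (rule sum.cong)
    fix S assume "S \<in> Pow E"
    then show "(\<integral>\<^sup>+ \<omega>. ennreal (f S) * indicator (?A S) \<omega> \<partial>percolation p) = ennreal (f S * (p ^ card S * (1 - p) ^ card (E - S)))"
      using A measure_open_edges_eq[OF assms(1-4), of S] assms
      by (simp add: nn_integral_cmult_indicator emeasure_eq_measure ennreal_mult')
  qed simp
  also have "\<dots> = ennreal (\<Sum>S\<in>Pow E. f S * (p ^ card S * (1 - p) ^ card (E - S)))"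
    by (rule sum_ennreal) (use assms in auto)
  finally show ?thesis by (simp add: bexp_def mult_ac)
qed

lemma measure_open_edges:
  fixes E :: "'d::finite edge set"
  assumes "finite E" "E \<subseteq> lattice_edges" "0 \<le> p" "p \<le> 1"
  shows "measure (percolation p) {\<omega> \<in> space (percolation p). P {e \<in> E. \<omega> e}} = bexp p E (\<lambda>S. of_bool (P S))"
proof -
  interpret prob_space "percolation p :: 'd config measure" by (rule prob_space_percolation)
  let ?A = "{\<omega> \<in> space (percolation p :: 'd config measure). P {e \<in> E. \<omega> e}}"
  have "emeasure (percolation p) ?A = (\<integral>\<^sup>+ \<omega>. indicator ?A \<omega> \<partial>percolation p)"
    using sets_open_edges[OF assms(1,2)] by simp
  also have "\<dots> = (\<integral>\<^sup>+ \<omega>. ennreal (of_bool (P {e \<in> E. \<omega> e})) \<partial>percolation p)"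
    by (rule nn_integral_cong) (auto simp: indicator_def)
  also have "\<dots> = ennreal (bexp p E (\<lambda>S. of_bool (P S)))"
    using nn_integral_open_edges[OF assms, of "\<lambda>S. of_bool (P S)"] by simp
  finally show ?thesis
    using bexp_nonneg[OF assms(3,4), of E "\<lambda>S. of_bool (P S)"] by (simp add: measure_def)
qed

subsection \<open>Cubes of the lattice\<close>

definition cube :: "int ^ 'd \<Rightarrow> nat \<Rightarrow> (int ^ 'd::finite) set" where
  "cube a L = {x. \<forall>i. a $ i \<le> x $ i \<and> x $ i < a $ i + int L}"

definition edges_in :: "(int ^ 'd::finite) set \<Rightarrow> 'd edge set" where
  "edges_in V = {e \<in> lattice_edges. e \<subseteq> V}"

lemma cube_bij:
  "bij_betw (\<lambda>x i. x $ i) (cube a L) (\<Pi>\<^sub>E i\<in>UNIV. {a $ i..<a $ i + int L})"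
  unfolding bij_betw_def
proof
  show "inj_on (\<lambda>x i. x $ i) (cube a L)" by (auto simp: inj_on_def vec_eq_iff fun_eq_iff)
  show "(\<lambda>x i. x $ i) ` cube a L = (\<Pi>\<^sub>E i\<in>UNIV. {a $ i..<a $ i + int L})"
  proof
    show "(\<Pi>\<^sub>E i\<in>UNIV. {a $ i..<a $ i + int L}) \<subseteq> (\<lambda>x i. x $ i) ` cube a L"
    proof
      fix f assume f: "f \<in> (\<Pi>\<^sub>E i\<in>UNIV. {a $ i..<a $ i + int L})"
      have "(\<chi> i. f i) \<in> cube a L" using f by (auto simp: cube_def PiE_iff)
      then show "f \<in> (\<lambda>x i. x $ i) ` cube a L" by (intro image_eqI[of _ _ "\<chi> i. f i"]) auto
    qed
  qed (auto simp: cube_def PiE_iff)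
qed

lemma finite_cube [simp]: "finite (cube a L)"
  unfolding bij_betw_finite[OF cube_bij] by (rule finite_PiE) auto

lemma card_cube: "card (cube (a :: int ^ 'd::finite) L) = L ^ CARD('d)"
  unfolding bij_betw_same_card[OF cube_bij] by (subst card_PiE) auto

lemma lattice_edgeE:
  assumes "e \<in> lattice_edges"
  obtains x y where "e = {x, y}" "(\<Sum>i\<in>UNIV. \<bar>x $ i - y $ i\<bar>) = 1"
  using assms unfolding lattice_edges_def by auto

lemma lattice_neighbours:
  assumes "{x, y} \<in> lattice_edges"
  shows "(\<Sum>i\<in>UNIV. \<bar>x $ i - y $ i\<bar>) = 1" "\<bar>x $ i - y $ i\<bar> \<le> 1"
proof -
  obtain u v where uv: "{x, y} = {u, v}" "(\<Sum>i\<in>UNIV. \<bar>u $ i - v $ i\<bar>) = 1"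
    using assms by (rule lattice_edgeE)
  then have "(x = u \<and> y = v) \<or> (x = v \<and> y = u)" by (auto simp: doubleton_eq_iff)
  then show sum: "(\<Sum>i\<in>UNIV. \<bar>x $ i - y $ i\<bar>) = 1" using uv(2) by (auto simp: abs_minus_commute)
  have "\<bar>x $ i - y $ i\<bar> \<le> (\<Sum>i\<in>UNIV. \<bar>x $ i - y $ i\<bar>)" by (rule member_le_sum) auto
  then show "\<bar>x $ i - y $ i\<bar> \<le> 1" using sum by simp
qed

lemma finite_edges_in: "finite V \<Longrightarrow> finite (edges_in V)"
  unfolding edges_in_def by (rule finite_subset[of _ "Pow V"]) auto

lemma edges_in_lattice: "edges_in V \<subseteq> lattice_edges"
  by (auto simp: edges_in_def)

lemma edges_in_subset: "e \<in> edges_in V \<Longrightarrow> e \<subseteq> V"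
  by (auto simp: edges_in_def)

text \<open>A quadratic bound is enough, because the number of edges enters the bound on
  \<open>Z_n\<close> only through its logarithm.\<close>

lemma card_edges_in_le:
  assumes "finite V"
  shows "card (edges_in V) \<le> (card V)\<^sup>2"
proof -
  have "edges_in V \<subseteq> (\<lambda>(x, y). {x, y}) ` (V \<times> V)"
  proof
    fix e assume e: "e \<in> edges_in V"
    then obtain x y where "e = {x, y}" by (auto simp: edges_in_def elim: lattice_edgeE)
    then show "e \<in> (\<lambda>(x, y). {x, y}) ` (V \<times> V)" using edges_in_subset[OF e] by auto
  qed
  then have "card (edges_in V) \<le> card ((\<lambda>(x, y). {x, y}) ` (V \<times> V))"
    by (rule card_mono[rotated]) (use assms in auto)
  also have "\<dots> \<le> card (V \<times> V)" by (rule card_image_le) (use assms in auto)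
  finally show ?thesis by (simp add: card_cartesian_product power2_eq_square)
qed

lemma degree_le:
  fixes y :: "int ^ 'd::finite"
  shows "card {e \<in> edges_in V. y \<in> e} \<le> 3 ^ CARD('d)"
proof -
  let ?a = "\<chi> i. y $ i - 1"
  have "{e \<in> edges_in V. y \<in> e} \<subseteq> (\<lambda>z. {y, z}) ` cube ?a 3"
  proof
    fix e assume e: "e \<in> {e \<in> edges_in V. y \<in> e}"
    then have l: "e \<in> lattice_edges" by (auto simp: edges_in_def)
    obtain u v where uv: "e = {u, v}" using l by (rule lattice_edgeE)
    then obtain z where z: "e = {y, z}" using e by auto
    have "\<bar>y $ i - z $ i\<bar> \<le> 1" for i using lattice_neighbours(2) l z by metis
    then have "z \<in> cube ?a 3" by (auto simp: cube_def abs_le_iff) (smt (verit))+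
    then show "e \<in> (\<lambda>z. {y, z}) ` cube ?a 3" using z by auto
  qed
  then have "card {e \<in> edges_in V. y \<in> e} \<le> card ((\<lambda>z. {y, z}) ` cube ?a 3)" by (rule card_mono[rotated]) auto
  also have "\<dots> \<le> card (cube ?a 3)" by (rule card_image_le) simp
  finally show ?thesis by (simp add: card_cube)
qed

lemma step_towards:
  fixes x y :: "int ^ 'd::finite"
  assumes "x \<in> cube a L" "y \<in> cube a L" "x \<noteq> y"
  obtains z where "z \<in> cube a L" "{x, z} \<in> lattice_edges"
    "(\<Sum>i\<in>UNIV. \<bar>z $ i - y $ i\<bar>) < (\<Sum>i\<in>UNIV. \<bar>x $ i - y $ i\<bar>)"
proof -
  obtain k where k: "x $ k \<noteq> y $ k" using assms(3) by (auto simp: vec_eq_iff)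
  define z where "z = (\<chi> i. if i = k then x $ k + sgn (y $ k - x $ k) else x $ i)"
  have sgn: "sgn (y $ k - x $ k) = 1 \<and> x $ k < y $ k \<or> sgn (y $ k - x $ k) = -1 \<and> y $ k < x $ k"
    using k by (auto simp: sgn_if)
  have "a $ i \<le> z $ i \<and> z $ i < a $ i + int L" for i
  proof -
    have "a $ i \<le> x $ i" "x $ i < a $ i + int L" "a $ i \<le> y $ i" "y $ i < a $ i + int L"
      using assms(1,2) by (auto simp: cube_def)
    then show ?thesis using sgn by (cases "i = k") (auto simp: z_def)
  qed
  then have "z \<in> cube a L" by (simp add: cube_def)
  moreover have "(\<Sum>i\<in>UNIV. \<bar>x $ i - z $ i\<bar>) = (\<Sum>i\<in>UNIV. if i = k then 1 else 0)"
    by (rule sum.cong) (use sgn in \<open>auto simp: z_def\<close>)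
  then have "{x, z} \<in> lattice_edges" unfolding lattice_edges_def by auto
  moreover have "(\<Sum>i\<in>UNIV. \<bar>z $ i - y $ i\<bar>) < (\<Sum>i\<in>UNIV. \<bar>x $ i - y $ i\<bar>)"
  proof (rule sum_strict_mono_ex1)
    show "\<forall>i\<in>UNIV. \<bar>z $ i - y $ i\<bar> \<le> \<bar>x $ i - y $ i\<bar>" using sgn by (auto simp: z_def)
    show "\<exists>i\<in>UNIV. \<bar>z $ i - y $ i\<bar> < \<bar>x $ i - y $ i\<bar>" using sgn by (intro bexI[of _ k]) (auto simp: z_def)
  qed simp
  ultimately show ?thesis using that by blast
qed

text \<open>Otherwise a walk inside the cube that decreases the distance to a vertex outside
  \<open>U\<close> could never leave \<open>U\<close>.\<close>

lemma cube_connected: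
  assumes "U \<subseteq> cube a L" "U \<noteq> {}" "U \<noteq> cube a L"
  shows "\<exists>x\<in>U. \<exists>y\<in>cube a L - U. {x, y} \<in> edges_in (cube a L)"
proof (rule ccontr)
  assume none: "\<not> ?thesis"
  obtain y where y: "y \<in> cube a L" "y \<notin> U" using assms by blast
  have "False" if "x \<in> U" for x
    using that
  proof (induction "nat (\<Sum>i\<in>UNIV. \<bar>x $ i - y $ i\<bar>)" arbitrary: x rule: less_induct)
    case less
    have x: "x \<in> cube a L" "x \<noteq> y" using less.prems assms y by auto
    obtain z where z: "z \<in> cube a L" "{x, z} \<in> lattice_edges"
      "(\<Sum>i\<in>UNIV. \<bar>z $ i - y $ i\<bar>) < (\<Sum>i\<in>UNIV. \<bar>x $ i - y $ i\<bar>)"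
      using step_towards[OF x(1) y(1) x(2)] .
    have "{x, z} \<in> edges_in (cube a L)" using x z by (auto simp: edges_in_def)
    then have "z \<in> U" using none less.prems z(1) by blast
    moreover have "0 \<le> (\<Sum>i\<in>UNIV. \<bar>z $ i - y $ i\<bar>)" by (rule sum_nonneg) auto
    then have "nat (\<Sum>i\<in>UNIV. \<bar>z $ i - y $ i\<bar>) < nat (\<Sum>i\<in>UNIV. \<bar>x $ i - y $ i\<bar>)"
      using z(3) by (simp only: nat_less_eq_zless)
    ultimately show False by (intro less.hyps)
  qed
  then show False using assms(2) by blast
qed

section \<open>Finite-volume descriptions of the percolation probability and the mean cluster
  size\<close>

definition centred_cube :: "nat \<Rightarrow> (int ^ 'd::finite) set" where
  "centred_cube R = cube (\<chi> i. - int R) (2 * R + 1)"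

lemma mem_centred_cube: "x \<in> centred_cube R \<longleftrightarrow> (\<forall>i. \<bar>x $ i\<bar> \<le> int R)"
  by (auto simp: centred_cube_def cube_def abs_le_iff) (smt (verit))+

text \<open>Along a nearest-neighbour path from 0 to \<open>y\<close> the coordinate
  \<open>i\<close> moves by at most 1 per step, so all absolute values from 0 to that of
  \<open>y\<close> occur in the cluster.\<close>

lemma conn_reach_le_card:
  assumes "S \<subseteq> lattice_edges" "finite (conn S 0)" "y \<in> conn S 0"
  shows "\<bar>y $ i\<bar> < int (card (conn S 0))"
proof -
  have "{0..nat \<bar>y $ i\<bar>} \<subseteq> (\<lambda>w. nat \<bar>w $ i\<bar>) ` conn S 0"
    using assms(3)
  proof (induction rule: conn_induct)
    case base
    show ?case by (auto intro!: image_eqI[of _ _ 0])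
  next
    case (step y z)
    have "\<bar>y $ i - z $ i\<bar> \<le> 1" using lattice_neighbours(2)[of y z i] step(2) assms(1) by auto
    then have "{0..nat \<bar>z $ i\<bar>} \<subseteq> insert (nat \<bar>z $ i\<bar>) {0..nat \<bar>y $ i\<bar>}" by auto
    moreover have "z \<in> conn S 0" using step conn_step by metis
    ultimately show ?case using step.IH by blast
  qed
  then have "card {0..nat \<bar>y $ i\<bar>} \<le> card ((\<lambda>w. nat \<bar>w $ i\<bar>) ` conn S 0)"
    by (rule card_mono[rotated]) (use assms in auto)
  also have "\<dots> \<le> card (conn S 0)" by (rule card_image_le) (use assms in auto)
  finally show ?thesis by simp
qed

text \<open>A cluster with fewer than \<open>m\<close> vertices stays at distance less than
  \<open>m\<close> from the origin. An open edge leaving it would lie in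
  \<open>centred_cube m\<close>, hence in \<open>E\<close>, so the cluster is already
  complete.\<close>

lemma small_conn_in_cube:
  assumes S: "S \<subseteq> lattice_edges" and E: "edges_in (centred_cube m) \<subseteq> E" "finite E"
    and small: "card (conn (S \<inter> E) 0) < m"
  shows "conn (S \<inter> E) 0 = conn S 0"
proof
  show "conn S 0 \<subseteq> conn (S \<inter> E) 0"
  proof
    fix y assume "y \<in> conn S 0"
    then show "y \<in> conn (S \<inter> E) 0"
    proof (induction rule: conn_induct)
      case (step y z)
      have fin: "finite (conn (S \<inter> E) 0)" by (rule finite_conn) (use E in auto)
      have b1: "\<bar>y $ i\<bar> < int m" for i
      proof -
        have "S \<inter> E \<subseteq> lattice_edges" using S by auto
        then show ?thesis using conn_reach_le_card[OF _ fin step.IH, of i] small by linarith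
      qed
      have b2: "\<bar>y $ i - z $ i\<bar> \<le> 1" for i using lattice_neighbours(2)[of y z i] step(2) S by auto
      have yz: "\<bar>y $ i\<bar> \<le> int m \<and> \<bar>z $ i\<bar> \<le> int m" for i using b1[of i] b2[of i] by linarith
      then have "{y, z} \<in> edges_in (centred_cube m)"
        using step(2) S by (auto simp: edges_in_def mem_centred_cube)
      then show ?case using conn_step[OF step.IH, of z] step(2) E by auto
    qed simp
  qed
qed (rule conn_mono, auto)

text \<open>Writing the infinite-cluster event through finite-volume events gives its measurability
  and lets its probability be computed as a limit.\<close>

lemma infinite_conn_iff:
  assumes "S \<subseteq> lattice_edges"
  shows "infinite (conn S 0) \<longleftrightarrow> (\<forall>m. m \<le> card (conn (S \<inter> edges_in (centred_cube m)) 0))"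
proof
  assume inf: "infinite (conn S 0)"
  show "\<forall>m. m \<le> card (conn (S \<inter> edges_in (centred_cube m)) 0)"
  proof (rule ccontr)
    assume "\<not> ?thesis"
    then obtain m where m: "card (conn (S \<inter> edges_in (centred_cube m)) 0) < m" by (auto simp: not_le)
    have fin: "finite (edges_in (centred_cube m))" by (simp add: finite_edges_in centred_cube_def)
    have "conn (S \<inter> edges_in (centred_cube m)) 0 = conn S 0"
      by (rule small_conn_in_cube[OF assms order_refl fin m])
    moreover have "finite (conn (S \<inter> edges_in (centred_cube m)) 0)" by (rule finite_conn) (use fin in auto)
    ultimately show False using inf by simp
  qed
next
  assume all: "\<forall>m. m \<le> card (conn (S \<inter> edges_in (centred_cube m)) 0)"
  show "infinite (conn S 0)"
  proof
    assume fin: "finite (conn S 0)"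
    let ?m = "Suc (card (conn S 0))"
    have "card (conn (S \<inter> edges_in (centred_cube ?m)) 0) \<le> card (conn S 0)"
      by (rule card_mono[OF fin conn_mono]) auto
    then show False using all[rule_format, of ?m] by simp
  qed
qed

lemma open_edges_Int: "E \<subseteq> lattice_edges \<Longrightarrow> {e \<in> lattice_edges. \<omega> e} \<inter> E = {e \<in> E. \<omega> e}"
  by auto

lemma infinite_cluster_event_eq:
  "{\<omega> \<in> space (percolation p). infinite (cluster lattice_edges 0 \<omega>)}
    = (\<Inter>m. {\<omega> \<in> space (percolation p). m \<le> card (conn {e \<in> edges_in (centred_cube m). \<omega> e} 0)})"
  using infinite_conn_iff[of "{e \<in> lattice_edges. _ e}"]
  by (auto simp: cluster_eq_conn open_edges_Int[OF edges_in_lattice])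

lemma infinite_cluster_event_measurable:
  "{\<omega> \<in> space (percolation p). infinite (cluster lattice_edges 0 \<omega>)} \<in> sets (percolation p)"
  unfolding infinite_cluster_event_eq
  by (rule sets.countable_INT')
    (auto intro!: sets_open_edges finite_edges_in edges_in_lattice simp: centred_cube_def)

lemma theta_le_bexp:
  assumes "0 \<le> p" "p \<le> 1" "E \<subseteq> lattice_edges" "finite E"
    and "edges_in (centred_cube m) \<subseteq> E"
  shows "theta TYPE('d::finite) p \<le> bexp p E (\<lambda>S :: 'd edge set. of_bool (m \<le> card (conn S 0)))"
proof -
  interpret prob_space "percolation p :: 'd config measure" by (rule prob_space_percolation)
  have "theta TYPE('d) p \<le> measure (percolation p) {\<omega> \<in> space (percolation p). m \<le> card (conn {e \<in> E. \<omega> e} (0 :: 'd vertex))}"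
    unfolding theta_def
  proof (rule finite_measure_mono)
    show "{\<omega> \<in> space (percolation p). infinite (cluster lattice_edges 0 \<omega>)}
      \<subseteq> {\<omega> \<in> space (percolation p). m \<le> card (conn {e \<in> E. \<omega> e} (0 :: 'd vertex))}"
    proof
      fix \<omega> :: "'d config" assume \<omega>: "\<omega> \<in> {\<omega> \<in> space (percolation p). infinite (cluster lattice_edges 0 \<omega>)}"
      let ?S = "{e \<in> lattice_edges. \<omega> e}"
      have "m \<le> card (conn (?S \<inter> E) 0)"
      proof (rule ccontr)
        assume "\<not> ?thesis"
        then have "conn (?S \<inter> E) 0 = conn ?S 0" by (intro small_conn_in_cube[of _ m]) (use assms in auto)
        moreover have "finite (conn (?S \<inter> E) 0)" by (rule finite_conn) (use assms in auto)
        ultimately show False using \<omega> by (simp add: cluster_eq_conn)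
      qed
      then show "\<omega> \<in> {\<omega> \<in> space (percolation p). m \<le> card (conn {e \<in> E. \<omega> e} (0 :: 'd vertex))}"
        using \<omega> open_edges_Int[OF assms(3)] by simp
    qed
  qed (rule sets_open_edges[OF assms(4,3)])
  also have "\<dots> = bexp p E (\<lambda>S. of_bool (m \<le> card (conn S 0)))"
    by (rule measure_open_edges) (use assms in auto)
  finally show ?thesis .
qed

text \<open>The finite-volume events decrease: a cluster with fewer than \<open>m\<close> vertices
  inside the cube of radius \<open>m\<close> is complete, so larger cubes reveal nothing more.
  Continuity from above then passes the uniform bound to the limit.\<close>

lemma theta_ge_bexp:
  assumes "0 \<le> p" "p \<le> 1"
    and "\<And>m. \<delta> \<le> bexp p (edges_in (centred_cube m)) (\<lambda>S :: 'd::finite edge set. of_bool (m \<le> card (conn S 0)))"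
  shows "\<delta> \<le> theta TYPE('d) p"
proof -
  interpret prob_space "percolation p :: 'd config measure" by (rule prob_space_percolation)
  define A where "A = (\<lambda>m. {\<omega> \<in> space (percolation p). m \<le> card (conn {e \<in> edges_in (centred_cube m). \<omega> e} (0 :: 'd vertex))})"
  have fin: "finite (edges_in (centred_cube m :: 'd vertex set))" for m
    by (simp add: finite_edges_in centred_cube_def)
  have sets: "range A \<subseteq> events"
    unfolding A_def by (auto intro!: sets_open_edges fin edges_in_lattice)
  have "decseq A"
  proof (rule decseq_SucI, rule subsetI, rule ccontr)
    fix m and \<omega> :: "'d config" assume \<omega>: "\<omega> \<in> A (Suc m)" "\<omega> \<notin> A m"
    let ?S = "{e \<in> lattice_edges. \<omega> e}"
    have eq: "{e \<in> edges_in (centred_cube k). \<omega> e} = ?S \<inter> edges_in (centred_cube k)" for k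
      using edges_in_lattice by auto
    have "card (conn {e \<in> edges_in (centred_cube m). \<omega> e} 0) < m" "Suc m \<le> card (conn {e \<in> edges_in (centred_cube (Suc m)). \<omega> e} 0)"
      using \<omega> by (auto simp: A_def not_le)
    then have small: "card (conn (?S \<inter> edges_in (centred_cube m)) 0) < m"
      and large: "Suc m \<le> card (conn (?S \<inter> edges_in (centred_cube (Suc m))) 0)" unfolding eq .
    note small
    moreover from this have "conn (?S \<inter> edges_in (centred_cube m)) 0 = conn ?S 0"
      by (intro small_conn_in_cube[of _ m]) (use fin in auto)
    moreover have "card (conn (?S \<inter> edges_in (centred_cube (Suc m))) 0) \<le> card (conn ?S 0)"
      if "finite (conn ?S 0)" by (rule card_mono[OF that conn_mono]) auto
    moreover have "finite (conn (?S \<inter> edges_in (centred_cube m)) 0)" by (rule finite_conn) (use fin in auto)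
    ultimately have "card (conn (?S \<inter> edges_in (centred_cube (Suc m))) 0) < m" by simp
    then show False using large by simp
  qed
  then have "(\<lambda>m. prob (A m)) \<longlonglongrightarrow> prob (\<Inter>m. A m)"
    by (rule finite_Lim_measure_decseq[OF sets])
  moreover have "\<delta> \<le> prob (A m)" for m
    unfolding A_def by (subst measure_open_edges) (use assms fin edges_in_lattice in auto)
  ultimately have "\<delta> \<le> prob (\<Inter>m. A m)" by (intro LIMSEQ_le_const) auto
  then show ?thesis unfolding theta_def infinite_cluster_event_eq A_def by simp
qed

lemma theta_eq_0_below_p_c:
  assumes "0 \<le> p" "p \<le> 1" "p < p_c TYPE('d::finite)"
  shows "theta TYPE('d) p = 0"
proof (rule ccontr)
  assume "theta TYPE('d) p \<noteq> 0"
  then have "0 < theta TYPE('d) p" by (simp add: theta_def zero_less_measure_iff)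
  then have "p_c TYPE('d) \<le> p"
    unfolding p_c_def by (intro cInf_lower bdd_belowI[of _ 0]) (use assms in auto)
  then show False using assms by simp
qed

text \<open>Below the threshold the cluster of the origin is finite almost surely, so the
  conditioning in \<open>chi\<close> is on an event of probability 1, and restricting to
  \<open>E\<close> can only shrink the cluster.\<close>

lemma bexp_card_le_chi:
  assumes "0 \<le> p" "p \<le> 1" "p < p_c TYPE('d::finite)" "E \<subseteq> lattice_edges" "finite E"
  shows "ennreal (bexp p E (\<lambda>S :: 'd edge set. real (card (conn S 0)))) \<le> chi TYPE('d) p"
proof -
  interpret prob_space "percolation p :: 'd config measure" by (rule prob_space_percolation)
  let ?inf = "{\<omega> \<in> space (percolation p). infinite (cluster lattice_edges (0 :: 'd vertex) \<omega>)}"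
  have "emeasure (percolation p) ?inf = 0"
    using theta_eq_0_below_p_c[OF assms(1-3)] by (simp add: theta_def emeasure_eq_measure)
  then have ae: "AE \<omega> in percolation p. finite (cluster lattice_edges (0 :: 'd vertex) \<omega>)"
    by (rule AE_I[rotated]) (use infinite_cluster_event_measurable in auto)
  have "ennreal (bexp p E (\<lambda>S. real (card (conn S 0))))
     = (\<integral>\<^sup>+ \<omega>. ennreal (real (card (conn {e \<in> E. \<omega> e} (0 :: 'd vertex)))) \<partial>percolation p)"
    using nn_integral_open_edges[OF assms(5,4,1,2), of "\<lambda>S. real (card (conn S 0))"] by simp
  also have "\<dots> \<le> (\<integral>\<^sup>+ \<omega> \<in> finite_cluster_event p. of_nat (card (cluster lattice_edges 0 \<omega>))
        \<partial>(percolation p :: 'd config measure))"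
  proof (rule nn_integral_mono_AE)
    show "AE \<omega> in percolation p. ennreal (real (card (conn {e \<in> E. \<omega> e} (0 :: 'd vertex))))
       \<le> of_nat (card (cluster lattice_edges 0 \<omega>)) * indicator (finite_cluster_event p) \<omega>"
      using ae AE_space
    proof eventually_elim
      case (elim \<omega>)
      have "card (conn {e \<in> E. \<omega> e} 0) \<le> card (cluster lattice_edges (0 :: 'd vertex) \<omega>)"
        by (rule card_mono[OF elim(1)]) (unfold cluster_eq_conn, rule conn_mono, use assms in auto)
      then show ?case using elim
        by (simp add: finite_cluster_event_def ennreal_of_nat_eq_real_of_nat)
    qed
  qed
  also have "\<dots> \<le> chi TYPE('d) p"
  proof -
    have "(finite_cluster_event p :: 'd config set) = space (percolation p) - ?inf"
      by (auto simp: finite_cluster_event_def)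
    then have "(finite_cluster_event p :: 'd config set) \<in> events"
      using infinite_cluster_event_measurable by auto
    then have "emeasure (percolation p) (finite_cluster_event p :: 'd config set) = 1"
      by (rule emeasure_eq_1_AE) (use ae AE_space in \<open>eventually_elim, simp add: finite_cluster_event_def\<close>)
    then show ?thesis by (simp add: chi_def divide_ennreal_def)
  qed
  finally show ?thesis .
qed

subsection \<open>The percolation threshold is below one\<close>

type_synonym dart = "(int \<times> int) \<times> (int \<times> int)"

definition rot :: "int \<times> int \<Rightarrow> int \<times> int" where
  "rot d = (- snd d, fst d)"

definition directions :: "(int \<times> int) set" where
  "directions = {(1, 0), (-1, 0), (0, 1), (0, -1)}"

definition boundary :: "(int \<times> int) set \<Rightarrow> dart set" where
  "boundary K = {(x, d). x \<in> K \<and> x + d \<notin> K \<and> d \<in> directions}"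

text \<open>
  A dart \<open>(x, d)\<close> with \<open>x\<close> inside and \<open>x + d\<close> outside stands for the dual edge that crosses it with
  \<open>K\<close> on its left; \<open>next_dart\<close> walks along the contour, turning left at touching corners.
\<close>

definition next_dart :: "(int \<times> int) set \<Rightarrow> dart \<Rightarrow> dart" where
  "next_dart K = (\<lambda>(x, d). if x + rot d \<notin> K then (x, rot d)
     else if x + d + rot d \<notin> K then (x + rot d, d) else (x + d + rot d, - rot d))"

text \<open>The dual edge crossing \<open>(x, d)\<close> runs in direction \<open>rot d\<close>.
  Coordinates are doubled, which makes the half-integer dual vertices integral with odd
  coordinates.\<close>

definition dual_start :: "dart \<Rightarrow> int \<times> int" where
  "dual_start = (\<lambda>(x, d). x + x + d - rot d)"

definition dual_end :: "dart \<Rightarrow> int \<times> int" where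
  "dual_end = (\<lambda>(x, d). x + x + d + rot d)"

lemma rot_simps: "rot (rot d) = - d" "rot (- d) = - rot d" "rot a = rot b \<longleftrightarrow> a = b"
  by (auto simp: rot_def prod_eq_iff)

lemma rot_directions: "d \<in> directions \<Longrightarrow> rot d \<in> directions" "d \<in> directions \<Longrightarrow> - d \<in> directions"
  by (auto simp: directions_def rot_def)

lemma next_dart_boundary:
  assumes "b \<in> boundary K"
  shows "next_dart K b \<in> boundary K"
proof -
  obtain x d where b: "b = (x, d)" by (metis surj_pair)
  have "x \<in> K" "x + d \<notin> K" "d \<in> directions" "x + d + rot d + - rot d = x + d"
    using assms b by (auto simp: boundary_def)
  moreover have "x + rot d + d = x + d + rot d" by (simp add: add_ac)
  ultimately show ?thesis
    using rot_directions[of d] rot_directions(2)[of "rot d"] by (auto simp: b boundary_def next_dart_def add_ac)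
qed

lemma inj_on_next_dart: "inj_on (next_dart K) (boundary K)"
proof (rule inj_onI)
  fix b b' assume b: "b \<in> boundary K" "b' \<in> boundary K" and eq: "next_dart K b = next_dart K b'"
  obtain x d x' d' where xd: "b = (x, d)" "b' = (x', d')" by (metis surj_pair)
  have in_out: "x \<in> K" "x + d \<notin> K" "x' \<in> K" "x' + d' \<notin> K" using b xd by (auto simp: boundary_def)
  \<comment> \<open>The labels A, B, C denote the three branches of \<open>next_dart\<close>. If two
    darts had the same successor through different branches, the outer endpoint of one of them would
    be a vertex known to lie in \<open>K\<close>.\<close>
  have AB: False if "u = v + rot e" "rot d1 = e" "v \<in> K" "u + d1 \<notin> K" for u v e d1
  proof -
    have "rot e = - d1" using that(2) rot_simps(1)[of d1] by simp
    then have "v = u + d1" using that(1) by simp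
    then show False using that(3,4) by simp
  qed
  have AC: False if "u = v + e + rot e" "rot d1 = - rot e" "v + rot e \<in> K" "u + d1 \<notin> K" for u v e d1
  proof -
    have "d1 = - e" using that(2) rot_simps(2,3) by metis
    then have "u + d1 = v + rot e" using that(1) by simp
    then show False using that(3,4) by simp
  qed
  have BC: False if "u + rot d1 = v + e + rot e" "d1 = - rot e" "v \<in> K" "u + d1 \<notin> K" for u v e d1
  proof -
    have "rot d1 = e" using that(2) by (simp add: rot_simps)
    then have "u = v + e + rot e - e" using that(1) by (simp add: algebra_simps)
    then have "u + d1 = v" using that(2) by simp
    then show False using that(3,4) by simp
  qed
  have C: "(x + rot d \<notin> K \<and> next_dart K (x, d) = (x, rot d)) \<or>
      (x + rot d \<in> K \<and> next_dart K (x, d) = (x + rot d, d)) \<or>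
      (x + rot d \<in> K \<and> next_dart K (x, d) = (x + d + rot d, - rot d))" for x d
    by (simp add: next_dart_def)
  have eq': "next_dart K (x, d) = next_dart K (x', d')" using eq xd by simp
  show "b = b'"
    using C[of x d]
  proof (elim disjE conjE)
    assume 1: "next_dart K (x, d) = (x, rot d)"
    show "b = b'"
      using C[of x' d'] AB[of x x' d' d] AC[of x x' d' d] in_out eq'
      by (elim disjE conjE) (simp_all add: xd 1 rot_simps)
  next
    assume 1: "next_dart K (x, d) = (x + rot d, d)"
    show "b = b'"
      using C[of x' d']
    proof (elim disjE conjE)
      assume "next_dart K (x', d') = (x', rot d')"
      then have "x' = x + rot d" "rot d' = d" using eq' 1 by auto
      then have False by (rule AB) (use in_out in simp_all)
      then show ?thesis ..
    next
      assume "next_dart K (x', d') = (x' + rot d', d')"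
      then have "x + rot d = x' + rot d'" "d = d'" using eq' 1 by auto
      then show ?thesis by (simp add: xd)
    next
      assume "next_dart K (x', d') = (x' + d' + rot d', - rot d')"
      then have "x + rot d = x' + d' + rot d'" "d = - rot d'" using eq' 1 by auto
      then have False by (rule BC) (use in_out in simp_all)
      then show ?thesis ..
    qed
  next
    assume 1: "x + rot d \<in> K" "next_dart K (x, d) = (x + d + rot d, - rot d)"
    show "b = b'"
      using C[of x' d']
    proof (elim disjE conjE)
      assume "next_dart K (x', d') = (x', rot d')"
      then have "x' = x + d + rot d" "rot d' = - rot d" using eq' 1(2) by auto
      then have False by (rule AC) (use in_out 1(1) in simp_all)
      then show ?thesis ..
    next
      assume "next_dart K (x', d') = (x' + rot d', d')"
      then have "x' + rot d' = x + d + rot d" "d' = - rot d" using eq' 1(2) by auto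
      then have False by (rule BC) (use in_out in simp_all)
      then show ?thesis ..
    next
      assume "next_dart K (x', d') = (x' + d' + rot d', - rot d')"
      then have eqs: "x + d + rot d = x' + d' + rot d'" "rot d = rot d'" using eq' 1(2) by auto
      then have "d = d'" by (simp add: rot_simps)
      then show ?thesis using eqs(1) by (simp add: xd)
    qed
  qed
qed

lemma dual_end_eq: "dual_end b = dual_start (next_dart K b)"
proof -
  obtain a c e f where "b = ((a, c), (e, f))" by (metis surj_pair)
  then show ?thesis by (simp add: dual_end_def dual_start_def next_dart_def rot_def)
qed

text \<open>Signed crossings of the horizontal axis by the dual edge of a dart, upwards counted as
  1. From the vertex \<open>(a, 0)\<close> a dart to the right crosses at a + 1/2 and a dart to the
  left at a - 1/2, which explains the different cut-offs for \<open>a\<close>.\<close>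

definition crossing_right :: "dart \<Rightarrow> int" where
  "crossing_right = (\<lambda>((a, c), d). if c = 0 \<and> d = (1, 0) \<and> 0 \<le> a then 1
     else if c = 0 \<and> d = (-1, 0) \<and> 1 \<le> a then -1 else 0)"

definition crossing_left :: "dart \<Rightarrow> int" where
  "crossing_left = (\<lambda>((a, c), d). if c = 0 \<and> d = (1, 0) \<and> a < 0 then 1
     else if c = 0 \<and> d = (-1, 0) \<and> a < 1 then -1 else 0)"

text \<open>Dual vertices never lie on the axis, as their doubled heights are odd. The signed
  crossing is thus the increment of the indicator of being above the axis, and it sums to zero over
  any closed contour.\<close>

lemma crossing_sum:
  assumes "b \<in> boundary K"
  shows "of_bool (0 < snd (dual_end b)) - of_bool (0 < snd (dual_start b)) = crossing_right b + crossing_left b"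
proof -
  obtain a c d where b: "b = ((a, c), d)" by (metis surj_pair)
  have "d \<in> directions" using assms by (simp add: b boundary_def)
  then consider "d = (1, 0)" | "d = (-1, 0)" | "d = (0, 1)" | "d = (0, -1)" by (auto simp: directions_def)
  then show ?thesis
    by cases (auto simp: b dual_end_def dual_start_def rot_def crossing_right_def crossing_left_def)
qed

lemma finite_boundary: "finite K \<Longrightarrow> finite (boundary K)"
  by (rule finite_subset[of _ "K \<times> directions"]) (auto simp: boundary_def directions_def)

text \<open>Read along the half-axis from the origin, each step from inside to outside
  \<open>K\<close> counts 1 and each step back counts -1. The sum telescopes to the indicator at the
  origin minus the indicator at a far point.\<close>

lemma sum_crossing_right:
  assumes "finite K" "(0, 0) \<in> K"
  shows "(\<Sum>b\<in>boundary K. crossing_right b) = 1"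
proof -
  define f :: "nat \<Rightarrow> dart" where "f = (\<lambda>a. ((int a, 0), (1, 0)))"
  define g :: "nat \<Rightarrow> dart" where "g = (\<lambda>a. ((int a + 1, 0), (-1, 0)))"
  define k :: "nat \<Rightarrow> int" where "k = (\<lambda>a. of_bool ((int a, 0) \<in> K))"
  have fin: "finite (boundary K)" by (rule finite_boundary[OF assms(1)])
  have "finite (fst ` K)" using assms by simp
  then obtain N where N: "\<forall>x\<in>fst ` K. x < int N"
  proof -
    have "\<forall>x\<in>fst ` K. x < int (nat (Max (fst ` K) + 1))"
      using \<open>finite (fst ` K)\<close> Max_ge[of "fst ` K"] by fastforce
    then show ?thesis using that by blast
  qed
  have inj: "inj f" "inj g" by (auto simp: f_def g_def inj_def)
  have "(\<Sum>b\<in>boundary K. crossing_right b) = (\<Sum>b\<in>boundary K. of_bool (b \<in> f ` {..<N}) - of_bool (b \<in> g ` {..<N}))"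
  proof (rule sum.cong)
    fix b assume b: "b \<in> boundary K"
    obtain a c d where bb: "b = ((a, c), d)" by (metis surj_pair)
    have aK: "(a, c) \<in> K" "(a, c) + d \<notin> K" using b bb by (auto simp: boundary_def)
    then have aN: "a < int N" using N by force
    have f: "b \<in> f ` {..<N} \<longleftrightarrow> c = 0 \<and> d = (1, 0) \<and> 0 \<le> a"
      using aN unfolding bb f_def by (auto intro!: image_eqI[of _ _ "nat a"])
    have g: "b \<in> g ` {..<N} \<longleftrightarrow> c = 0 \<and> d = (-1, 0) \<and> 1 \<le> a"
      using aN unfolding bb g_def by (auto intro!: image_eqI[of _ _ "nat (a - 1)"])
    show "crossing_right b = of_bool (b \<in> f ` {..<N}) - of_bool (b \<in> g ` {..<N})"
      unfolding f g unfolding bb crossing_right_def by auto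
  qed simp
  also have "\<dots> = int (card (boundary K \<inter> f ` {..<N})) - int (card (boundary K \<inter> g ` {..<N}))"
    using fin by (simp add: sum_subtractf Int_def conj_commute)
  also have "boundary K \<inter> f ` {..<N} = f ` {a\<in>{..<N}. f a \<in> boundary K}" by auto
  also have "boundary K \<inter> g ` {..<N} = g ` {a\<in>{..<N}. g a \<in> boundary K}" by auto
  also have "int (card (f ` {a\<in>{..<N}. f a \<in> boundary K})) - int (card (g ` {a\<in>{..<N}. g a \<in> boundary K}))
     = (\<Sum>a<N. of_bool (f a \<in> boundary K) - of_bool (g a \<in> boundary K))"
    by (simp add: card_image inj_on_subset[OF inj(1)] inj_on_subset[OF inj(2)] sum_subtractf Int_def conj_commute)
  also have "\<dots> = (\<Sum>a<N. k a - k (Suc a))"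
    by (rule sum.cong) (auto simp: f_def g_def k_def boundary_def directions_def add.commute)
  also have "\<dots> = k 0 - k N" by (rule sum_lessThan_telescope')
  also have "\<dots> = 1"
  proof -
    have "(int N, 0) \<notin> K" using N by force
    then show ?thesis using assms by (simp add: k_def)
  qed
  finally show ?thesis .
qed

lemma dual_start_next:
  assumes "b \<in> boundary K"
  shows "fst (dual_start b) - 2 \<le> fst (dual_start (next_dart K b))"
  unfolding dual_end_eq[symmetric] using assms
  by (auto simp: boundary_def directions_def dual_end_def dual_start_def rot_def split: prod.splits)

lemma funpow_dart_boundary: "b \<in> boundary K \<Longrightarrow> (next_dart K ^^ i) b \<in> boundary K"
  by (induction i) (auto intro: next_dart_boundary)

lemma dual_start_funpow:
  assumes "b \<in> boundary K"
  shows "fst (dual_start b) - 2 * int i \<le> fst (dual_start ((next_dart K ^^ i) b))"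
proof (induction i)
  case (Suc i)
  then show ?case using dual_start_next[OF funpow_dart_boundary[OF assms, of i]] by simp
qed simp

text \<open>
  Some contour has a positive crossing number with the right half-axis. As a closed curve it crosses
  the full axis zero times in total, so it also crosses the left half-axis, and hence is long.
\<close>

lemma long_contour:
  assumes "finite K" "(0, 0) \<in> K"
  shows "\<exists>r::nat. (int r, 0) \<in> K \<and> ((int r, 0), (1, 0)) \<in> boundary K
    \<and> inj_on (\<lambda>i. (next_dart K ^^ i) ((int r, 0), (1, 0))) {..Suc r}"
proof -
  let ?B = "boundary K" and ?n = "next_dart K"
  define Fam where "Fam = {X. X \<subseteq> ?B \<and> ?n ` X \<subseteq> X \<and> 0 < (\<Sum>b\<in>X. crossing_right b)}"
  have fin: "finite ?B" by (rule finite_boundary[OF assms(1)])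
  have "?B \<in> Fam" using next_dart_boundary sum_crossing_right[OF assms] by (auto simp: Fam_def)
  \<comment> \<open>A minimal invariant set of darts with positive crossing number is taken, in
    order to obtain a single cycle.\<close>
  then obtain X where X: "X \<in> Fam" and least: "\<And>Y. Y \<in> Fam \<Longrightarrow> card X \<le> card Y"
    using ex_has_least_nat[of "\<lambda>X. X \<in> Fam" ?B card] by blast
  have XB: "X \<subseteq> ?B" "?n ` X \<subseteq> X" "0 < (\<Sum>b\<in>X. crossing_right b)" using X by (auto simp: Fam_def)
  have finX: "finite X" using XB(1) fin finite_subset by blast
  have injX: "inj_on ?n X" using inj_on_subset[OF inj_on_next_dart XB(1)] .
  obtain b where b: "b \<in> X" "0 < crossing_right b"
    using XB(3) sum_nonpos[of X crossing_right] by (meson not_le)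
  obtain a c d where bb: "b = ((a, c), d)" by (metis surj_pair)
  have "c = 0 \<and> d = (1, 0) \<and> 0 \<le> a" using b(2) unfolding bb crossing_right_def by (auto split: if_splits)
  then obtain r :: nat where r: "b = ((int r, 0), (1, 0))" using bb nonneg_int_cases by metis
  have bB: "b \<in> ?B" using b XB by auto
  have "?n ` X = X" by (rule endo_inj_surj[OF finX XB(2) injX])
  then have bij: "bij_betw ?n X X" using injX by (simp add: bij_betw_def)
  have "(\<Sum>b\<in>X. crossing_right b + crossing_left b)
     = (\<Sum>b\<in>X. of_bool (0 < snd (dual_start (?n b))) - of_bool (0 < snd (dual_start b)))"
  proof (rule sum.cong)
    fix b assume "b \<in> X"
    then have "b \<in> ?B" using XB(1) by blast
    from crossing_sum[OF this] show "crossing_right b + crossing_left b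
      = of_bool (0 < snd (dual_start (?n b))) - of_bool (0 < snd (dual_start b))"
      unfolding dual_end_eq[of b K] ..
  qed simp
  also have "\<dots> = 0"
    using sum.reindex_bij_betw[OF bij, of "\<lambda>b. of_bool (0 < snd (dual_start b)) :: int"] by (simp add: sum_subtractf)
  finally have "(\<Sum>b\<in>X. crossing_left b) \<noteq> 0" using XB(3) by (simp add: sum.distrib)
  then obtain b' where b': "b' \<in> X" "crossing_left b' \<noteq> 0" by (meson sum.neutral)
  then have left: "fst (dual_start b') \<le> -1"
    by (cases b') (auto simp: crossing_left_def dual_start_def rot_def split: prod.splits if_splits)
  define T where "T = (\<lambda>i. (?n ^^ i) b) ` UNIV"
  have TX: "T \<subseteq> X"
  proof -
    have "(?n ^^ i) b \<in> X" for i by (induction i) (use b XB in auto)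
    then show ?thesis by (auto simp: T_def)
  qed
  have finT: "finite T" using TX finX finite_subset by blast
  have bT: "b \<in> T" unfolding T_def by (rule image_eqI[of _ _ 0]) auto
  have nT: "?n ` T \<subseteq> T"
  proof -
    have "?n ((?n ^^ i) b) = (?n ^^ Suc i) b" for i by simp
    then show ?thesis unfolding T_def by blast
  qed
  have surjT: "?n ` T = T" by (rule endo_inj_surj[OF finT nT inj_on_subset[OF injX TX]])
  \<comment> \<open>The orbit \<open>T\<close> of \<open>b\<close> and its complement in
    \<open>X\<close> are both invariant. If \<open>T\<close> were a proper part, one of the two
    would have positive crossing number, against minimality.\<close>
  have "T = X"
  proof (rule ccontr)
    assume "T \<noteq> X"
    then have less: "card T < card X" using TX finX by (simp add: psubset_card_mono psubset_eq)
    have "?n ` (X - T) \<subseteq> X - T"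
    proof
      fix y assume "y \<in> ?n ` (X - T)"
      then obtain x where x: "x \<in> X" "x \<notin> T" "y = ?n x" by blast
      have "y \<notin> T"
      proof
        assume "y \<in> T"
        then obtain x' where "x' \<in> T" "y = ?n x'" using surjT by blast
        then have "x = x'" using x TX injX by (auto simp: inj_on_def)
        then show False using x \<open>x' \<in> T\<close> by simp
      qed
      then show "y \<in> X - T" using x XB(2) by auto
    qed
    moreover have "card (X - T) < card X" using bT TX finX by (intro psubset_card_mono) auto
    ultimately have "\<not> 0 < (\<Sum>b\<in>X - T. crossing_right b)"
      using least[of "X - T"] XB(1) unfolding Fam_def by force
    moreover have "\<not> 0 < (\<Sum>b\<in>T. crossing_right b)"
      using least[of T] less TX XB(1) nT unfolding Fam_def by force
    moreover have "(\<Sum>b\<in>X. crossing_right b) = (\<Sum>b\<in>X - T. crossing_right b) + (\<Sum>b\<in>T. crossing_right b)"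
      by (rule sum.subset_diff[OF TX finX])
    ultimately show False using XB(3) by simp
  qed
  then obtain t where t: "b' = (?n ^^ t) b" using b'(1) by (auto simp: T_def)
  \<comment> \<open>The doubled abscissa starts at \<open>2 * r + 1\<close>, is at most -1 at
    \<open>b'\<close>, and drops by at most 2 per step. So \<open>b'\<close> needs at least
    \<open>r + 1\<close> steps, whereas a period of at most \<open>r + 1\<close> would reach it
    within \<open>r\<close>.\<close>
  have "inj_on (\<lambda>i. (?n ^^ i) b) {..Suc r}"
  proof (rule linorder_inj_onI')
    fix i j assume ij: "i \<in> {..Suc r}" "j \<in> {..Suc r}" "i < j"
    show "(?n ^^ i) b \<noteq> (?n ^^ j) b"
    proof
      assume eq: "(?n ^^ i) b = (?n ^^ j) b"
      let ?q = "j - i"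
      have "i + ?q = j" using ij(3) by simp
      then have "(?n ^^ j) b = (?n ^^ i) ((?n ^^ ?q) b)" using funpow_add[of i ?q ?n] by simp
      then have "(?n ^^ i) b = (?n ^^ i) ((?n ^^ ?q) b)" using eq by simp
      moreover have "inj_on (?n ^^ i) X"
      proof (induction i)
        case (Suc i)
        have "(?n ^^ i) ` X \<subseteq> X" by (induction i) (use XB(2) in auto)
        then show ?case using comp_inj_on[OF Suc inj_on_subset[OF injX]] by (simp add: comp_def)
      qed simp
      moreover have "(?n ^^ ?q) b \<in> X" using TX by (auto simp: T_def)
      ultimately have per: "(?n ^^ ?q) b = b" using b(1) by (auto simp: inj_on_def)
      have "b' = (?n ^^ (t mod ?q)) b" unfolding t by (rule funpow_mod_eq[OF per, symmetric])
      then have "fst (dual_start b) - 2 * int (t mod ?q) \<le> -1"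
        using dual_start_funpow[OF bB, of "t mod ?q"] left by simp
      moreover have "fst (dual_start b) = 2 * int r + 1" by (simp add: r dual_start_def rot_def)
      moreover have "t mod ?q < ?q" using ij(3) by simp
      ultimately show False using ij(1,2) by auto
    qed
  qed
  then show ?thesis using bB unfolding r by (intro exI[of _ r]) (auto simp: boundary_def)
qed

text \<open>The dart sets that some contour could visit in \<open>n\<close> steps, whatever
  \<open>K\<close> is: all three possible successors are allowed at each step, which makes the
  family countable by powers of 3.\<close>

fun walks :: "dart \<Rightarrow> nat \<Rightarrow> dart set set" where
  "walks b 0 = {{b}}"
| "walks (x, d) (Suc n) = (\<Union>c\<in>{(x, rot d), (x + rot d, d), (x + d + rot d, - rot d)}. insert (x, d) ` walks c n)"

lemma finite_walks: "finite (walks b n)"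
  by (induction b n rule: walks.induct) auto

lemma card_walks: "card (walks b n) \<le> 3 ^ n"
proof (induction b n rule: walks.induct)
  case (2 x d n)
  let ?C = "{(x, rot d), (x + rot d, d), (x + d + rot d, - rot d)}"
  have "card (walks (x, d) (Suc n)) \<le> (\<Sum>c\<in>?C. card (insert (x, d) ` walks c n))"
    unfolding walks.simps by (rule card_UN_le) simp
  also have "\<dots> \<le> (\<Sum>c\<in>?C. 3 ^ n)"
    by (intro sum_mono order_trans[OF card_image_le[OF finite_walks]] 2)
  also have "\<dots> \<le> 3 * 3 ^ n"
  proof -
    have "card ?C \<le> 3" by (metis (no_types, lifting) card.empty card_insert_le_m1 diff_Suc_1 le_SucI le_refl numeral_3_eq_3 zero_less_Suc)
    then show ?thesis by simp
  qed
  finally show ?case by simp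
qed simp

lemma next_dart_walk: "(\<lambda>i. (next_dart K ^^ i) b) ` {..n} \<in> walks b n"
proof (induction n arbitrary: b)
  case (Suc n)
  obtain x d where b: "b = (x, d)" by (metis surj_pair)
  let ?c = "next_dart K b"
  have "(\<lambda>i. (next_dart K ^^ i) b) ` {..Suc n} = insert b ((\<lambda>i. (next_dart K ^^ i) ?c) ` {..n})"
    unfolding atMost_Suc_eq_insert_0 image_insert image_image by (simp add: funpow_swap1)
  moreover have "?c \<in> {(x, rot d), (x + rot d, d), (x + d + rot d, - rot d)}"
    unfolding b next_dart_def by auto
  ultimately show ?case using Suc[of ?c] unfolding b walks.simps by blast
qed simp

lemma bexp_all_closed:
  assumes "finite E" "A \<subseteq> E"
  shows "bexp p E (\<lambda>S. of_bool (S \<inter> A = {})) = (1 - p) ^ card A"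
proof -
  have finA: "finite A" using assms finite_subset by auto
  have "bexp p E (\<lambda>S. of_bool (S \<inter> A = {})) = bexp p A (\<lambda>S. of_bool (S = {}))"
    by (rule bexp_restrict[OF assms, of p "\<lambda>S. of_bool (S = {})"])
  also have "\<dots> = (\<Sum>S\<in>{{}}. p ^ card S * (1 - p) ^ card (A - S) * of_bool (S = {}))"
    unfolding bexp_def by (rule sum.mono_neutral_right) (use finA in auto)
  finally show ?thesis by simp
qed

lemma two_distinct_coordinates:
  assumes "2 \<le> CARD('d::finite)"
  obtains i j :: "'d::finite" where "i \<noteq> j"
proof -
  have "\<not> (\<forall>i j :: 'd. i = j)"
  proof
    assume "\<forall>i j :: 'd. i = j"
    then have "CARD('d) \<le> Suc 0" by (simp add: card_le_Suc0_iff_eq)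
    then show False using assms by simp
  qed
  then show ?thesis using that by blast
qed

text \<open>Peierls' argument in a coordinate plane. The slice of a small cluster is finite and
  contains the origin, though it may be disconnected, and its contour through the axis at
  \<open>r\<close> begins with \<open>r + 2\<close> darts crossing distinct closed edges. With at
  most \<open>3 ^ Suc r\<close> walks, each closed with probability
  \<open>(1 / 12) ^ (r + 2)\<close>, the sum is geometric of ratio 1/4 and at most 1/36; this is the
  reason for the density 11/12.\<close>

lemma bexp_small_cluster_le:
  assumes dim: "2 \<le> CARD('d::finite)" and p: "p = 11 / 12"
  shows "bexp p (edges_in (centred_cube m)) (\<lambda>S :: 'd edge set. of_bool (card (conn S 0) < m)) \<le> 1 / 2"
proof -
  obtain i j :: 'd where ij: "i \<noteq> j" using two_distinct_coordinates[OF dim] .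
  define P :: "int \<times> int \<Rightarrow> 'd vertex" where "P = (\<lambda>(a, c). \<chi> k. if k = i then a else if k = j then c else 0)"
  let ?E = "edges_in (centred_cube m) :: 'd edge set"
  have P: "P (a, c) $ i = a" "P (a, c) $ j = c" for a c using ij by (auto simp: P_def)
  have injP: "inj P" by (rule injI) (metis P surj_pair)
  have P0: "P (0, 0) = 0" by (auto simp: P_def vec_eq_iff)
  have finE: "finite ?E" by (simp add: finite_edges_in centred_cube_def)
  define ed :: "dart \<Rightarrow> 'd edge" where "ed = (\<lambda>(x, d). {P x, P (x + d)})"
  let ?b = "\<lambda>r::nat. ((int r, 0), (1, 0)) :: dart"
  let ?ok = "\<lambda>r A. card (ed ` A) = r + 2 \<and> ed ` A \<subseteq> ?E"
  have contour: "\<exists>r<m. \<exists>A\<in>walks (?b r) (Suc r). ?ok r A \<and> S \<inter> ed ` A = {}"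
    if S: "S \<subseteq> ?E" and small: "card (conn S 0) < m" for S
  proof -
    define K where "K = {x. P x \<in> conn S 0}"
    have finS: "finite S" using S finE finite_subset by auto
    have Sl: "S \<subseteq> lattice_edges" using S edges_in_lattice by blast
    have near: "\<bar>y $ k\<bar> < int m" if "y \<in> conn S 0" for y k
      using conn_reach_le_card[OF Sl finite_conn[OF finS] that, of k] small by linarith
    have "finite K" unfolding K_def using finite_vimageI[OF finite_conn[OF finS, of 0] injP] by (simp add: vimage_def)
    moreover have "(0, 0) \<in> K" by (simp add: K_def P0)
    ultimately obtain r :: nat where r: "(int r, 0) \<in> K" "?b r \<in> boundary K"
      "inj_on (\<lambda>i. (next_dart K ^^ i) (?b r)) {..Suc r}"
      using long_contour by blast
    define A where "A = (\<lambda>i. (next_dart K ^^ i) (?b r)) ` {..Suc r}"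
    have AB: "A \<subseteq> boundary K" unfolding A_def using funpow_dart_boundary[OF r(2)] by auto
    \<comment> \<open>Exactly one endpoint of such an edge is in the cluster, so the edge determines
      the orientation of its dart.\<close>
    have "inj_on ed (boundary K)"
    proof (rule inj_onI)
      fix b b' assume b: "b \<in> boundary K" "b' \<in> boundary K" "ed b = ed b'"
      obtain x d x' d' where xd: "b = (x, d)" "b' = (x', d')" by (metis surj_pair)
      have in_out: "P x \<in> conn S 0" "P (x + d) \<notin> conn S 0" "P x' \<in> conn S 0" "P (x' + d') \<notin> conn S 0"
        using b xd by (auto simp: boundary_def K_def)
      have "{P x, P (x + d)} = {P x', P (x' + d')}" using b(3) xd by (simp add: ed_def)
      then have "P x = P x'" "P (x + d) = P (x' + d')" using in_out by (auto simp: doubleton_eq_iff)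
      then have "x = x'" "x + d = x' + d'" using injP by (auto dest: injD)
      then show "b = b'" using xd by simp
    qed
    then have "card (ed ` A) = card A" using AB by (intro card_image) (rule inj_on_subset)
    also have "\<dots> = r + 2" unfolding A_def using card_image[OF r(3)] by simp
    finally have card: "card (ed ` A) = r + 2" .
    have in_out: "ed b \<in> ?E \<and> ed b \<notin> S" if b: "b \<in> boundary K" for b
    proof -
      obtain x d where xd: "b = (x, d)" by (metis surj_pair)
      obtain x1 x2 where x: "x = (x1, x2)" by (metis surj_pair)
      have inK: "P x \<in> conn S 0" "P (x + d) \<notin> conn S 0" and d: "d \<in> directions"
        using b xd by (auto simp: boundary_def K_def)
      have "(\<Sum>k\<in>UNIV. \<bar>P x $ k - P (x + d) $ k\<bar>) = (\<Sum>k\<in>UNIV. if k = (if snd d = 0 then i else j) then 1 else 0)"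
        by (rule sum.cong) (use d ij in \<open>auto simp: x P_def directions_def split: prod.splits\<close>)
      then have l: "{P x, P (x + d)} \<in> lattice_edges" unfolding lattice_edges_def by auto
      have "\<bar>P (x + d) $ k\<bar> \<le> int m" for k
        using near[OF inK(1), of k] lattice_neighbours(2)[OF l, of k] by linarith
      moreover have "\<bar>P x $ k\<bar> \<le> int m" for k using near[OF inK(1), of k] by linarith
      ultimately have "ed b \<in> ?E" using l xd by (auto simp: edges_in_def ed_def mem_centred_cube)
      moreover have "ed b \<notin> S" using conn_step[OF inK(1), of "P (x + d)"] inK(2) xd by (auto simp: ed_def)
      ultimately show ?thesis ..
    qed
    have "int r < int m"
    proof -
      have "P (int r, 0) \<in> conn S 0" using r(1) by (simp add: K_def)
      then show ?thesis using near[of "P (int r, 0)" i] by (simp add: P)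
    qed
    moreover have "A \<in> walks (?b r) (Suc r)" unfolding A_def by (rule next_dart_walk)
    ultimately show ?thesis using card in_out AB by (intro exI[of _ r] conjI bexI[of _ A]) auto
  qed
  have "bexp p ?E (\<lambda>S. of_bool (card (conn S 0) < m))
     \<le> bexp p ?E (\<lambda>S. \<Sum>r<m. \<Sum>A\<in>walks (?b r) (Suc r). of_bool (?ok r A) * of_bool (S \<inter> ed ` A = {}))"
  proof (rule bexp_mono)
    fix S assume S: "S \<subseteq> ?E"
    show "of_bool (card (conn S 0) < m) \<le> (\<Sum>r<m. \<Sum>A\<in>walks (?b r) (Suc r). of_bool (?ok r A) * of_bool (S \<inter> ed ` A = {}) :: real)"
    proof (cases "card (conn S 0) < m")
      case True
      then obtain r A where rA: "r < m" "A \<in> walks (?b r) (Suc r)" "?ok r A" "S \<inter> ed ` A = {}"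
        using contour[OF S] by blast
      have "(1::real) = of_bool (?ok r A) * of_bool (S \<inter> ed ` A = {})" using rA by simp
      also have "\<dots> \<le> (\<Sum>A\<in>walks (?b r) (Suc r). of_bool (?ok r A) * of_bool (S \<inter> ed ` A = {}))"
        by (rule member_le_sum[OF rA(2)]) (use finite_walks in auto)
      also have "\<dots> \<le> (\<Sum>r<m. \<Sum>A\<in>walks (?b r) (Suc r). of_bool (?ok r A) * of_bool (S \<inter> ed ` A = {}))"
        by (rule member_le_sum[of r]) (use rA in \<open>auto intro!: sum_nonneg\<close>)
      finally show ?thesis using True by simp
    qed (auto intro!: sum_nonneg)
  qed (use p in auto)
  also have "\<dots> = (\<Sum>r<m. \<Sum>A\<in>walks (?b r) (Suc r). of_bool (?ok r A) * bexp p ?E (\<lambda>S. of_bool (S \<inter> ed ` A = {})))"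
    by (simp add: bexp_sum bexp_cmult)
  also have "\<dots> \<le> (\<Sum>r<m. \<Sum>A\<in>walks (?b r) (Suc r). (1 / 12) ^ (r + 2))"
  proof (intro sum_mono)
    fix r A
    show "of_bool (?ok r A) * bexp p ?E (\<lambda>S. of_bool (S \<inter> ed ` A = {})) \<le> (1 / 12) ^ (r + 2)"
    proof (cases "?ok r A")
      case True
      then show ?thesis using bexp_all_closed[OF finE, of "ed ` A" "11 / 12"] unfolding p by simp
    next
      case False
      then have zero: "of_bool (?ok r A) = (0 :: real)" by (rule of_bool_eq_0_iff[THEN iffD2])
      show ?thesis unfolding zero by simp
    qed
  qed
  also have "\<dots> \<le> (\<Sum>r<m. 3 ^ Suc r * (1 / 12) ^ (r + 2))"
  proof (intro sum_mono)
    fix r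
    have "real (card (walks (?b r) (Suc r))) \<le> 3 ^ Suc r"
      using card_walks[of "?b r" "Suc r"] by (metis of_nat_le_iff of_nat_numeral of_nat_power)
    then show "(\<Sum>A\<in>walks (?b r) (Suc r). (1 / 12) ^ (r + 2)) \<le> (3 ^ Suc r * (1 / 12) ^ (r + 2) :: real)"
      unfolding sum_constant by (rule mult_right_mono) simp
  qed
  also have "\<dots> = (\<Sum>r<m. (1 / 4) ^ r) / 48"
    unfolding sum_divide_distrib
  proof (rule sum.cong)
    fix r
    have "(1 / 4 :: real) ^ r = 3 ^ r * (1 / 12) ^ r" by (subst power_mult_distrib[symmetric]) simp
    then show "3 ^ Suc r * (1 / 12) ^ (r + 2) = (1 / 4 :: real) ^ r / 48" by (simp add: power_add)
  qed simp
  also have "(\<Sum>r<m. (1 / 4) ^ r) \<le> (4 / 3 :: real)"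
  proof -
    have "(\<Sum>r<m. (1 / 4) ^ r) = 4 / 3 * (1 - (1 / 4 :: real) ^ m)" by (induction m) (simp_all add: algebra_simps)
    then show ?thesis by simp
  qed
  finally show ?thesis by simp
qed

lemma theta_11_12:
  assumes "2 \<le> CARD('d::finite)"
  shows "0 < theta TYPE('d) (11 / 12)"
proof -
  have "1 / 2 \<le> theta TYPE('d) (11 / 12)"
  proof (rule theta_ge_bexp)
    fix m
    let ?E = "edges_in (centred_cube m) :: 'd edge set"
    have fin: "finite ?E" by (simp add: finite_edges_in centred_cube_def)
    have "bexp (11 / 12) ?E (\<lambda>S. of_bool (m \<le> card (conn S 0)))
       = bexp (11 / 12) ?E (\<lambda>S. 1 - of_bool (card (conn S 0) < m))"
      by (rule bexp_cong) (simp add: not_le[symmetric])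
    also have "\<dots> \<ge> 1 / 2"
      using bexp_small_cluster_le[OF assms refl, of m] fin by (simp add: bexp_diff bexp_const)
    finally show "1 / 2 \<le> bexp (11 / 12) ?E (\<lambda>S. of_bool (m \<le> card (conn S 0)))" .
  qed auto
  then show ?thesis by simp
qed

lemma p_c_bounds:
  assumes "2 \<le> CARD('d::finite)"
  shows "0 \<le> p_c TYPE('d)" "p_c TYPE('d) < 1"
proof -
  have mem: "11 / 12 \<in> {p \<in> {0..1}. theta TYPE('d) p > 0}" using theta_11_12[OF assms] by simp
  show "0 \<le> p_c TYPE('d)"
    unfolding p_c_def
  proof (rule cInf_greatest)
    show "{p \<in> {0..1}. theta TYPE('d) p > 0} \<noteq> {}" using mem by blast
  qed auto
  have "p_c TYPE('d) \<le> 11 / 12" unfolding p_c_def by (rule cInf_lower[OF mem]) (auto intro!: bdd_belowI[of _ 0])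
  then show "p_c TYPE('d) < 1" by simp
qed

subsection \<open>Percolation in the box\<close>

lemma box_vertices_eq_cube: "box_vertices n = cube (\<chi> i. \<lceil>- real n / 2\<rceil>) n"
proof -
  have "(- real n / 2 \<le> real_of_int z \<and> real_of_int z < real n / 2) = (\<lceil>- real n / 2\<rceil> \<le> z \<and> z < \<lceil>- real n / 2\<rceil> + int n)" for z :: int
  proof -
    have "(z < \<lceil>- real n / 2\<rceil> + int n) = (z - int n < \<lceil>- real n / 2\<rceil>)" by linarith
    also have "\<dots> = (real_of_int (z - int n) < - real n / 2)" by (rule less_ceiling_iff)
    also have "\<dots> = (real_of_int z < real n / 2)" by auto
    finally show ?thesis by (simp add: ceiling_le_iff)
  qed
  then show ?thesis by (simp add: box_vertices_def cube_def)
qed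

lemma finite_box_vertices: "finite (box_vertices n)"
  by (simp add: box_vertices_eq_cube)

lemma card_box_vertices: "card (box_vertices n :: (int ^ 'd::finite) set) = n ^ CARD('d)"
  by (simp add: box_vertices_eq_cube card_cube)

lemma box_edges_eq: "box_edges n = edges_in (box_vertices n)"
  by (simp add: box_edges_def edges_in_def)

lemma finite_box_edges: "finite (box_edges n)"
  by (simp add: box_edges_eq finite_edges_in finite_box_vertices)

lemma card_box_edges: "card (box_edges n :: 'd::finite edge set) \<le> n ^ (2 * CARD('d))"
  using card_edges_in_le[OF finite_box_vertices[where 'a = 'd], of n]
  by (simp add: box_edges_eq card_box_vertices power_mult[symmetric] mult.commute)

lemma bexp_translate:
  fixes v :: "int ^ 'd::finite"
  assumes "finite V"
  shows "bexp p (edges_in ((+) v ` V)) (\<lambda>S. g (card (conn S (v + x)))) = bexp p (edges_in V) (\<lambda>S. g (card (conn S x)))"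
proof -
  have inj: "inj ((+) v)" by simp
  have lat: "(+) v ` e \<in> lattice_edges" if e: "e \<in> lattice_edges" for e and v :: "int ^ 'd"
  proof -
    obtain x y where xy: "e = {x, y}" "(\<Sum>i\<in>UNIV. \<bar>x $ i - y $ i\<bar>) = 1" using e by (rule lattice_edgeE)
    then have "(+) v ` e = {v + x, v + y}" "(\<Sum>i\<in>UNIV. \<bar>(v + x) $ i - (v + y) $ i\<bar>) = 1" by auto
    then show ?thesis unfolding lattice_edges_def by blast
  qed
  have "edges_in ((+) v ` V) = (`) ((+) v) ` edges_in V"
  proof
    show "(`) ((+) v) ` edges_in V \<subseteq> edges_in ((+) v ` V)" using lat by (auto simp: edges_in_def)
    show "edges_in ((+) v ` V) \<subseteq> (`) ((+) v) ` edges_in V"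
    proof
      fix e assume e: "e \<in> edges_in ((+) v ` V)"
      let ?e = "(+) (- v) ` e"
      have "?e \<subseteq> V" using e by (auto simp: edges_in_def)
      moreover have "?e \<in> lattice_edges" using lat[of e "- v"] e by (simp add: edges_in_def)
      moreover have "e = (+) v ` ?e" by (simp add: image_image)
      ultimately show "e \<in> (`) ((+) v) ` edges_in V" by (auto simp: edges_in_def)
    qed
  qed
  then have "bexp p (edges_in ((+) v ` V)) (\<lambda>S. g (card (conn S (v + x))))
     = bexp p (edges_in V) (\<lambda>S. g (card (conn ((`) ((+) v) ` S) (v + x))))"
    using bexp_image[OF finite_edges_in[OF assms], of "(`) ((+) v)"] inj
    by (simp add: inj_on_def inj_image_eq_iff)
  also have "\<dots> = bexp p (edges_in V) (\<lambda>S. g (card (conn S x)))"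
    unfolding conn_image[OF inj] by (simp add: card_image)
  finally show ?thesis .
qed

lemma bexp_card_le:
  assumes "0 \<le> p" "p \<le> 1" "p < p_c TYPE('d::finite)" "finite V" "chi TYPE('d) p \<le> ennreal X" "0 \<le> X"
  shows "bexp p (edges_in V) (\<lambda>S :: 'd edge set. real (card (conn S x))) \<le> X"
proof -
  have fin: "finite (edges_in ((+) (- x) ` V))" by (rule finite_edges_in) (use assms in simp)
  have "bexp p (edges_in ((+) (- x) ` V)) (\<lambda>S. real (card (conn S (- x + x)))) = bexp p (edges_in V) (\<lambda>S. real (card (conn S x)))"
    by (rule bexp_translate[OF assms(4), of p "- x" real x])
  then have "ennreal (bexp p (edges_in V) (\<lambda>S. real (card (conn S x)))) \<le> chi TYPE('d) p"
    using bexp_card_le_chi[OF assms(1-3) edges_in_lattice fin] by simp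
  also have "\<dots> \<le> ennreal X" by fact
  finally show ?thesis using assms(6) by simp
qed

lemma theta_le_bexp_translated:
  fixes x :: "int ^ 'd::finite"
  assumes "0 \<le> p" "p \<le> 1" "finite V" "(+) x ` centred_cube m \<subseteq> V"
  shows "theta TYPE('d) p \<le> bexp p (edges_in V) (\<lambda>S. of_bool (m \<le> card (conn S x)))"
proof -
  let ?V = "(+) (- x) ` V"
  have "centred_cube m \<subseteq> ?V"
  proof
    fix y :: "int ^ 'd" assume "y \<in> centred_cube m"
    then have "x + y \<in> V" using assms(4) by auto
    then show "y \<in> ?V" by (intro image_eqI[of _ _ "x + y"]) auto
  qed
  then have "edges_in (centred_cube m) \<subseteq> edges_in ?V" by (auto simp: edges_in_def)
  then have "theta TYPE('d) p \<le> bexp p (edges_in ?V) (\<lambda>S. of_bool (m \<le> card (conn S (- x + x))))"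
    using theta_le_bexp[where 'd = 'd, OF assms(1,2) edges_in_lattice finite_edges_in, of ?V m] assms(3) by simp
  also have "\<dots> = bexp p (edges_in V) (\<lambda>S. of_bool (m \<le> card (conn S x)))"
    by (rule bexp_translate[OF assms(3), of p "- x" "\<lambda>k. of_bool (m \<le> k)" x])
  finally show ?thesis .
qed

lemma box_upper_tail:
  assumes p: "0 \<le> p" "p < p_c TYPE('d::finite)" "p \<le> 1" and X: "1 \<le> X" "chi TYPE('d) p \<le> ennreal X"
  shows "bexp p (box_edges n) (\<lambda>S :: 'd edge set. of_bool (k \<le> large_count (box_vertices n) m S))
    \<le> exp (2 * X * real n ^ CARD('d) * exp (- (real m / (64 * X\<^sup>2))) - real k / (64 * X\<^sup>2))"
proof -
  have "bexp p (box_edges n) (\<lambda>S :: 'd edge set. of_bool (k \<le> large_count (box_vertices n) m S))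
    \<le> exp (2 * X * real (card (box_vertices n :: 'd vertex set)) * exp (- (real m / (64 * X\<^sup>2))) - real k / (64 * X\<^sup>2))"
  proof (rule large_count_tail)
    fix x :: "'d vertex"
    show "bexp p (box_edges n) (\<lambda>S. real (card (conn S x))) \<le> X"
      unfolding box_edges_eq by (rule bexp_card_le) (use assms finite_box_vertices in auto)
  qed (use assms finite_box_vertices finite_box_edges in \<open>auto simp: box_edges_eq edges_in_def\<close>)
  then show ?thesis by (simp add: card_box_vertices)
qed

text \<open>
  The box is tiled by cubes of side \<open>3 m\<close>; a vertex of the central cube of side \<open>m\<close> that lies in an
  infinite cluster already has \<open>m\<close> vertices in its cluster within the tile.
\<close>

lemma box_lower_tail:
  assumes p: "0 \<le> p" "p \<le> 1" and m: "0 < m"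
  shows "bexp p (box_edges n) (\<lambda>S :: 'd::finite edge set. of_bool (large_count (box_vertices n) m S \<le> k))
    \<le> exp (real k / real m ^ CARD('d) - real (n div (6 * m)) ^ CARD('d) * theta TYPE('d) p / 2)"
proof -
  \<comment> \<open>Only the orthant of nonnegative coordinates is tiled. Its side is about
    \<open>n / 2\<close>, which leaves room for \<open>n div (6 * m)\<close> tiles of side
    \<open>3 * m\<close> in each direction.\<close>
  let ?J = "cube (0 :: int ^ 'd) (n div (6 * m))"
  define Q where "Q = (\<lambda>j :: int ^ 'd. cube (\<chi> i. 3 * int m * j $ i) (3 * m))"
  define T where "T = (\<lambda>j :: int ^ 'd. cube (\<chi> i. 3 * int m * j $ i + int m) m)"
  let ?d = "CARD('d)"
  have QB: "Q j \<subseteq> box_vertices n" if j: "j \<in> ?J" for j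
  proof
    fix x assume x: "x \<in> Q j"
    have "- real n / 2 \<le> real_of_int (x $ i) \<and> real_of_int (x $ i) < real n / 2" for i
    proof -
      have ji: "0 \<le> j $ i" "j $ i + 1 \<le> int (n div (6 * m))" using j by (auto simp: cube_def add1_zle_eq)
      have xi: "3 * int m * j $ i \<le> x $ i" "x $ i < 3 * int m * j $ i + int (3 * m)" using x by (auto simp: Q_def cube_def)
      have "6 * int m * (j $ i + 1) \<le> 6 * int m * int (n div (6 * m))" by (rule mult_left_mono[OF ji(2)]) simp
      also have "\<dots> \<le> int n" by (metis of_nat_mult of_nat_numeral of_nat_le_iff times_div_less_eq_dividend)
      finally have "2 * x $ i < int n" using xi(2) by (simp add: algebra_simps)
      then have "real_of_int (x $ i) < real n / 2" by linarith
      moreover have "0 \<le> x $ i" using xi(1) ji(1) by (meson mult_nonneg_nonneg of_nat_0_le_iff order_trans zero_le_numeral)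
      ultimately show ?thesis by simp
    qed
    then show "x \<in> box_vertices n" by (simp add: box_vertices_def)
  qed
  have Q_disj: "Q j \<inter> Q j' = {}" if "j \<noteq> j'" for j j'
  proof (rule ccontr)
    assume "Q j \<inter> Q j' \<noteq> {}"
    then obtain x where x: "x \<in> Q j" "x \<in> Q j'" by blast
    have "j $ i = j' $ i" for i
    proof -
      have "3 * int m * j $ i \<le> x $ i" "x $ i < 3 * int m * j $ i + 3 * int m"
        "3 * int m * j' $ i \<le> x $ i" "x $ i < 3 * int m * j' $ i + 3 * int m"
        using x by (auto simp: Q_def cube_def)
      then have "3 * int m * j $ i < 3 * int m * (j' $ i + 1)" "3 * int m * j' $ i < 3 * int m * (j $ i + 1)"
        by (simp_all add: algebra_simps)
      then have "j $ i < j' $ i + 1" "j' $ i < j $ i + 1" using m by (simp_all only: mult_less_cancel_left_pos)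
      then show ?thesis by simp
    qed
    then show False using that by (simp add: vec_eq_iff)
  qed
  have TQ: "T j \<subseteq> Q j" for j by (auto simp: T_def Q_def cube_def) (smt (verit))+
  have near: "(+) x ` centred_cube m \<subseteq> Q j" if x: "x \<in> T j" for x j
  proof (rule image_subsetI)
    fix y :: "int ^ 'd" assume y: "y \<in> centred_cube m"
    have "3 * int m * j $ i \<le> (x + y) $ i \<and> (x + y) $ i < 3 * int m * j $ i + int (3 * m)" for i
    proof -
      have "\<bar>y $ i\<bar> \<le> int m" using y by (simp add: mem_centred_cube)
      moreover have "3 * int m * j $ i + int m \<le> x $ i" "x $ i < 3 * int m * j $ i + int m + int m"
        using x by (auto simp: T_def cube_def)
      moreover have "(x + y) $ i = x $ i + y $ i" "int (3 * m) = 3 * int m" by simp_all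
      ultimately show ?thesis by linarith
    qed
    then show "x + y \<in> Q j" by (simp add: Q_def cube_def)
  qed
  have finQ: "finite (Q j)" for j by (simp add: Q_def)
  have cardT: "card (T j) = m ^ ?d" for j by (simp add: T_def card_cube)
  have "bexp p (box_edges n) (\<lambda>S :: 'd edge set. of_bool (large_count (box_vertices n) m S \<le> k))
    \<le> exp (real k / real m ^ ?d - real (card ?J) * (real m ^ ?d * theta TYPE('d) p) / (2 * real m ^ ?d))"
  proof (rule large_count_lower_tail[where T = T and G = "\<lambda>j. edges_in (Q j)"])
    show "T j \<subseteq> box_vertices n" if "j \<in> ?J" for j using TQ QB[OF that] by blast
    show "disjoint_family_on T ?J" unfolding disjoint_family_on_def using TQ Q_disj by blast
    show "edges_in (Q j) \<subseteq> box_edges n" if "j \<in> ?J" for j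
      using QB[OF that] by (auto simp: box_edges_eq edges_in_def)
    show "disjoint_family_on (\<lambda>j. edges_in (Q j)) ?J"
      unfolding disjoint_family_on_def
    proof (intro ballI impI)
      fix j j' :: "int ^ 'd" assume "j \<noteq> j'"
      show "edges_in (Q j) \<inter> edges_in (Q j') = {}"
      proof (rule ccontr)
        assume "edges_in (Q j) \<inter> edges_in (Q j') \<noteq> {}"
        then obtain e where e: "e \<in> lattice_edges" "e \<subseteq> Q j" "e \<subseteq> Q j'" by (auto simp: edges_in_def)
        then obtain x y where "e = {x, y}" by (auto elim: lattice_edgeE)
        then show False using e Q_disj[OF \<open>j \<noteq> j'\<close>] by auto
      qed
    qed
    fix j assume j: "j \<in> ?J"
    have "real m ^ ?d * theta TYPE('d) p = (\<Sum>x\<in>T j. theta TYPE('d) p)" by (simp add: cardT)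
    also have "\<dots> \<le> (\<Sum>x\<in>T j. bexp p (edges_in (Q j)) (\<lambda>S. of_bool (m \<le> card (conn S x))))"
      by (intro sum_mono theta_le_bexp_translated p finQ near)
    also have "\<dots> = bexp p (edges_in (Q j)) (\<lambda>S. real (card {x \<in> T j. m \<le> card (conn S x)}))"
    proof -
      have "finite (T j)" by (simp add: T_def)
      then show ?thesis unfolding bexp_sum[symmetric] by (simp add: Int_def)
    qed
    finally show "real m ^ ?d * theta TYPE('d) p \<le> bexp p (edges_in (Q j)) (\<lambda>S. real (card {x \<in> T j. m \<le> card (conn S x)}))" .
  qed (use assms finite_box_vertices finite_box_edges cardT in auto)
  then show ?thesis using m by (simp add: card_cube)
qed

section \<open>An exact value of the count that is typical at its own density\<close>

definition edge_density :: "real \<Rightarrow> nat \<Rightarrow> nat \<Rightarrow> real" where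
  "edge_density a n k = exp (- real k / real n powr a)"

lemma edge_density_bounds: "0 < edge_density a n k" "0 \<le> edge_density a n k" "edge_density a n k \<le> 1"
  by (auto simp: edge_density_def)

lemma bexp_nonempty_le:
  fixes p :: real
  assumes "finite E" "0 \<le> p" "p \<le> 1"
  shows "bexp p E (\<lambda>S. of_bool (S \<noteq> {})) \<le> card E * p"
proof -
  have "bexp p E (\<lambda>S. of_bool (S \<noteq> {})) = bexp p E (\<lambda>S. 1 - of_bool (S \<inter> E = {}))"
    by (rule bexp_cong) (auto simp: Int_absorb2)
  also have "\<dots> = 1 - (1 - p) ^ card E"
    using assms by (simp add: bexp_diff bexp_const bexp_all_closed)
  also have "\<dots> \<le> card E * p"
    using Bernoulli_inequality[of "- p" "card E"] assms by simp
  finally show ?thesis .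
qed

text \<open>The base \<open>W\<close> dominates \<open>1 / \<mu>\<close>,
  \<open>1 + card E / \<mu>\<close> and 7. In the exponent, \<open>m\<close> comes from the
  thinning, \<open>2 * m * 3 ^ CARD('d)\<close> from the modified edges, and 2 covers the factor
  \<open>8 * card E\<close>.\<close>

lemma exact_count_probability:
  fixes m n :: nat and a :: real
  defines "W \<equiv> 7 * real n ^ (4 * CARD('d::finite))"
  assumes n: "1 \<le> n" and m: "2 \<le> m" and a: "0 < a" "a < CARD('d)"
    and likely: "1 / 2 \<le> bexp (edge_density a n (2 * m)) (box_edges n)
      (\<lambda>S :: 'd edge set. of_bool (2 * m \<le> large_count (box_vertices n) m S))"
  shows "\<exists>k \<le> n ^ CARD('d). (1 / W) ^ (m * (1 + 2 * 3 ^ CARD('d)) + 2)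
    \<le> bexp (edge_density a n k) (box_edges n) (\<lambda>S :: 'd edge set. of_bool (large_count (box_vertices n) m S = k))"
proof -
  let ?V = "box_vertices n :: 'd vertex set" and ?E = "box_edges n :: 'd edge set"
  let ?d = "CARD('d)"
  let ?D = "3 ^ CARD('d) :: nat"
  let ?x = "m * (1 + 2 * ?D) + 2"
  define G where "G = (\<lambda>k. bexp (edge_density a n k) ?E (\<lambda>S. of_bool (k \<le> large_count ?V m S)))"
  define N where "N = real n ^ (2 * ?d)"
  have N: "1 \<le> N" "W = 7 * N\<^sup>2" using n by (auto simp: N_def W_def power_mult[symmetric] one_le_power)
  have W7: "7 \<le> W" using N one_le_power[of N 2] by simp
  \<comment> \<open>The values of \<open>k\<close> that are likely at their own density. The count
    is at most \<open>n ^ CARD('d)\<close>, so there is a largest one, and \<open>likely\<close>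
    puts it at or above \<open>2 * m\<close>.\<close>
  define I where "I = {k. 1 / 2 \<le> G k}"
  have "k \<le> n ^ ?d" if "k \<in> I" for k
  proof (rule ccontr)
    assume k: "\<not> k \<le> n ^ ?d"
    have "G k = bexp (edge_density a n k) ?E (\<lambda>S. 0)"
      unfolding G_def
    proof (rule bexp_cong)
      fix S
      have "large_count ?V m S \<le> n ^ ?d" using large_count_le_card[OF finite_box_vertices] by (simp add: card_box_vertices)
      then show "of_bool (k \<le> large_count ?V m S) = (0 :: real)" using k by simp
    qed
    then have "G k = 0" by (simp add: bexp_const finite_box_edges)
    then show False using that by (simp add: I_def)
  qed
  then have I_le: "I \<subseteq> {..n ^ ?d}" by auto
  then have finI: "finite I" using finite_subset by blast
  have "2 * m \<in> I" using likely by (simp add: I_def G_def)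
  define k where "k = Max I"
  have kI: "k \<in> I" unfolding k_def using Max_in[OF finI] \<open>2 * m \<in> I\<close> by blast
  have k_ge: "2 * m \<le> k" unfolding k_def using Max_ge[OF finI \<open>2 * m \<in> I\<close>] .
  have "Suc k \<notin> I" using Max_ge[OF finI, of "Suc k"] by (auto simp: k_def)
  then have unlikely: "G (Suc k) \<le> 1 / 2" by (simp add: I_def)
  define p where "p = edge_density a n k"
  define r where "r = edge_density a n 1"
  have pr: "p * r = edge_density a n (Suc k)"
    by (simp add: p_def r_def edge_density_def exp_add[symmetric] add_divide_distrib diff_divide_distrib)
  have p: "0 \<le> p" "p \<le> 1" and r: "0 \<le> r" "r \<le> 1" by (simp_all add: p_def r_def edge_density_bounds)
  have na: "1 \<le> real n powr a" "real n powr a \<le> real n ^ ?d"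
  proof -
    show "1 \<le> real n powr a" using n a by (simp add: ge_one_powr_ge_zero)
    have "real n powr a \<le> real n powr real ?d" by (rule powr_mono) (use a n in auto)
    then show "real n powr a \<le> real n ^ ?d" using n by (simp add: powr_realpow)
  qed
  have cardE: "real (card ?E) \<le> N"
    using card_box_edges[where 'd = 'd, of n] unfolding N_def by (metis of_nat_le_iff of_nat_power)
  have y: "0 \<le> 1 / real n powr a" "1 / real n powr a \<le> 1" using na(1) by (auto simp: divide_le_eq)
  \<comment> \<open>A positive count requires an open edge, so the union bound gives
    \<open>p \<ge> 1 / (2 * N)\<close>; with \<open>r \<ge> 1 / 3\<close> this yields
    \<open>p * r \<ge> 1 / (6 * N)\<close>. The distance of \<open>p * r\<close> from 1 is at least
    \<open>1 / (2 * n powr a)\<close>, which is larger.\<close>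
  define \<mu> where "\<mu> = 1 / (6 * N)"
  have \<mu>0: "0 < \<mu>" using N by (simp add: \<mu>_def)
  have half: "1 / 2 \<le> N * p"
  proof -
    have "1 / 2 \<le> bexp p ?E (\<lambda>S. of_bool (k \<le> large_count ?V m S))" using kI by (simp add: I_def G_def p_def)
    also have "\<dots> \<le> bexp p ?E (\<lambda>S. of_bool (S \<noteq> {}))"
    proof (rule bexp_mono)
      fix S :: "'d edge set"
      have "\<not> k \<le> large_count ?V m S" if "S = {}"
      proof -
        have "conn {} x = {x}" for x :: "'d vertex"
        proof -
          have "y = x" if "y \<in> conn {} x" for y using that by (induction rule: conn_induct) auto
          then show ?thesis by auto
        qed
        then have "large_count ?V m {} = 0" using m by (simp add: large_count_def)
        then show ?thesis using that k_ge m by simp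
      qed
      then show "of_bool (k \<le> large_count ?V m S) \<le> (of_bool (S \<noteq> {}) :: real)" by auto
    qed (use p in auto)
    also have "\<dots> \<le> card ?E * p" by (rule bexp_nonempty_le) (use finite_box_edges p in auto)
    also have "\<dots> \<le> N * p" by (rule mult_right_mono[OF cardE p(1)])
    finally show ?thesis .
  qed
  have r3: "1 / 3 \<le> r"
  proof -
    have "exp (- 1) \<le> r" using y by (simp add: r_def edge_density_def)
    moreover have "1 / 3 \<le> exp (- 1 :: real)" using exp_le by (simp add: exp_minus field_simps)
    ultimately show ?thesis by linarith
  qed
  have \<mu>1: "\<mu> \<le> p * r"
  proof -
    have "\<mu> = 1 / (2 * N) * (1 / 3)" by (simp add: \<mu>_def)
    also have "\<dots> \<le> p * r" by (rule mult_mono) (use half N r3 p in \<open>auto simp: field_simps\<close>)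
    finally show ?thesis .
  qed
  have \<mu>2: "\<mu> \<le> 1 - p * r"
  proof -
    have "p * r \<le> 1 * r" by (rule mult_right_mono) (use p r in auto)
    also have "r \<le> 1 - 1 / real n powr a / 2" using exp_minus_le_linear[OF y] by (simp add: r_def edge_density_def)
    finally have "1 / real n powr a / 2 \<le> 1 - p * r" by simp
    moreover have "\<mu> \<le> 1 / real n powr a / 2"
    proof -
      have "real n powr a \<le> N"
      proof -
        have "real n ^ ?d \<le> N" unfolding N_def by (rule power_increasing) (use n in auto)
        then show ?thesis using na(2) by linarith
      qed
      then have "2 * real n powr a \<le> 6 * N" using na(1) by simp
      then have "1 / (6 * N) \<le> 1 / (2 * real n powr a)" by (intro frac_le) (use na(1) n in auto)
      then show ?thesis by (simp add: \<mu>_def mult.commute)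
    qed
    ultimately show ?thesis by linarith
  qed
  have dich: "1 / 4 \<le> bexp p ?E (\<lambda>S. of_bool (large_count ?V m S = k)) \<or>
    r ^ (Suc k * m) / 8 \<le> card ?E * (1 + card ?E / \<mu>) ^ (2 * m * ?D) *
      bexp (p * r) ?E (\<lambda>S. of_bool (large_count ?V m S = Suc k))"
  proof (rule exact_count_lower_bound)
    show "card {e \<in> ?E. y \<in> e} \<le> ?D" for y unfolding box_edges_eq by (rule degree_le)
    show "\<exists>x\<in>U. \<exists>y\<in>?V - U. {x, y} \<in> ?E" if "U \<subseteq> ?V" "U \<noteq> {}" "U \<noteq> ?V" for U
      using that unfolding box_edges_eq box_vertices_eq_cube by (rule cube_connected)
    show "\<exists>a b. e = {a, b}" if "e \<in> ?E" for e
      using that by (auto simp: box_edges_def elim!: lattice_edgeE)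
    show "1 / 2 \<le> bexp p ?E (\<lambda>S. of_bool (k \<le> large_count ?V m S))" using kI by (simp add: I_def G_def p_def)
    show "bexp (p * r) ?E (\<lambda>S. of_bool (Suc k \<le> large_count ?V m S)) \<le> 1 / 2" using unlikely by (simp add: G_def pr)
  qed (fact finite_box_vertices finite_box_edges p r \<mu>0 \<mu>1 \<mu>2 k_ge)+
  have iW: "0 \<le> 1 / W" "1 / W \<le> 1 / 7" using W7 by (auto intro!: divide_left_mono)
  show ?thesis
  proof (cases "1 / 4 \<le> bexp p ?E (\<lambda>S. of_bool (large_count ?V m S = k))")
    case True
    have "(1 / W) ^ ?x \<le> (1 / W) ^ 1" by (rule power_decreasing) (use iW in auto)
    also have "\<dots> \<le> 1 / 4" using iW by simp
    finally have "(1 / W) ^ ?x \<le> bexp p ?E (\<lambda>S. of_bool (large_count ?V m S = k))" using True by (rule order_trans)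
    then show ?thesis using kI I_le unfolding p_def by (intro exI[of _ k]) blast
  next
    case False
    let ?q = "bexp (p * r) ?E (\<lambda>S. of_bool (large_count ?V m S = Suc k))"
    have q0: "0 \<le> ?q" by (rule bexp_nonneg) (use \<mu>0 \<mu>1 \<mu>2 in auto)
    have muW: "1 / W \<le> \<mu>"
    proof -
      have "6 * N \<le> W" using N mult_left_mono[of 1 N N] by (simp add: power2_eq_square)
      then show ?thesis using N by (simp add: \<mu>_def frac_le)
    qed
    have fac: "1 + card ?E / \<mu> \<le> W"
    proof -
      have "card ?E / \<mu> = 6 * N * card ?E" by (simp add: \<mu>_def)
      also have "\<dots> \<le> 6 * N * N" by (rule mult_left_mono[OF cardE]) (use N in auto)
      finally show ?thesis using N one_le_power[of N 2] by (simp add: power2_eq_square)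
    qed
    \<comment> \<open>Here the cost of preserving \<open>Suc k * m\<close> witness edges collapses:
      \<open>r ^ Suc k\<close> is the density at \<open>Suc k\<close>, which is at least
      \<open>\<mu>\<close>, so only an \<open>m\<close>-th power is lost.\<close>
    have rk: "r ^ (Suc k * m) = (p * r) ^ m"
    proof -
      have "r ^ Suc k = p * r"
        unfolding pr by (simp add: r_def edge_density_def exp_of_nat_mult[symmetric] add_divide_distrib diff_divide_distrib del: power_Suc)
      then show ?thesis by (simp only: power_mult)
    qed
    have "(1 / W) ^ m \<le> (p * r) ^ m" by (rule power_mono) (use muW \<mu>1 iW in auto)
    then have "(1 / W) ^ m / 8 \<le> card ?E * (1 + card ?E / \<mu>) ^ (2 * m * ?D) * ?q" using dich False rk by linarith
    also have "\<dots> \<le> N * W ^ (2 * m * ?D) * ?q"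
      by (intro mult_right_mono mult_mono power_mono cardE fac q0) (use \<mu>0 N in auto)
    finally have main: "(1 / W) ^ m \<le> 8 * N * W ^ (2 * m * ?D) * ?q" by simp
    also have "\<dots> \<le> W\<^sup>2 * W ^ (2 * m * ?D) * ?q"
    proof -
      have "8 * N \<le> W * W"
      proof -
        have "8 * N \<le> 7 * W" using N mult_left_mono[of 1 N N] by (simp add: power2_eq_square)
        also have "\<dots> \<le> W * W" by (rule mult_right_mono) (use W7 in auto)
        finally show ?thesis .
      qed
      then show ?thesis by (intro mult_right_mono q0) (use W7 in \<open>auto simp: power2_eq_square\<close>)
    qed
    finally have "(1 / W) ^ m \<le> W ^ (2 * m * ?D + 2) * ?q" by (simp add: power_add power2_eq_square mult_ac)
    then have "(1 / W) ^ m * (1 / W) ^ (2 * m * ?D + 2) \<le> W ^ (2 * m * ?D + 2) * ?q * (1 / W) ^ (2 * m * ?D + 2)"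
      by (rule mult_right_mono) (use iW in auto)
    also have "\<dots> = ?q" using W7 by (simp add: power_one_over)
    also have "(1 / W) ^ m * (1 / W) ^ (2 * m * ?D + 2) = (1 / W) ^ ?x"
      by (simp only: power_add[symmetric]) (simp add: algebra_simps)
    finally have res: "(1 / W) ^ ?x \<le> ?q" .
    have "Suc k \<le> n ^ ?d"
    proof (rule ccontr)
      assume k: "\<not> Suc k \<le> n ^ ?d"
      have "?q = bexp (p * r) ?E (\<lambda>S. 0)"
      proof (rule bexp_cong)
        fix S
        have "large_count ?V m S \<le> n ^ ?d" using large_count_le_card[OF finite_box_vertices] by (simp add: card_box_vertices)
        then show "of_bool (large_count ?V m S = Suc k) = (0 :: real)" using k by auto
      qed
      then have "?q = 0" by (simp add: bexp_const finite_box_edges)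
      moreover have "0 < (1 / W) ^ ?x" using W7 by simp
      ultimately show False using res by simp
    qed
    then show ?thesis using res unfolding pr by (intro exI[of _ "Suc k"]) auto
  qed
qed

subsection \<open>The self-organized measure\<close>

definition threshold :: "nat \<Rightarrow> real \<Rightarrow> nat" where
  "threshold n b = nat \<lceil>real n powr b\<rceil>"

lemma F_n_eq: "F_n n b \<omega> = large_count (box_vertices n) (threshold n b) {e \<in> box_edges n. \<omega> e}"
  unfolding F_n_def large_cluster_vertices_def large_count_def threshold_def cluster_eq_conn
  by (simp add: nat_le_iff ceiling_le_iff)

text \<open>The mass of the event \<open>F_n = k\<close> under \<open>\<mu>_n\<close> before
  division by \<open>Z_n\<close>.\<close>

definition count_weight :: "'d::finite itself \<Rightarrow> nat \<Rightarrow> real \<Rightarrow> real \<Rightarrow> nat \<Rightarrow> real" where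
  "count_weight _ n a b k = bexp (edge_density a n k) (box_edges n)
     (\<lambda>S :: 'd edge set. of_bool (large_count (box_vertices n) (threshold n b) S = k))"

lemma count_weight_nonneg: "0 \<le> count_weight T n a b k"
  unfolding count_weight_def by (rule bexp_nonneg) (simp_all add: edge_density_bounds)

lemma sum_box_configs:
  "(\<Sum>\<omega>\<in>(box_configs n :: 'd::finite config set). f {e \<in> box_edges n. \<omega> e}) = (\<Sum>S\<in>Pow (box_edges n). f S)"
proof (rule sum.reindex_bij_witness[where i = "\<lambda>S. \<lambda>e\<in>box_edges n. e \<in> S" and j = "\<lambda>\<omega>. {e \<in> box_edges n. \<omega> e}"])
  fix \<omega> :: "'d config" assume "\<omega> \<in> box_configs n"
  then show "(\<lambda>e\<in>box_edges n. e \<in> {e \<in> box_edges n. \<omega> e}) = \<omega>"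
    by (auto simp: box_configs_def PiE_iff extensional_def fun_eq_iff)
qed (auto simp: box_configs_def)

lemma sum_box_prob:
  "(\<Sum>\<omega>\<in>(box_configs n :: 'd::finite config set). of_bool (Q (F_n n b \<omega>)) * box_prob n (p_n n a b \<omega>) \<omega>)
    = (\<Sum>k\<le>n ^ CARD('d). of_bool (Q k) * count_weight TYPE('d) n a b k)"
proof -
  let ?E = "box_edges n :: 'd edge set" and ?F = "\<lambda>S. large_count (box_vertices n :: 'd vertex set) (threshold n b) S"
  let ?w = "\<lambda>p S. p ^ card S * (1 - p) ^ card (?E - S)"
  have prob: "box_prob n p \<omega> = ?w p {e \<in> ?E. \<omega> e}" for p and \<omega> :: "'d config"
  proof -
    have "box_prob n p \<omega> = (\<Prod>e\<in>?E \<inter> {e. \<omega> e}. p) * (\<Prod>e\<in>?E \<inter> - {e. \<omega> e}. 1 - p)"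
      unfolding box_prob_def by (rule prod.If_cases) (rule finite_box_edges)
    moreover have "?E \<inter> {e. \<omega> e} = {e \<in> ?E. \<omega> e}" "?E \<inter> - {e. \<omega> e} = ?E - {e \<in> ?E. \<omega> e}" by auto
    ultimately show ?thesis by simp
  qed
  have "(\<Sum>\<omega>\<in>(box_configs n :: 'd config set). of_bool (Q (F_n n b \<omega>)) * box_prob n (p_n n a b \<omega>) \<omega>)
     = (\<Sum>\<omega>\<in>(box_configs n :: 'd config set). (\<lambda>S. of_bool (Q (?F S)) * ?w (edge_density a n (?F S)) S) {e \<in> ?E. \<omega> e})"
    by (rule sum.cong) (simp_all add: prob p_n_def F_n_eq edge_density_def)
  also have "\<dots> = (\<Sum>S\<in>Pow ?E. of_bool (Q (?F S)) * ?w (edge_density a n (?F S)) S)"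
    by (rule sum_box_configs)
  also have "\<dots> = (\<Sum>S\<in>Pow ?E. \<Sum>k\<le>n ^ CARD('d). of_bool (Q k) * (?w (edge_density a n k) S * of_bool (?F S = k)))"
  proof (rule sum.cong)
    fix S
    have le: "?F S \<le> n ^ CARD('d)"
      using large_count_le_card[OF finite_box_vertices[where 'a = 'd]] by (simp add: card_box_vertices)
    have "(\<Sum>k\<le>n ^ CARD('d). of_bool (Q k) * (?w (edge_density a n k) S * of_bool (?F S = k)))
       = (\<Sum>k\<in>{?F S}. of_bool (Q k) * (?w (edge_density a n k) S * of_bool (?F S = k)))"
      by (rule sum.mono_neutral_right) (use le in auto)
    then show "of_bool (Q (?F S)) * ?w (edge_density a n (?F S)) S
      = (\<Sum>k\<le>n ^ CARD('d). of_bool (Q k) * (?w (edge_density a n k) S * of_bool (?F S = k)))" by simp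
  qed simp
  also have "\<dots> = (\<Sum>k\<le>n ^ CARD('d). of_bool (Q k) * count_weight TYPE('d) n a b k)"
    unfolding count_weight_def bexp_def sum_distrib_left by (rule sum.swap)
  finally show ?thesis .
qed

lemma Z_n_eq: "Z_n TYPE('d::finite) n a b = (\<Sum>k\<le>n ^ CARD('d). count_weight TYPE('d) n a b k)"
  using sum_box_prob[of "\<lambda>_. True" n b a, where 'd = 'd] by (simp add: Z_n_def)

lemma finite_box_configs: "finite (box_configs n :: 'd::finite config set)"
  unfolding box_configs_def by (intro finite_PiE finite_box_edges) auto

lemma measure_\<mu>_n:
  assumes "0 < Z_n TYPE('d::finite) n a b"
  shows "measure (\<mu>_n n a b) {\<omega> \<in> (box_configs n :: 'd config set). Q (F_n n b \<omega>)}
    = (\<Sum>k\<le>n ^ CARD('d). of_bool (Q k) * count_weight TYPE('d) n a b k) / Z_n TYPE('d) n a b"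
proof -
  let ?Z = "Z_n TYPE('d) n a b"
  let ?A = "{\<omega> \<in> (box_configs n :: 'd config set). Q (F_n n b \<omega>)}"
  let ?w = "\<lambda>\<omega> :: 'd config. box_prob n (p_n n a b \<omega>) \<omega>"
  have w: "0 \<le> ?w \<omega>" for \<omega>
    unfolding box_prob_def p_n_def by (intro prod_nonneg) auto
  have "emeasure (\<mu>_n n a b) ?A = (\<Sum>\<omega>\<in>?A. ennreal (1 / ?Z * ?w \<omega>))"
    unfolding \<mu>_n_def by (rule emeasure_point_measure_finite) (use finite_box_configs in auto)
  also have "\<dots> = ennreal (\<Sum>\<omega>\<in>?A. 1 / ?Z * ?w \<omega>)"
    by (rule sum_ennreal) (use w assms in auto)
  also have "(\<Sum>\<omega>\<in>?A. 1 / ?Z * ?w \<omega>) = (\<Sum>\<omega>\<in>?A. ?w \<omega>) / ?Z"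
    by (simp add: sum_divide_distrib)
  also have "(\<Sum>\<omega>\<in>?A. ?w \<omega>) = (\<Sum>\<omega>\<in>(box_configs n :: 'd config set). of_bool (Q (F_n n b \<omega>)) * ?w \<omega>)"
    unfolding sum.inter_filter[OF finite_box_configs] by (rule sum.cong) auto
  also have "\<dots> = (\<Sum>k\<le>n ^ CARD('d). of_bool (Q k) * count_weight TYPE('d) n a b k)"
    by (rule sum_box_prob)
  finally have "emeasure (\<mu>_n n a b) ?A = ennreal ((\<Sum>k\<le>n ^ CARD('d). of_bool (Q k) * count_weight TYPE('d) n a b k) / ?Z)" .
  moreover have "0 \<le> (\<Sum>k\<le>n ^ CARD('d). of_bool (Q k) * count_weight TYPE('d) n a b k) / ?Z"
    by (intro divide_nonneg_pos sum_nonneg mult_nonneg_nonneg count_weight_nonneg assms) simp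
  ultimately show ?thesis unfolding measure_def by (simp only: enn2real_ennreal)
qed

subsection \<open>Asymptotics\<close>

lemma filterlim_nat_powr_at_top:
  assumes "0 < s"
  shows "filterlim (\<lambda>n. real n powr s) at_top sequentially"
proof -
  have "filterlim (\<lambda>n. exp (s * ln (real n))) at_top sequentially"
    by (intro filterlim_compose[OF exp_at_top] filterlim_tendsto_pos_mult_at_top[OF tendsto_const assms]
        filterlim_compose[OF ln_at_top] filterlim_real_sequentially)
  then show ?thesis
  proof (rule filterlim_cong[THEN iffD1, rotated -1])
    show "eventually (\<lambda>n. exp (s * ln (real n)) = real n powr s) sequentially"
      using eventually_gt_at_top[of 0] by eventually_elim (simp add: powr_def)
  qed simp_all
qed

lemma eventually_nat_powr_ge:
  assumes "0 < s"
  shows "eventually (\<lambda>n. K \<le> real n powr s) sequentially"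
  using filterlim_nat_powr_at_top[OF assms] by (simp add: filterlim_at_top)

text \<open>The logarithmic factors from the number of values of \<open>k\<close>, from
  \<open>Z_n\<close> and from the densities are all absorbed by a strict gap between
  exponents.\<close>

lemma eventually_log_powr_le:
  assumes "s < u" "0 < \<delta>"
  shows "eventually (\<lambda>n. real n powr s * (A + B * ln (real n)) \<le> \<delta> * real n powr u) sequentially"
proof -
  let ?e = "u - s"
  have e: "0 < ?e" using assms by simp
  have "(\<lambda>n. ln (real n) / real n powr ?e) \<longlonglongrightarrow> 0" by (rule lim_ln_over_power[OF e])
  moreover have "(\<lambda>n. 1 / real n powr ?e) \<longlonglongrightarrow> 0"
    by (rule tendsto_divide_0[OF tendsto_const filterlim_at_top_imp_at_infinity[OF filterlim_nat_powr_at_top[OF e]]])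
  ultimately have "(\<lambda>n. A * (1 / real n powr ?e) + B * (ln (real n) / real n powr ?e)) \<longlonglongrightarrow> A * 0 + B * 0"
    by (intro tendsto_intros)
  then have "eventually (\<lambda>n. A * (1 / real n powr ?e) + B * (ln (real n) / real n powr ?e) < \<delta>) sequentially"
    by (rule order_tendstoD) (use assms in simp)
  then show ?thesis
    using eventually_gt_at_top[of 0]
  proof eventually_elim
    case (elim n)
    let ?p = "real n powr ?e"
    have p: "0 < ?p" using elim(2) by simp
    have "A + B * ln (real n) = (A * (1 / ?p) + B * (ln (real n) / ?p)) * ?p" using p by (simp add: field_simps)
    also have "\<dots> \<le> \<delta> * ?p" by (rule mult_right_mono) (use elim(1) p in auto)
    finally have "real n powr s * (A + B * ln (real n)) \<le> real n powr s * (\<delta> * ?p)" by (rule mult_left_mono) simp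
    also have "\<dots> = \<delta> * real n powr u" by (simp add: powr_add[symmetric])
    finally show ?case .
  qed
qed

lemma tendsto_exp_neg_powr:
  assumes "0 < u" "0 < \<delta>"
  shows "(\<lambda>n. exp (- (\<delta> * real n powr u))) \<longlonglongrightarrow> 0"
proof -
  have "filterlim (\<lambda>n. \<delta> * real n powr u) at_top sequentially"
    by (rule filterlim_tendsto_pos_mult_at_top[OF tendsto_const assms(2) filterlim_nat_powr_at_top[OF assms(1)]])
  then show ?thesis
    by (intro filterlim_compose[OF exp_at_bot] filterlim_uminus_at_bot_at_top[THEN filterlim_compose])
qed

text \<open>The denominator is negative near the threshold, so an upper bound on the quotient bounds
  \<open>theta\<close> from below. If \<open>theta\<close> vanished, \<open>ext_ln\<close> would
  make the quotient infinite, so its positivity follows as well.\<close>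

lemma theta_eventually_ge:
  assumes "Limsup (at pc within {pc<..1}) (\<lambda>p. ext_ln (ennreal (theta T p)) / ereal (ln (p - pc))) \<le> ereal \<beta>"
    and "\<beta> < \<beta>'"
  shows "eventually (\<lambda>p. (p - pc) powr \<beta>' \<le> theta T p) (at pc within {pc<..1})"
proof -
  have "Limsup (at pc within {pc<..1}) (\<lambda>p. ext_ln (ennreal (theta T p)) / ereal (ln (p - pc))) < ereal \<beta>'"
    by (rule le_less_trans[OF assms(1)]) (use assms(2) in simp)
  then have "eventually (\<lambda>p. ext_ln (ennreal (theta T p)) / ereal (ln (p - pc)) < ereal \<beta>') (at pc within {pc<..1})"
    by (rule Limsup_lessD)
  moreover have "eventually (\<lambda>p. p \<in> {pc<..<pc + 1}) (at pc within {pc<..1})"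
    unfolding eventually_at by (intro exI[of _ 1]) (auto simp: dist_real_def)
  ultimately show ?thesis
  proof eventually_elim
    case (elim p)
    define l where "l = ln (p - pc)"
    have l: "l < 0" using elim(2) by (auto simp: l_def)
    have th: "0 \<le> theta T p" by (simp add: theta_def)
    have "theta T p \<noteq> 0"
    proof
      assume "theta T p = 0"
      then have "ext_ln (ennreal (theta T p)) / ereal l = \<infinity>" using l by (simp add: ext_ln_def)
      then show False using elim(1) by (simp add: l_def)
    qed
    then have th: "0 < theta T p" using th by simp
    then have "ext_ln (ennreal (theta T p)) / ereal l = ereal (ln (theta T p) / l)"
      using l by (simp add: ext_ln_def)
    then have "ln (theta T p) / l < \<beta>'" using elim(1) by (simp add: l_def)
    then have "\<beta>' * l < ln (theta T p)" using l by (simp add: neg_divide_less_eq)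
    then have "exp (\<beta>' * l) \<le> exp (ln (theta T p))" by simp
    then show ?case using th elim(2) by (simp add: powr_def l_def)
  qed
qed

text \<open>The negative denominator turns the lower bound on the quotient into an upper bound on
  \<open>chi\<close>. An infinite \<open>chi\<close> would give the quotient minus infinity and is
  therefore excluded.\<close>

lemma chi_eventually_le:
  assumes "Liminf (at pc within {0..<pc}) (\<lambda>p. ext_ln (chi T p) / ereal (ln (pc - p))) \<ge> ereal (- \<gamma>)"
    and "\<gamma> < \<gamma>'"
  shows "eventually (\<lambda>p. chi T p \<le> ennreal ((pc - p) powr (- \<gamma>'))) (at pc within {0..<pc})"
proof -
  have "ereal (- \<gamma>') < Liminf (at pc within {0..<pc}) (\<lambda>p. ext_ln (chi T p) / ereal (ln (pc - p)))"
    by (rule less_le_trans[OF _ assms(1)]) (use assms(2) in simp)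
  then have "eventually (\<lambda>p. ereal (- \<gamma>') < ext_ln (chi T p) / ereal (ln (pc - p))) (at pc within {0..<pc})"
    by (rule less_LiminfD)
  moreover have "eventually (\<lambda>p. p \<in> {pc - 1<..<pc}) (at pc within {0..<pc})"
    unfolding eventually_at by (intro exI[of _ 1]) (auto simp: dist_real_def)
  ultimately show ?thesis
  proof eventually_elim
    case (elim p)
    define l where "l = ln (pc - p)"
    have l: "l < 0" using elim(2) by (auto simp: l_def)
    show ?case
    proof (cases "chi T p = 0")
      case False
      have "chi T p \<noteq> \<infinity>"
      proof
        assume "chi T p = \<infinity>"
        then have "ext_ln (chi T p) / ereal l = - \<infinity>" using l by (simp add: ext_ln_def)
        then show False using elim(1) by (simp add: l_def)
      qed
      then obtain x where x: "chi T p = ennreal x" "0 < x"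
        using False by (cases "chi T p") (auto simp: order_less_le)
      then have "ext_ln (chi T p) / ereal l = ereal (ln x / l)" using l by (simp add: ext_ln_def)
      then have "- \<gamma>' < ln x / l" using elim(1) by (simp add: l_def)
      then have "ln x < - \<gamma>' * l" using l by (simp add: neg_less_divide_eq)
      then have "exp (ln x) \<le> exp (- \<gamma>' * l)" by simp
      then show ?thesis using x elim(2) by (simp add: powr_def l_def ennreal_leI)
    qed simp
  qed
qed

lemma threshold_bounds:
  "real n powr b \<le> real (threshold n b)" "0 < b \<Longrightarrow> 1 \<le> n \<Longrightarrow> real (threshold n b) \<le> 2 * real n powr b"
  "0 < b \<Longrightarrow> 2 \<le> n \<Longrightarrow> 2 \<le> threshold n b"
proof -
  show lower: "real n powr b \<le> real (threshold n b)" unfolding threshold_def by linarith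
  show "real (threshold n b) \<le> 2 * real n powr b" if "0 < b" "1 \<le> n"
  proof -
    have "1 \<le> real n powr b" using that by (simp add: ge_one_powr_ge_zero)
    then show ?thesis unfolding threshold_def by linarith
  qed
  show "2 \<le> threshold n b" if "0 < b" "2 \<le> n"
  proof -
    have "1 < real n powr b" using that by (simp add: gr_one_powr)
    then have "1 < real (threshold n b)" using lower by linarith
    then show ?thesis by simp
  qed
qed

text \<open>The threshold is at most \<open>2 * n powr b\<close>, so the quotient before rounding is
  at least \<open>n powr (1 - b) / 12\<close>; half of this absorbs the rounding once
  \<open>n powr (1 - b) \<ge> 24\<close>.\<close>

lemma eventually_tiles_ge:
  assumes "0 < b" "b < 1"
  shows "eventually (\<lambda>n. real n powr (1 - b) / 24 \<le> real (n div (6 * threshold n b))) sequentially"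
proof -
  have "eventually (\<lambda>n. 24 \<le> real n powr (1 - b)) sequentially"
    by (rule eventually_nat_powr_ge) (use assms in simp)
  then show ?thesis
    using eventually_ge_at_top[of 2]
  proof eventually_elim
    case (elim n)
    let ?m = "threshold n b"
    have m: "2 \<le> ?m" "real ?m \<le> 2 * real n powr b" using threshold_bounds[where n = n and b = b] assms elim(2) by auto
    have "real n powr (1 - b) / 12 = real n / (12 * real n powr b)" using elim(2) by (simp add: powr_diff)
    also have "\<dots> \<le> real n / (6 * real ?m)" by (rule divide_left_mono) (use m elim(2) in auto)
    also have "\<dots> \<le> real (n div (6 * ?m)) + 1"
    proof -
      have "n \<le> 6 * ?m * (n div (6 * ?m)) + 6 * ?m"
        using mult_div_mod_eq[of "6 * ?m" n] mod_less_divisor[of "6 * ?m" n] m(1) by linarith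
      then have "real n \<le> real (6 * ?m * (n div (6 * ?m)) + 6 * ?m)" by (simp only: of_nat_le_iff)
      then show ?thesis using m(1) by (simp add: divide_le_eq algebra_simps)
    qed
    finally show ?case using elim(1) by linarith
  qed
qed

text \<open>For \<open>k\<close> twice the threshold, of order n^b and hence negligible against n^a,
  the density tends to 1 and exceeds 11/12. There \<open>theta\<close> is positive, and the lower
  tail shows that the count reaches \<open>k\<close> with probability at least 1/2, which starts the
  search for a typical value.\<close>

lemma eventually_Z_n_ge:
  fixes a b :: real
  assumes dim: "2 \<le> CARD('d::finite)" and ab: "0 < b" "b < a" "a < CARD('d)" "b < 1"
  shows "\<exists>A B. eventually (\<lambda>n. exp (- (real n powr b * (A + B * ln (real n)))) \<le> Z_n TYPE('d) n a b) sequentially"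
proof -
  let ?d = "CARD('d)"
  define h where "h = theta TYPE('d) (11 / 12)"
  have h: "0 < h" using theta_11_12[OF dim] by (simp add: h_def)
  \<comment> \<open>With the threshold at most \<open>2 * n powr b\<close>, the constant
    \<open>C\<close> bounds the exponent \<open>m * (1 + 2 * 3 ^ d) + 2\<close> by
    \<open>C * n powr b\<close>.\<close>
  define C where "C = 2 * (1 + 2 * 3 ^ ?d) + (2 :: real)"
  have ln23: "ln (11 / 12 :: real) < 0" by simp
  have "eventually (\<lambda>n. 4 / (- ln (11 / 12)) \<le> real n powr (a - b)) sequentially"
    by (rule eventually_nat_powr_ge) (use ab in simp)
  moreover have "eventually (\<lambda>n. 24 * (6 / h) \<le> real n powr (1 - b)) sequentially"
    by (rule eventually_nat_powr_ge) (use ab in simp)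
  moreover note eventually_tiles_ge[OF ab(1,4)] eventually_ge_at_top[of 2]
  ultimately have "eventually (\<lambda>n. exp (- (real n powr b * (C * ln 7 + C * (4 * ?d) * ln (real n)))) \<le> Z_n TYPE('d) n a b) sequentially"
  proof eventually_elim
    case (elim n)
    let ?m = "threshold n b" and ?V = "box_vertices n :: 'd vertex set" and ?E = "box_edges n :: 'd edge set"
    have m: "2 \<le> ?m" "real ?m \<le> 2 * real n powr b" using threshold_bounds[where n = n and b = b] ab elim(4) by auto
    have nb: "1 \<le> real n powr b" using ab elim(4) by (simp add: ge_one_powr_ge_zero)
    define W where "W = 7 * real n ^ (4 * ?d)"
    have W: "7 \<le> W" using elim(4) one_le_power[of "real n" "4 * ?d"] by (simp add: W_def)
    have dens: "11 / 12 \<le> edge_density a n (2 * ?m)"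
    proof -
      have "real (2 * ?m) / real n powr a \<le> 4 * real n powr b / real n powr a" by (rule divide_right_mono) (use m in auto)
      also have "\<dots> = 4 / real n powr (a - b)" by (simp add: powr_diff)
      also have "\<dots> \<le> - ln (11 / 12)" using elim(1,4) ln23 by (simp add: field_simps)
      finally have "exp (ln (11 / 12)) \<le> edge_density a n (2 * ?m)" unfolding edge_density_def by (subst exp_le_cancel_iff) simp
      then show ?thesis by simp
    qed
    have "1 / 2 \<le> bexp (11 / 12) ?E (\<lambda>S. of_bool (2 * ?m \<le> large_count ?V ?m S))"
    proof -
      let ?J = "n div (6 * ?m)"
      \<comment> \<open>This makes the tile term of the tail at least 3, while the count term is at
        most 2, leaving \<open>exp (- 1)\<close>.\<close>
      have J: "6 / h \<le> real ?J" using elim(2,3) by simp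
      have "bexp (11 / 12) ?E (\<lambda>S. of_bool (large_count ?V ?m S \<le> 2 * ?m))
        \<le> exp (real (2 * ?m) / real ?m ^ ?d - real ?J ^ ?d * h / 2)"
        unfolding h_def by (rule box_lower_tail) (use m in auto)
      also have "\<dots> \<le> exp (- 1)"
      proof -
        have "real ?m \<le> real ?m ^ ?d" using m dim by (intro self_le_power) auto
        then have "real (2 * ?m) / real ?m ^ ?d \<le> 2" using m(1) by (simp add: divide_le_eq)
        moreover have "6 / h \<le> real ?J ^ ?d"
        proof -
          have "0 < real ?J" using J h by (meson divide_pos_pos less_le_trans zero_less_numeral)
          then have "real ?J \<le> real ?J ^ ?d" using dim by (intro self_le_power) auto
          then show ?thesis using J by linarith
        qed
        then have "3 \<le> real ?J ^ ?d * h / 2" using h by (simp add: field_simps)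
        ultimately show ?thesis by simp
      qed
      also have "\<dots> \<le> 1 / 2" using exp_ge_add_one_self[of 1] by (simp add: exp_minus field_simps)
      finally have "bexp (11 / 12) ?E (\<lambda>S. of_bool (large_count ?V ?m S \<le> 2 * ?m)) \<le> 1 / 2" .
      moreover have "bexp (11 / 12) ?E (\<lambda>S. 1 - of_bool (large_count ?V ?m S \<le> 2 * ?m))
        \<le> bexp (11 / 12) ?E (\<lambda>S. of_bool (2 * ?m \<le> large_count ?V ?m S))"
        by (rule bexp_mono) auto
      ultimately show ?thesis by (simp add: bexp_diff bexp_const finite_box_edges)
    qed
    also have "\<dots> \<le> bexp (edge_density a n (2 * ?m)) ?E (\<lambda>S. of_bool (2 * ?m \<le> large_count ?V ?m S))"
    proof (rule bexp_mono_density)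
      fix S T assume "S \<subseteq> T" "T \<subseteq> ?E"
      then have "large_count ?V ?m S \<le> large_count ?V ?m T"
        by (intro large_count_mono finite_box_vertices) (auto intro: finite_subset[OF _ finite_box_edges])
      then show "(of_bool (2 * ?m \<le> large_count ?V ?m S) :: real) \<le> of_bool (2 * ?m \<le> large_count ?V ?m T)" by auto
    qed (use dens edge_density_bounds finite_box_edges in auto)
    finally obtain k where k: "k \<le> n ^ ?d"
      "(1 / W) ^ (?m * (1 + 2 * 3 ^ ?d) + 2) \<le> bexp (edge_density a n k) ?E (\<lambda>S. of_bool (large_count ?V ?m S = k))"
      using exact_count_probability[where 'd = 'd, of n ?m a] elim(4) m ab unfolding W_def by auto
    have "real n powr b * (C * ln 7 + C * (4 * ?d) * ln (real n)) = (C * real n powr b) * ln W"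
      using elim(4) by (simp add: W_def ln_mult ln_realpow algebra_simps)
    moreover have "real (?m * (1 + 2 * 3 ^ ?d) + 2) * ln W \<le> (C * real n powr b) * ln W"
    proof (rule mult_right_mono)
      have "real ?m * (1 + 2 * 3 ^ ?d) \<le> 2 * real n powr b * (1 + 2 * 3 ^ ?d)" by (rule mult_right_mono[OF m(2)]) simp
      then show "real (?m * (1 + 2 * 3 ^ ?d) + 2) \<le> C * real n powr b" using nb by (simp add: C_def algebra_simps)
    qed (use W in simp)
    ultimately have "real (?m * (1 + 2 * 3 ^ ?d) + 2) * ln W \<le> real n powr b * (C * ln 7 + C * (4 * ?d) * ln (real n))"
      by (simp only:)
    then have "exp (- (real n powr b * (C * ln 7 + C * (4 * ?d) * ln (real n))))
      \<le> exp (- (real (?m * (1 + 2 * 3 ^ ?d) + 2) * ln W))" by (simp only: exp_le_cancel_iff neg_le_iff_le)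
    also have "\<dots> = (1 / W) ^ (?m * (1 + 2 * 3 ^ ?d) + 2)"
      using W by (simp only: exp_minus exp_of_nat_mult power_one_over inverse_eq_divide) simp
    also have "\<dots> \<le> count_weight TYPE('d) n a b k" using k(2) by (simp add: count_weight_def)
    also have "\<dots> \<le> Z_n TYPE('d) n a b"
      unfolding Z_n_eq by (rule member_le_sum) (use k(1) count_weight_nonneg in auto)
    finally show ?case .
  qed
  then show ?thesis by blast
qed

section \<open>Weights of the densities away from the threshold\<close>

lemma sum_le_card_times:
  fixes K :: nat and f :: "nat \<Rightarrow> real"
  assumes "\<And>k. k \<le> K \<Longrightarrow> Q k \<Longrightarrow> f k \<le> B" "0 \<le> B"
  shows "(\<Sum>k\<le>K. of_bool (Q k) * f k) \<le> (1 + real K) * B"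
proof -
  have "(\<Sum>k\<le>K. of_bool (Q k) * f k) \<le> (\<Sum>k\<le>K. B)"
    by (rule sum_mono) (use assms in auto)
  then show ?thesis by simp
qed

text \<open>Let \<open>\<eta> = 2 * c * \<gamma>'\<close>, the exponent of the square of the bound
  on \<open>chi\<close> at the edge of the window. The condition \<open>\<eta> < b\<close> keeps the
  number of tilted large clusters, the first term of the tail, below 1; the condition
  \<open>\<eta> < a - b\<close> gives the decay exponent \<open>a - \<eta>\<close>, which exceeds
  \<open>b\<close>.\<close>

lemma lower_deviation_sum:
  fixes a b c \<epsilon> \<gamma>' :: real
  assumes dim: "2 \<le> CARD('d::finite)" and ab: "0 < b" "b < a"
    and c: "0 < c" "0 < \<gamma>'" "2 * c * \<gamma>' < b" "2 * c * \<gamma>' < a - b" and \<epsilon>: "0 < \<epsilon>"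
    and chi: "eventually (\<lambda>p. chi TYPE('d) p \<le> ennreal ((p_c TYPE('d) - p) powr (- \<gamma>')))
      (at (p_c TYPE('d)) within {0..<p_c TYPE('d)})"
  shows "\<exists>u>b. \<exists>\<delta>>0. eventually (\<lambda>n. (\<Sum>k\<le>n ^ CARD('d).
      of_bool (edge_density a n k \<le> p_c TYPE('d) - \<epsilon> * real n powr (- c)) * count_weight TYPE('d) n a b k)
      \<le> exp (- (\<delta> * real n powr u))) sequentially"
proof (cases "p_c TYPE('d) = 0")
  case True
  \<comment> \<open>Densities are strictly positive, so none lies below a vanishing
    threshold.\<close>
  have "\<not> edge_density a n k \<le> p_c TYPE('d) - \<epsilon> * real n powr (- c)" for n k
    using edge_density_bounds(1)[of a n k] \<epsilon> True by (smt (verit) mult_nonneg_nonneg powr_ge_zero)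
  then show ?thesis by (intro exI[of _ "b + 1"] conjI exI[of _ 1]) auto
next
  case False
  let ?d = "CARD('d)" and ?pc = "p_c TYPE('d)"
  have pc: "0 < ?pc" "?pc < 1" using p_c_bounds[OF dim] False by auto
  define \<eta> where "\<eta> = 2 * c * \<gamma>'"
  define H where "H = 64 * \<epsilon> powr (- 2 * \<gamma>')"
  define \<kappa> where "\<kappa> = - ln ?pc"
  define ps where "ps = (\<lambda>n. ?pc - \<epsilon> * real n powr (- c))"
  have H: "0 < H" using \<epsilon> by (simp add: H_def)
  have \<kappa>: "0 < \<kappa>" using pc by (simp add: \<kappa>_def)
  have neg_lim: "(\<lambda>n. real n powr (- c)) \<longlonglongrightarrow> 0"
    by (rule tendsto_neg_powr[OF _ filterlim_real_sequentially]) (use c in simp)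
  have ps_lim: "ps \<longlonglongrightarrow> ?pc"
    unfolding ps_def using tendsto_diff[OF tendsto_const tendsto_mult_right_zero[OF neg_lim], of ?pc \<epsilon>] by simp
  then have ps_pos: "eventually (\<lambda>n. 0 < ps n) sequentially" by (rule order_tendstoD) (use pc in simp)
  have ps_less: "eventually (\<lambda>n. ps n < ?pc) sequentially"
    using eventually_gt_at_top[of 0] by eventually_elim (use \<epsilon> in \<open>simp add: ps_def\<close>)
  have "filterlim ps (at ?pc within {0..<?pc}) sequentially"
    unfolding filterlim_at using ps_lim ps_pos ps_less by (auto elim: eventually_elim2)
  then have chi_ps: "eventually (\<lambda>n. chi TYPE('d) (ps n) \<le> ennreal ((?pc - ps n) powr (- \<gamma>'))) sequentially"
    using chi by (rule eventually_compose_filterlim[rotated])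
  have big_X: "eventually (\<lambda>n. \<epsilon> powr \<gamma>' \<le> real n powr (c * \<gamma>')) sequentially"
    by (rule eventually_nat_powr_ge) (use c in simp)
  have ev1: "eventually (\<lambda>n. real n powr 0 * (ln (2 * \<epsilon> powr (- \<gamma>')) + (c * \<gamma>' + ?d) * ln (real n)) \<le> 1 / H * real n powr (b - \<eta>)) sequentially"
    by (rule eventually_log_powr_le) (use c H \<eta>_def in auto)
  have ev2: "eventually (\<lambda>n. real n powr 0 * ((ln 2 + 1) + ?d * ln (real n)) \<le> \<kappa> / H / 2 * real n powr (a - \<eta>)) sequentially"
    by (rule eventually_log_powr_le) (use c ab H \<kappa> \<eta>_def in auto)
  have "eventually (\<lambda>n. (\<Sum>k\<le>n ^ ?d. of_bool (edge_density a n k \<le> ps n) * count_weight TYPE('d) n a b k)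
      \<le> exp (- (\<kappa> / H / 2 * real n powr (a - \<eta>)))) sequentially"
    using ps_pos ps_less chi_ps big_X ev1 ev2 eventually_ge_at_top[of 2]
  proof eventually_elim
    case (elim n)
    let ?m = "threshold n b" and ?V = "box_vertices n :: 'd vertex set" and ?E = "box_edges n :: 'd edge set"
    have n: "0 < real n" using elim(7) by simp
    define X where "X = \<epsilon> powr (- \<gamma>') * real n powr (c * \<gamma>')"
    have "(?pc - ps n) powr (- \<gamma>') = X"
      using \<epsilon> n by (simp add: ps_def X_def powr_mult powr_powr)
    then have chiX: "chi TYPE('d) (ps n) \<le> ennreal X" using elim(3) by simp
    have X1: "1 \<le> X" using elim(4) \<epsilon> by (simp add: X_def powr_minus field_simps)
    have X2: "64 * X\<^sup>2 = H * real n powr \<eta>"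
    proof -
      have sq: "(x powr y)\<^sup>2 = x powr (2 * y)" for x y :: real by (simp add: power2_eq_square powr_add[symmetric])
      show ?thesis unfolding X_def H_def \<eta>_def power_mult_distrib sq by (simp add: mult.assoc)
    qed
    have tail: "2 * X * real n ^ ?d * exp (- (real ?m / (64 * X\<^sup>2))) \<le> 1"
    proof -
      have "real n powr (b - \<eta>) / H = real n powr b / (64 * X\<^sup>2)" unfolding X2 using n by (simp add: powr_diff)
      also have "\<dots> \<le> real ?m / (64 * X\<^sup>2)" by (rule divide_right_mono) (use threshold_bounds(1)[where n = n and b = b] in auto)
      finally have mm: "real n powr (b - \<eta>) / H \<le> real ?m / (64 * X\<^sup>2)" .
      have "2 * X * real n ^ ?d = exp (ln (2 * \<epsilon> powr (- \<gamma>')) + (c * \<gamma>' + ?d) * ln (real n))"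
      proof -
        have "exp (ln (2 * \<epsilon> powr (- \<gamma>')) + (c * \<gamma>' + ?d) * ln (real n))
          = (2 * \<epsilon> powr (- \<gamma>')) * (real n powr (c * \<gamma>' + ?d))"
          using \<epsilon> n by (simp add: exp_add powr_def)
        then show ?thesis using n by (simp add: X_def powr_add powr_realpow mult_ac)
      qed
      also have "\<dots> \<le> exp (real ?m / (64 * X\<^sup>2))" using elim(5) mm n by simp
      finally show ?thesis by (simp add: exp_minus field_simps)
    qed
    have each: "count_weight TYPE('d) n a b k \<le> exp (1 - \<kappa> / H * real n powr (a - \<eta>))"
      if k: "edge_density a n k \<le> ps n" for k
    proof -
      \<comment> \<open>This is where \<open>p_c < 1\<close> enters:
        \<open>\<kappa> = - ln p_c\<close> is positive, so a density below the threshold forces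
        \<open>k\<close> to be of order \<open>n powr a\<close>.\<close>
      have "ln (edge_density a n k) \<le> ln ?pc" using k elim(2) edge_density_bounds(1)[of a n k] by (intro ln_mono) auto
      then have "\<kappa> * real n powr a \<le> real k" using n by (simp add: edge_density_def \<kappa>_def field_simps)
      then have "\<kappa> * real n powr a / (64 * X\<^sup>2) \<le> real k / (64 * X\<^sup>2)" by (rule divide_right_mono) simp
      moreover have "\<kappa> * real n powr a / (64 * X\<^sup>2) = \<kappa> / H * real n powr (a - \<eta>)"
        unfolding X2 using n by (simp add: powr_diff)
      ultimately have kk: "\<kappa> / H * real n powr (a - \<eta>) \<le> real k / (64 * X\<^sup>2)" by simp
      \<comment> \<open>Replacing equality by \<open>\<ge>\<close> gives an increasing event, and
        the density can be raised to the common value \<open>ps n\<close>, where \<open>chi\<close>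
        is controlled.\<close>
      have "count_weight TYPE('d) n a b k \<le> bexp (edge_density a n k) ?E (\<lambda>S. of_bool (k \<le> large_count ?V ?m S))"
        unfolding count_weight_def by (rule bexp_mono) (use edge_density_bounds in auto)
      also have "\<dots> \<le> bexp (ps n) ?E (\<lambda>S. of_bool (k \<le> large_count ?V ?m S))"
      proof (rule bexp_mono_density)
        fix S T assume "S \<subseteq> T" "T \<subseteq> ?E"
        then have "large_count ?V ?m S \<le> large_count ?V ?m T"
          by (intro large_count_mono finite_box_vertices) (auto intro: finite_subset[OF _ finite_box_edges])
        then show "(of_bool (k \<le> large_count ?V ?m S) :: real) \<le> of_bool (k \<le> large_count ?V ?m T)" by auto
      qed (use k elim(2) pc edge_density_bounds finite_box_edges in auto)
      also have "\<dots> \<le> exp (2 * X * real n ^ ?d * exp (- (real ?m / (64 * X\<^sup>2))) - real k / (64 * X\<^sup>2))"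
        by (rule box_upper_tail) (use elim(1,2) pc X1 chiX in auto)
      also have "\<dots> \<le> exp (1 - \<kappa> / H * real n powr (a - \<eta>))" using tail kk by simp
      finally show ?thesis .
    qed
    have "(\<Sum>k\<le>n ^ ?d. of_bool (edge_density a n k \<le> ps n) * count_weight TYPE('d) n a b k)
      \<le> (1 + real (n ^ ?d)) * exp (1 - \<kappa> / H * real n powr (a - \<eta>))"
      by (rule sum_le_card_times) (use each in auto)
    also have "\<dots> \<le> exp (ln 2 + ?d * ln (real n)) * exp (1 - \<kappa> / H * real n powr (a - \<eta>))"
    proof (rule mult_right_mono)
      have "exp (ln 2 + ?d * ln (real n)) = 2 * real n ^ ?d" using n by (simp add: exp_add exp_of_nat_mult)
      moreover have "1 \<le> real n ^ ?d" using elim(7) by simp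
      ultimately show "1 + real (n ^ ?d) \<le> exp (ln 2 + ?d * ln (real n))" by simp
    qed simp
    also have "\<dots> = exp ((ln 2 + 1 + ?d * ln (real n)) - \<kappa> / H * real n powr (a - \<eta>))" by (simp add: exp_add[symmetric])
    also have "\<dots> \<le> exp (- (\<kappa> / H / 2 * real n powr (a - \<eta>)))" using elim(6) n by simp
    finally show ?case .
  qed
  then show ?thesis unfolding ps_def
    using c ab H \<kappa> by (intro exI[of _ "a - \<eta>"] conjI exI[of _ "\<kappa> / H / 2"]) (auto simp: \<eta>_def)
qed

text \<open>The exponent \<open>u\<close> is that of the number of tiles times \<open>theta\<close>
  at the edge of the window; the fourth condition says \<open>u > b\<close>. A density of at least
  \<open>\<epsilon> * n powr (- c)\<close> bounds \<open>k\<close> by a multiple of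
  \<open>n powr a\<close> up to a logarithm, and the condition
  \<open>c * \<beta>' < CARD('d) - a\<close> makes the resulting cost negligible against
  \<open>n powr u\<close>.\<close>

lemma upper_deviation_sum:
  fixes a b c \<epsilon> \<beta>' :: real
  assumes dim: "2 \<le> CARD('d::finite)" and ab: "0 < b" "b < 1"
    and c: "0 < c" "0 < \<beta>'" "c * \<beta>' < CARD('d) - a" "c * \<beta>' < CARD('d) - b * CARD('d) - b" and \<epsilon>: "0 < \<epsilon>"
    and theta: "eventually (\<lambda>p. (p - p_c TYPE('d)) powr \<beta>' \<le> theta TYPE('d) p)
      (at (p_c TYPE('d)) within {p_c TYPE('d)<..1})"
  shows "\<exists>u>b. \<exists>\<delta>>0. eventually (\<lambda>n. (\<Sum>k\<le>n ^ CARD('d).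
      of_bool (p_c TYPE('d) + \<epsilon> * real n powr (- c) \<le> edge_density a n k) * count_weight TYPE('d) n a b k)
      \<le> exp (- (\<delta> * real n powr u))) sequentially"
proof -
  let ?d = "CARD('d)" and ?pc = "p_c TYPE('d)"
  have pc: "0 \<le> ?pc" "?pc < 1" using p_c_bounds[OF dim] by auto
  define u where "u = ?d * (1 - b) - c * \<beta>'"
  \<comment> \<open>The 24 comes from the count of tiles in each direction and the 2 from the
    exponent of \<open>box_lower_tail\<close>.\<close>
  define \<delta> where "\<delta> = \<epsilon> powr \<beta>' / (2 * 24 ^ ?d)"
  define ps where "ps = (\<lambda>n. ?pc + \<epsilon> * real n powr (- c))"
  have \<delta>: "0 < \<delta>" using \<epsilon> by (simp add: \<delta>_def)
  have u: "b < u" "a - b * ?d < u" using c by (auto simp: u_def algebra_simps)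
  have neg_lim: "(\<lambda>n. real n powr (- c)) \<longlonglongrightarrow> 0"
    by (rule tendsto_neg_powr[OF _ filterlim_real_sequentially]) (use c in simp)
  have ps_lim: "ps \<longlonglongrightarrow> ?pc"
    unfolding ps_def using tendsto_add[OF tendsto_const tendsto_mult_right_zero[OF neg_lim], of ?pc \<epsilon>] by simp
  then have ps_less: "eventually (\<lambda>n. ps n < 1) sequentially" by (rule order_tendstoD) (use pc in simp)
  have ps_gt: "eventually (\<lambda>n. ?pc < ps n) sequentially"
    using eventually_gt_at_top[of 0] by eventually_elim (use \<epsilon> in \<open>simp add: ps_def\<close>)
  have "filterlim ps (at ?pc within {?pc<..1}) sequentially"
    unfolding filterlim_at using ps_lim ps_less ps_gt by (auto elim: eventually_elim2)
  then have theta_ps: "eventually (\<lambda>n. (ps n - ?pc) powr \<beta>' \<le> theta TYPE('d) (ps n)) sequentially"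
    using theta by (rule eventually_compose_filterlim[rotated])
  have ev1: "eventually (\<lambda>n. real n powr (a - b * ?d) * (- ln \<epsilon> + c * ln (real n)) \<le> \<delta> / 4 * real n powr u) sequentially"
    by (rule eventually_log_powr_le) (use u \<delta> in auto)
  have ev2: "eventually (\<lambda>n. real n powr 0 * (ln 2 + ?d * ln (real n)) \<le> \<delta> / 4 * real n powr u) sequentially"
    by (rule eventually_log_powr_le) (use u ab \<delta> in auto)
  have "eventually (\<lambda>n. (\<Sum>k\<le>n ^ ?d. of_bool (ps n \<le> edge_density a n k) * count_weight TYPE('d) n a b k)
      \<le> exp (- (\<delta> / 2 * real n powr u))) sequentially"
    using ps_less ps_gt theta_ps ev1 ev2 eventually_tiles_ge[OF ab] eventually_ge_at_top[of 2]
  proof eventually_elim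
    case (elim n)
    let ?m = "threshold n b" and ?V = "box_vertices n :: 'd vertex set" and ?E = "box_edges n :: 'd edge set"
    let ?J = "n div (6 * ?m)"
    have n: "0 < real n" using elim(7) by simp
    have m: "0 < ?m" using threshold_bounds(3)[where n = n and b = b] ab elim(7) by auto
    have J: "\<delta> * real n powr u \<le> real ?J ^ ?d * theta TYPE('d) (ps n) / 2"
    proof -
      have "\<delta> * real n powr u = (real n powr (1 - b) / 24) ^ ?d * ((\<epsilon> * real n powr (- c)) powr \<beta>') / 2"
      proof -
        have "(real n powr (1 - b)) ^ ?d = real n powr (?d * (1 - b))"
          using n by (simp add: powr_realpow[symmetric] powr_powr mult.commute)
        moreover have "(\<epsilon> * real n powr (- c)) powr \<beta>' = \<epsilon> powr \<beta>' * real n powr (- (c * \<beta>'))"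
          using \<epsilon> by (simp add: powr_mult powr_powr)
        moreover have "real n powr u = real n powr (?d * (1 - b)) * real n powr (- (c * \<beta>'))"
          unfolding u_def by (simp add: powr_add[symmetric])
        ultimately show ?thesis by (simp only: \<delta>_def power_divide) (simp add: mult_ac)
      qed
      also have "\<dots> \<le> real ?J ^ ?d * theta TYPE('d) (ps n) / 2"
        by (intro divide_right_mono mult_mono power_mono) (use elim(3,6) in \<open>auto simp: ps_def\<close>)
      finally show ?thesis .
    qed
    have each: "count_weight TYPE('d) n a b k \<le> exp (\<delta> / 4 * real n powr u - \<delta> * real n powr u)"
      if k: "ps n \<le> edge_density a n k" for k
    proof -
      have "ln (\<epsilon> * real n powr (- c)) \<le> ln (edge_density a n k)"
        using k pc \<epsilon> n by (intro ln_mono) (auto simp: ps_def)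
      then have "real k / real n powr a \<le> - ln \<epsilon> + c * ln (real n)"
        using \<epsilon> n by (simp add: edge_density_def ln_mult ln_powr)
      then have "real k \<le> real n powr a * (- ln \<epsilon> + c * ln (real n))" using n by (simp add: divide_le_eq mult.commute)
      moreover have "real n powr (b * ?d) \<le> real ?m ^ ?d"
      proof -
        have "real n powr (b * ?d) = (real n powr b) ^ ?d" using n by (simp add: powr_realpow[symmetric] powr_powr)
        also have "\<dots> \<le> real ?m ^ ?d" by (rule power_mono[OF threshold_bounds(1)]) simp
        finally show ?thesis .
      qed
      ultimately have "real k / real ?m ^ ?d \<le> real n powr a * (- ln \<epsilon> + c * ln (real n)) / real n powr (b * ?d)"
        by (intro frac_le) (use n in auto)
      also have "\<dots> = real n powr (a - b * ?d) * (- ln \<epsilon> + c * ln (real n))" by (simp add: powr_diff)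
      also have "\<dots> \<le> \<delta> / 4 * real n powr u" by fact
      finally have kk: "real k / real ?m ^ ?d \<le> \<delta> / 4 * real n powr u" .
      have "count_weight TYPE('d) n a b k \<le> bexp (edge_density a n k) ?E (\<lambda>S. of_bool (large_count ?V ?m S \<le> k))"
        unfolding count_weight_def by (rule bexp_mono) (use edge_density_bounds in auto)
      also have "\<dots> \<le> bexp (ps n) ?E (\<lambda>S. of_bool (large_count ?V ?m S \<le> k))"
      proof -
        \<comment> \<open>The event that the count is at most \<open>k\<close> is decreasing, so
          monotonicity in the density is applied to minus its indicator.\<close>
        have "bexp (ps n) ?E (\<lambda>S. - of_bool (large_count ?V ?m S \<le> k)) \<le> bexp (edge_density a n k) ?E (\<lambda>S. - of_bool (large_count ?V ?m S \<le> k))"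
        proof (rule bexp_mono_density)
          fix S T assume "S \<subseteq> T" "T \<subseteq> ?E"
          then have "large_count ?V ?m S \<le> large_count ?V ?m T"
            by (intro large_count_mono finite_box_vertices) (auto intro: finite_subset[OF _ finite_box_edges])
          then show "(- of_bool (large_count ?V ?m S \<le> k) :: real) \<le> - of_bool (large_count ?V ?m T \<le> k)" by auto
        qed (use k elim(2) pc edge_density_bounds finite_box_edges in auto)
        then show ?thesis using bexp_cmult[of _ ?E "-1" "\<lambda>S. of_bool (large_count ?V ?m S \<le> k)"] by simp
      qed
      also have "\<dots> \<le> exp (real k / real ?m ^ ?d - real ?J ^ ?d * theta TYPE('d) (ps n) / 2)"
        by (rule box_lower_tail) (use elim(1,2) pc m in auto)
      also have "\<dots> \<le> exp (\<delta> / 4 * real n powr u - \<delta> * real n powr u)"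
        unfolding exp_le_cancel_iff using kk J by linarith
      finally show ?thesis .
    qed
    have "(\<Sum>k\<le>n ^ ?d. of_bool (ps n \<le> edge_density a n k) * count_weight TYPE('d) n a b k)
      \<le> (1 + real (n ^ ?d)) * exp (\<delta> / 4 * real n powr u - \<delta> * real n powr u)"
      by (rule sum_le_card_times) (use each in auto)
    also have "\<dots> \<le> exp (ln 2 + ?d * ln (real n)) * exp (\<delta> / 4 * real n powr u - \<delta> * real n powr u)"
    proof (rule mult_right_mono)
      have "exp (ln 2 + ?d * ln (real n)) = 2 * real n ^ ?d" using n by (simp add: exp_add exp_of_nat_mult)
      moreover have "1 \<le> real n ^ ?d" using elim(7) by simp
      ultimately show "1 + real (n ^ ?d) \<le> exp (ln 2 + ?d * ln (real n))" by simp
    qed simp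
    also have "\<dots> = exp ((ln 2 + ?d * ln (real n)) + (\<delta> / 4 * real n powr u - \<delta> * real n powr u))" by (simp only: exp_add)
    also have "\<dots> \<le> exp (- (\<delta> / 2 * real n powr u))" using elim(5) n by simp
    finally show ?case .
  qed
  then show ?thesis unfolding ps_def
    using u \<delta> by (intro exI[of _ u] conjI exI[of _ "\<delta> / 2"]) auto
qed

section \<open>Convergence in law\<close>

lemma measure_\<mu>_n_tendsto_0:
  fixes Q :: "nat \<Rightarrow> nat \<Rightarrow> bool"
  assumes "b < u" "0 < u" "0 < \<delta>"
    and sum: "eventually (\<lambda>n. (\<Sum>k\<le>n ^ CARD('d::finite). of_bool (Q n k) * count_weight TYPE('d) n a b k)
      \<le> exp (- (\<delta> * real n powr u))) sequentially"
    and Z: "eventually (\<lambda>n. exp (- (real n powr b * (A + B * ln (real n)))) \<le> Z_n TYPE('d) n a b) sequentially"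
  shows "(\<lambda>n. measure (\<mu>_n n a b) {\<omega> \<in> (box_configs n :: 'd config set). Q n (F_n n b \<omega>)}) \<longlonglongrightarrow> 0"
proof (rule tendsto_sandwich[OF _ _ tendsto_const])
  show "(\<lambda>n. exp (- (\<delta> / 2 * real n powr u))) \<longlonglongrightarrow> 0"
    by (rule tendsto_exp_neg_powr) (use assms in auto)
  have "eventually (\<lambda>n. real n powr b * (A + B * ln (real n)) \<le> \<delta> / 2 * real n powr u) sequentially"
    by (rule eventually_log_powr_le) (use assms in auto)
  with sum Z show "eventually (\<lambda>n. measure (\<mu>_n n a b) {\<omega> \<in> (box_configs n :: 'd config set). Q n (F_n n b \<omega>)}
      \<le> exp (- (\<delta> / 2 * real n powr u))) sequentially"
  proof eventually_elim
    case (elim n)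
    let ?Z = "Z_n TYPE('d) n a b"
    have Z0: "0 < ?Z" using elim(2) by (meson exp_gt_zero less_le_trans)
    have "measure (\<mu>_n n a b) {\<omega> \<in> (box_configs n :: 'd config set). Q n (F_n n b \<omega>)}
      = (\<Sum>k\<le>n ^ CARD('d). of_bool (Q n k) * count_weight TYPE('d) n a b k) / ?Z"
      by (rule measure_\<mu>_n[OF Z0])
    also have "\<dots> \<le> exp (- (\<delta> * real n powr u)) / exp (- (real n powr b * (A + B * ln (real n))))"
      by (rule frac_le) (use elim in auto)
    also have "\<dots> = exp (real n powr b * (A + B * ln (real n)) - \<delta> * real n powr u)"
      by (simp add: exp_diff[symmetric])
    also have "\<dots> \<le> exp (- (\<delta> / 2 * real n powr u))" using elim(3) by simp
    finally show ?case .
  qed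
qed simp

text \<open>The fully open configuration has positive weight at the density given by its own
  count.\<close>

lemma Z_n_pos: "0 < Z_n TYPE('d::finite) n a b"
proof -
  let ?E = "box_edges n :: 'd edge set"
  let ?F = "\<lambda>S. large_count (box_vertices n :: 'd vertex set) (threshold n b) S"
  let ?p = "edge_density a n (?F ?E)"
  have "0 < ?p ^ card ?E" using edge_density_bounds(1) by simp
  also have "\<dots> = ?p ^ card ?E * (1 - ?p) ^ card (?E - ?E) * of_bool (?F ?E = ?F ?E)" by simp
  also have "\<dots> \<le> count_weight TYPE('d) n a b (?F ?E)"
    unfolding count_weight_def bexp_def
    by (rule member_le_sum[of ?E]) (use edge_density_bounds finite_box_edges in auto)
  also have "\<dots> \<le> Z_n TYPE('d) n a b"
    unfolding Z_n_eq
  proof (rule member_le_sum)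
    show "?F ?E \<in> {..n ^ CARD('d)}"
      using large_count_le_card[OF finite_box_vertices[where 'a = 'd]] by (simp add: card_box_vertices)
  qed (use count_weight_nonneg in auto)
  finally show ?thesis .
qed

lemma measure_\<mu>_n_mono:
  assumes "\<And>k. Q k \<Longrightarrow> R k"
  shows "measure (\<mu>_n n a b) {\<omega> \<in> (box_configs n :: 'd::finite config set). Q (F_n n b \<omega>)}
    \<le> measure (\<mu>_n n a b) {\<omega> \<in> (box_configs n :: 'd config set). R (F_n n b \<omega>)}"
  unfolding measure_\<mu>_n[OF Z_n_pos]
  by (intro divide_right_mono sum_mono mult_right_mono count_weight_nonneg)
    (use assms Z_n_pos[where 'd = 'd] in \<open>auto simp: less_imp_le of_bool_def\<close>)

lemma measure_\<mu>_n_not: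
  "measure (\<mu>_n n a b) {\<omega> \<in> (box_configs n :: 'd::finite config set). \<not> Q (F_n n b \<omega>)}
    = 1 - measure (\<mu>_n n a b) {\<omega> \<in> (box_configs n :: 'd config set). Q (F_n n b \<omega>)}"
proof -
  let ?Z = "Z_n TYPE('d) n a b"
  let ?w = "count_weight TYPE('d) n a b"
  have "(\<Sum>k\<le>n ^ CARD('d). of_bool (\<not> Q k) * ?w k) + (\<Sum>k\<le>n ^ CARD('d). of_bool (Q k) * ?w k) = ?Z"
    unfolding sum.distrib[symmetric] Z_n_eq by (rule sum.cong) auto
  then have "(\<Sum>k\<le>n ^ CARD('d). of_bool (\<not> Q k) * ?w k) / ?Z + (\<Sum>k\<le>n ^ CARD('d). of_bool (Q k) * ?w k) / ?Z = 1"
    using Z_n_pos[where 'd = 'd, of n a b] unfolding add_divide_distrib[symmetric] by simp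
  then show ?thesis
    unfolding measure_\<mu>_n[OF Z_n_pos, where Q = Q] measure_\<mu>_n[OF Z_n_pos, where Q = "\<lambda>k. \<not> Q k"] by linarith
qed

lemma cdf_return_0: "cdf (return borel 0) x = (if 0 \<le> x then 1 else 0)"
  by (simp add: cdf_def measure_return)

text \<open>The jump at 0 exempts that point from weak convergence, so only the tails below a
  negative level and above a positive level have to be controlled.\<close>

lemma not_isCont_cdf_return_0: "\<not> isCont (cdf (return borel 0)) 0"
proof
  assume "isCont (cdf (return borel 0)) 0"
  moreover have "(\<lambda>n. - 1 / real (Suc n)) \<longlonglongrightarrow> 0"
    using tendsto_minus[OF LIMSEQ_inverse_real_of_nat] by (simp add: inverse_eq_divide)
  ultimately have "(\<lambda>n. cdf (return borel 0) (- 1 / real (Suc n))) \<longlonglongrightarrow> cdf (return borel 0) 0"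
    by (rule isCont_tendsto_compose)
  then have "(\<lambda>n. 0 :: real) \<longlonglongrightarrow> 1" by (simp add: cdf_return_0 divide_less_0_iff not_le[symmetric])
  then show False using LIMSEQ_unique[OF tendsto_const] by fastforce
qed

theorem theorem2:
  fixes a b c \<beta> \<gamma> :: real
  assumes dim: "CARD('d::finite) \<ge> 2"
    and exponents_pos: "\<beta> > 0" "\<gamma> > 0"
    and theta_exponent:
      "Limsup (at (p_c TYPE('d)) within {p_c TYPE('d)<..1})
         (\<lambda>p. ext_ln (ennreal (theta TYPE('d) p)) / ereal (ln (p - p_c TYPE('d)))) \<le> ereal \<beta>"
    and chi_exponent:
      "Liminf (at (p_c TYPE('d)) within {0..<p_c TYPE('d)})
         (\<lambda>p. ext_ln (chi TYPE('d) p) / ereal (ln (p_c TYPE('d) - p))) \<ge> ereal (- \<gamma>)"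
    and ab: "0 < b" "b < a" "a < real CARD('d)"
    and c: "c < Min {b / (2 * \<gamma>), (a - b) / (2 * \<gamma>), (real CARD('d) - a) / \<beta>,
                     (real CARD('d) - b * real CARD('d) - b) / \<beta>}"
  shows "weak_conv_m
           (\<lambda>n. distr (\<mu>_n n a b :: 'd config measure) borel
              (\<lambda>\<omega>. real n powr c * (p_n n a b \<omega> - p_c TYPE('d))))
           (return borel 0)"
proof -
  let ?pc = "p_c TYPE('d)" and ?d = "real CARD('d)"
  let ?cfg = "\<lambda>n. box_configs n :: 'd config set"
  have pc: "0 \<le> ?pc" "?pc < 1" using p_c_bounds[OF dim] by auto
  define Min4 where "Min4 = Min {b / (2 * \<gamma>), (a - b) / (2 * \<gamma>), (?d - a) / \<beta>, (?d - b * ?d - b) / \<beta>}"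
  define low where "low = (\<lambda>\<epsilon> n k. real n powr c * (edge_density a n k - ?pc) \<le> - \<epsilon>)"
  define high where "high = (\<lambda>\<epsilon> n k. \<epsilon> \<le> real n powr c * (edge_density a n k - ?pc))"
  have low_iff: "low \<epsilon> n k \<longleftrightarrow> edge_density a n k \<le> ?pc - \<epsilon> * real n powr (- c)"
    and high_iff: "high \<epsilon> n k \<longleftrightarrow> ?pc + \<epsilon> * real n powr (- c) \<le> edge_density a n k" if "0 < n" for \<epsilon> n k
    using that by (auto simp: low_def high_def powr_minus field_simps)
  have dev: "(\<lambda>n. measure (\<mu>_n n a b) {\<omega> \<in> ?cfg n. low \<epsilon> n (F_n n b \<omega>)}) \<longlonglongrightarrow> 0
     \<and> (\<lambda>n. measure (\<mu>_n n a b) {\<omega> \<in> ?cfg n. high \<epsilon> n (F_n n b \<omega>)}) \<longlonglongrightarrow> 0"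
    if \<epsilon>: "0 < \<epsilon>" for \<epsilon>
  proof (cases "0 < Min4")
    case True
    \<comment> \<open>A positive exponent \<open>c' \<ge> c\<close> still below the minimum: the
      window for \<open>c'\<close> is contained in the one for \<open>c\<close>, so deviations at
      scale \<open>c\<close> are deviations at scale \<open>c'\<close>.\<close>
    then obtain c' where c': "max c 0 < c'" "c' < Min4" using dense[of "max c 0" Min4] c by (auto simp: Min4_def)
    then have bounds: "c' < b / (2 * \<gamma>)" "c' < (a - b) / (2 * \<gamma>)" "c' < (?d - a) / \<beta>" "c' < (?d - b * ?d - b) / \<beta>"
      by (auto simp: Min4_def)
    have c'0: "0 < c'" "c \<le> c'" using c' by auto
    \<comment> \<open>The fourth bound forces \<open>b < 1\<close>, so that the number of tiles
      grows.\<close>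
    have "0 < ?d - b * ?d - b" using bounds(4) c'0 exponents_pos by (simp add: less_divide_eq) (smt (verit) mult_pos_pos)
    then have "b * ?d < 1 * ?d" using ab(1) by linarith
    then have b1: "b < 1" using dim by (simp only: mult_less_cancel_right)
    \<comment> \<open>The strict inequalities on \<open>c'\<close> leave room for
      \<open>\<gamma>' > \<gamma>\<close> and \<open>\<beta>' > \<beta>\<close>, which absorb the
      subpolynomial corrections hidden in the critical exponents.\<close>
    have "\<gamma> < min (b / (2 * c')) ((a - b) / (2 * c'))" using bounds(1,2) c'0 exponents_pos by (auto simp: field_simps)
    then obtain \<gamma>' where \<gamma>': "\<gamma> < \<gamma>'" "\<gamma>' < min (b / (2 * c')) ((a - b) / (2 * c'))" using dense by blast
    have "\<beta> < min ((?d - a) / c') ((?d - b * ?d - b) / c')" using bounds(3,4) c'0 exponents_pos by (auto simp: field_simps)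
    then obtain \<beta>' where \<beta>': "\<beta> < \<beta>'" "\<beta>' < min ((?d - a) / c') ((?d - b * ?d - b) / c')" using dense by blast
    obtain A B where Z: "eventually (\<lambda>n. exp (- (real n powr b * (A + B * ln (real n)))) \<le> Z_n TYPE('d) n a b) sequentially"
      using eventually_Z_n_ge[OF dim ab b1] by blast
    have weaken: "\<epsilon> * real n powr (- c') \<le> \<epsilon> * real n powr (- c)" if "0 < n" for n
      using c'0(2) \<epsilon> that by (intro mult_left_mono powr_mono) auto
    obtain u \<delta> where u: "b < u" "0 < \<delta>" "eventually (\<lambda>n. (\<Sum>k\<le>n ^ CARD('d).
        of_bool (edge_density a n k \<le> ?pc - \<epsilon> * real n powr (- c')) * count_weight TYPE('d) n a b k)
        \<le> exp (- (\<delta> * real n powr u))) sequentially"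
      using lower_deviation_sum[OF dim ab(1,2) c'0(1) _ _ _ \<epsilon> chi_eventually_le[OF chi_exponent \<gamma>'(1)]]
        \<gamma>' c'0 exponents_pos by (auto simp: field_simps)
    have "eventually (\<lambda>n. (\<Sum>k\<le>n ^ CARD('d). of_bool (low \<epsilon> n k) * count_weight TYPE('d) n a b k)
        \<le> exp (- (\<delta> * real n powr u))) sequentially"
      using u(3) eventually_gt_at_top[of 0]
    proof eventually_elim
      case (elim n)
      have "(\<Sum>k\<le>n ^ CARD('d). of_bool (low \<epsilon> n k) * count_weight TYPE('d) n a b k)
        \<le> (\<Sum>k\<le>n ^ CARD('d). of_bool (edge_density a n k \<le> ?pc - \<epsilon> * real n powr (- c')) * count_weight TYPE('d) n a b k)"
        by (intro sum_mono mult_right_mono count_weight_nonneg)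
          (use weaken[OF elim(2)] low_iff[OF elim(2)] in \<open>auto simp: of_bool_def\<close>)
      then show ?case using elim(1) by linarith
    qed
    then have 1: "(\<lambda>n. measure (\<mu>_n n a b) {\<omega> \<in> ?cfg n. low \<epsilon> n (F_n n b \<omega>)}) \<longlonglongrightarrow> 0"
      using u(1) ab(1) by (intro measure_\<mu>_n_tendsto_0[OF u(1) _ u(2) _ Z, where Q = "low \<epsilon>"]) auto
    obtain v \<delta>2 where v: "b < v" "0 < \<delta>2" "eventually (\<lambda>n. (\<Sum>k\<le>n ^ CARD('d).
        of_bool (?pc + \<epsilon> * real n powr (- c') \<le> edge_density a n k) * count_weight TYPE('d) n a b k)
        \<le> exp (- (\<delta>2 * real n powr v))) sequentially"
      using upper_deviation_sum[OF dim ab(1) b1 c'0(1) _ _ _ \<epsilon> theta_eventually_ge[OF theta_exponent \<beta>'(1)], of a]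
        \<beta>' c'0 exponents_pos by (auto simp: field_simps)
    have "eventually (\<lambda>n. (\<Sum>k\<le>n ^ CARD('d). of_bool (high \<epsilon> n k) * count_weight TYPE('d) n a b k)
        \<le> exp (- (\<delta>2 * real n powr v))) sequentially"
      using v(3) eventually_gt_at_top[of 0]
    proof eventually_elim
      case (elim n)
      have "(\<Sum>k\<le>n ^ CARD('d). of_bool (high \<epsilon> n k) * count_weight TYPE('d) n a b k)
        \<le> (\<Sum>k\<le>n ^ CARD('d). of_bool (?pc + \<epsilon> * real n powr (- c') \<le> edge_density a n k) * count_weight TYPE('d) n a b k)"
        by (intro sum_mono mult_right_mono count_weight_nonneg)
          (use weaken[OF elim(2)] high_iff[OF elim(2)] in \<open>auto simp: of_bool_def\<close>)
      then show ?case using elim(1) by linarith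
    qed
    then have 2: "(\<lambda>n. measure (\<mu>_n n a b) {\<omega> \<in> ?cfg n. high \<epsilon> n (F_n n b \<omega>)}) \<longlonglongrightarrow> 0"
      using v(1) ab(1) by (intro measure_\<mu>_n_tendsto_0[OF v(1) _ v(2) _ Z, where Q = "high \<epsilon>"]) auto
    show ?thesis using 1 2 ..
  next
    case False
    moreover have "c < Min4" using c unfolding Min4_def .
    \<comment> \<open>For negative \<open>c\<close> the claim needs no percolation estimate:
      densities and threshold both lie in the unit interval, so \<open>n powr c\<close> times their
      difference tends to 0 uniformly.\<close>
    ultimately have "c < 0" by linarith
    then have "eventually (\<lambda>n. 2 / \<epsilon> \<le> real n powr (- c)) sequentially" by (intro eventually_nat_powr_ge) simp
    then have empty: "eventually (\<lambda>n. \<forall>k. \<not> low \<epsilon> n k \<and> \<not> high \<epsilon> n k) sequentially"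
      using eventually_gt_at_top[of 0]
    proof eventually_elim
      case (elim n)
      have "2 \<le> \<epsilon> * real n powr (- c)" using elim(1) \<epsilon> by (simp add: divide_le_eq mult.commute)
      then show ?case using pc edge_density_bounds[of a n] unfolding low_iff[OF elim(2)] high_iff[OF elim(2)] by (smt (verit))
    qed
    show ?thesis
    proof
      show "(\<lambda>n. measure (\<mu>_n n a b) {\<omega> \<in> ?cfg n. low \<epsilon> n (F_n n b \<omega>)}) \<longlonglongrightarrow> 0"
        by (rule tendsto_eventually, rule eventually_mono[OF empty]) simp
      show "(\<lambda>n. measure (\<mu>_n n a b) {\<omega> \<in> ?cfg n. high \<epsilon> n (F_n n b \<omega>)}) \<longlonglongrightarrow> 0"
        by (rule tendsto_eventually, rule eventually_mono[OF empty]) simp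
    qed
  qed
  define X where "X = (\<lambda>n (\<omega> :: 'd config). real n powr c * (p_n n a b \<omega> - ?pc))"
  have X: "X n \<omega> = real n powr c * (edge_density a n (F_n n b \<omega>) - ?pc)" for n \<omega>
    by (simp add: X_def p_n_def edge_density_def)
  have sp: "space (\<mu>_n n a b) = ?cfg n" for n by (simp add: \<mu>_n_def space_point_measure)
  have cdf: "cdf (distr (\<mu>_n n a b) borel (X n)) x = measure (\<mu>_n n a b) {\<omega> \<in> ?cfg n. X n \<omega> \<le> x}" for n x
  proof -
    have "X n \<in> borel_measurable (\<mu>_n n a b)" by (simp add: \<mu>_n_def measurable_point_measure_eq1)
    then have "cdf (distr (\<mu>_n n a b) borel (X n)) x = measure (\<mu>_n n a b) (X n -` {..x} \<inter> space (\<mu>_n n a b))"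
      unfolding cdf_def by (rule measure_distr) simp
    also have "X n -` {..x} \<inter> space (\<mu>_n n a b) = {\<omega> \<in> ?cfg n. X n \<omega> \<le> x}" by (auto simp: sp)
    finally show ?thesis .
  qed
  have "weak_conv (\<lambda>n. cdf (distr (\<mu>_n n a b) borel (X n))) (cdf (return borel 0))"
    unfolding weak_conv_def
  proof (intro allI impI)
    fix x assume cont: "isCont (cdf (return borel 0)) x"
    then consider "x < 0" | "0 < x" using not_isCont_cdf_return_0 by (cases x "0 :: real" rule: linorder_cases) auto
    then show "(\<lambda>n. cdf (distr (\<mu>_n n a b) borel (X n)) x) \<longlonglongrightarrow> cdf (return borel 0) x"
    proof cases
      case 1
      then show ?thesis using dev[of "- x"] by (simp add: cdf cdf_return_0 low_def X)
    next
      case 2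
      let ?Q = "\<lambda>n k. real n powr c * (edge_density a n k - ?pc) \<le> x"
      \<comment> \<open>The complement of the event in the distribution function is a strict
        inequality, contained in the event \<open>high\<close> at level \<open>x\<close>.\<close>
      have "(\<lambda>n. measure (\<mu>_n n a b) {\<omega> \<in> ?cfg n. \<not> ?Q n (F_n n b \<omega>)}) \<longlonglongrightarrow> 0"
      proof (rule tendsto_sandwich[OF _ _ tendsto_const])
        show "(\<lambda>n. measure (\<mu>_n n a b) {\<omega> \<in> ?cfg n. high x n (F_n n b \<omega>)}) \<longlonglongrightarrow> 0" using dev[OF 2] by simp
        show "eventually (\<lambda>n. measure (\<mu>_n n a b) {\<omega> \<in> ?cfg n. \<not> ?Q n (F_n n b \<omega>)}
            \<le> measure (\<mu>_n n a b) {\<omega> \<in> ?cfg n. high x n (F_n n b \<omega>)}) sequentially"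
          by (intro always_eventually allI measure_\<mu>_n_mono) (simp add: high_def)
      qed simp
      then have "(\<lambda>n. 1 - measure (\<mu>_n n a b) {\<omega> \<in> ?cfg n. \<not> ?Q n (F_n n b \<omega>)}) \<longlonglongrightarrow> 1 - 0"
        by (intro tendsto_diff tendsto_const)
      moreover have "1 - measure (\<mu>_n n a b) {\<omega> \<in> ?cfg n. \<not> ?Q n (F_n n b \<omega>)} = cdf (distr (\<mu>_n n a b) borel (X n)) x" for n
        using measure_\<mu>_n_not[where 'd = 'd and Q = "?Q n" and n = n and a = a and b = b] by (simp add: cdf X)
      ultimately show ?thesis using 2 by (simp add: cdf_return_0)
    qed
  qed
  then show ?thesis by (simp add: weak_conv_m_def X_def)
qed

end
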